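(* Let $\ell$ be a discretely valued field with residue characteristic zero, let $f\in\ell(z)$ be a rational function of degree $d\ge2$, and let $k$ be a minimal complete algebraically closed non-Archimedean extension of $\ell$. For every vertex set $\Gamma$ in $\mathbf{P}^1_{\mathrm{Berk},k}$ there exists a vertex set $\Gamma'\supseteq\Gamma$ such that $(f,\Gamma')$ is analytically stable. Moreover, if every element of $\Gamma$ is $\ell$-split, then $\Gamma'$ may be chosen so that every element of $\Gamma'$ is $\ell$-split.
   Context: $\mathbf{P}^1_{\mathrm{Berk},k}$ is the Berkovich projective line over $k$ (the completion of an algebraic closure of the completion $\hat\ell$). A vertex set is a finite nonempty set $\Gamma$ of type II points; connected components of the complement of $\Gamma$ are $\Gamma$-domains. A $\Gamma$-domain $U$ is an $F$-domain if $f^n(U)\cap\Gamma=\varnothing$ for all $n\ge1$. $(f,\Gamma)$ is analytically stable if for each $\zeta\in\Gamma$, either $f(\zeta)\in\Gamma$ or $f(\zeta)$ lies in some $F$-domain. A type II point $\zeta$ is $\ell$-split if $\zeta=\zeta_{a,r}$ (the sup-norm point of the closed disk $\{x\in k:|x-a|\le r\}$) for some $a\in\ell$ and $r\in|\ell^\times|$; a vertex set is $\ell$-split if all its elements are. *)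

theory Defs
  imports "HOL-Analysis.Analysis" "HOL-Computational_Algebra.Polynomial"
begin

definition nonarch_abs :: "('k::field \<Rightarrow> real) \<Rightarrow> bool" where
  "nonarch_abs absv \<longleftrightarrow>
     (\<forall>x. absv x \<ge> 0) \<and> (\<forall>x. absv x = 0 \<longleftrightarrow> x = 0) \<and>
     (\<forall>x y. absv (x * y) = absv x * absv y) \<and>
     (\<forall>x y. absv (x + y) \<le> max (absv x) (absv y))"

definition is_subfield :: "'k::field set \<Rightarrow> bool" where
  "is_subfield K \<longleftrightarrow> 0 \<in> K \<and> 1 \<in> K \<and>
     (\<forall>x\<in>K. \<forall>y\<in>K. x + y \<in> K \<and> x - y \<in> K \<and> x * y \<in> K) \<and>
     (\<forall>x\<in>K. inverse x \<in> K)"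

definition complete_wrt :: "('k::field \<Rightarrow> real) \<Rightarrow> 'k set \<Rightarrow> bool" where
  "complete_wrt absv K \<longleftrightarrow>
     (\<forall>X::nat \<Rightarrow> 'k. (\<forall>n. X n \<in> K) \<longrightarrow>
        (\<forall>e>0. \<exists>N. \<forall>m\<ge>N. \<forall>n\<ge>N. absv (X m - X n) < e) \<longrightarrow>
        (\<exists>x\<in>K. (\<lambda>n. absv (X n - x)) \<longlonglongrightarrow> 0))"

definition alg_closed_in :: "'k::field set \<Rightarrow> bool" where
  "alg_closed_in K \<longleftrightarrow>
     (\<forall>p::'k poly. (\<forall>i. coeff p i \<in> K) \<longrightarrow> degree p \<ge> 1 \<longrightarrow> (\<exists>x\<in>K. poly p x = 0))"

definition discretely_valued :: "('k::field \<Rightarrow> real) \<Rightarrow> 'k set \<Rightarrow> bool" where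
  "discretely_valued absv L \<longleftrightarrow>
     (\<exists>\<pi>\<in>L. 0 < absv \<pi> \<and> absv \<pi> < 1 \<and>
        (\<forall>x\<in>L. x \<noteq> 0 \<longrightarrow> (\<exists>n::int. absv x = absv \<pi> powi n)))"

text \<open>Residue characteristic zero: no positive integer n lies in the maximal ideal,
  i.e. |n| = 1 for all n \<ge> 1.\<close>
definition residue_char_zero :: "('k::field \<Rightarrow> real) \<Rightarrow> bool" where
  "residue_char_zero absv \<longleftrightarrow> (\<forall>n::nat. n \<ge> 1 \<longrightarrow> absv (of_nat n) = 1)"

definition minimal_CAC_extension :: "('k::field \<Rightarrow> real) \<Rightarrow> 'k set \<Rightarrow> bool" where
  "minimal_CAC_extension absv L \<longleftrightarrow>
     complete_wrt absv UNIV \<and> alg_closed_in (UNIV :: 'k set) \<and>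
     (\<forall>K. is_subfield K \<longrightarrow> L \<subseteq> K \<longrightarrow> complete_wrt absv K \<longrightarrow> alg_closed_in K
          \<longrightarrow> K = UNIV)"

definition berk_A1 :: "('k::field \<Rightarrow> real) \<Rightarrow> ('k poly \<Rightarrow> real) set" where
  "berk_A1 absv = {\<zeta>. (\<forall>p. \<zeta> p \<ge> 0) \<and>
       (\<forall>p q. \<zeta> (p * q) = \<zeta> p * \<zeta> q) \<and>
       (\<forall>p q. \<zeta> (p + q) \<le> max (\<zeta> p) (\<zeta> q)) \<and>
       (\<forall>c. \<zeta> [:c:] = absv c)}"

text \<open>Berkovich projective line: None is the point at infinity.\<close>
definition berk_P1 :: "('k::field \<Rightarrow> real) \<Rightarrow> ('k poly \<Rightarrow> real) option set" where
  "berk_P1 absv = insert None (Some ` berk_A1 absv)"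

definition berk_A1_top :: "('k::field \<Rightarrow> real) \<Rightarrow> ('k poly \<Rightarrow> real) topology" where
  "berk_A1_top absv = subtopology
     (topology_generated_by {{\<zeta> \<in> berk_A1 absv. a < \<zeta> g \<and> \<zeta> g < b} | g a b. True})
     (berk_A1 absv)"

text \<open>Topology on the projective line: the one-point compactification of the affine line.\<close>
definition berk_P1_top :: "('k::field \<Rightarrow> real) \<Rightarrow> ('k poly \<Rightarrow> real) option topology" where
  "berk_P1_top absv = subtopology
     (topology_generated_by
        ({Some ` V | V. openin (berk_A1_top absv) V} \<union>
         {insert None (Some ` (berk_A1 absv - K)) | K.
             compactin (berk_A1_top absv) K \<and> closedin (berk_A1_top absv) K}))
     (berk_P1 absv)"

definition zeta1 :: "('k::field \<Rightarrow> real) \<Rightarrow> 'k \<Rightarrow> ('k poly \<Rightarrow> real)" where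
  "zeta1 absv a = (\<lambda>g. absv (poly g a))"

definition zeta_disk :: "('k::field \<Rightarrow> real) \<Rightarrow> 'k \<Rightarrow> real \<Rightarrow> ('k poly \<Rightarrow> real)" where
  "zeta_disk absv a r = (\<lambda>g. Sup ((\<lambda>x. absv (poly g x)) ` {x. absv (x - a) \<le> r}))"

definition value_group :: "('k::field \<Rightarrow> real) \<Rightarrow> 'k set \<Rightarrow> real set" where
  "value_group absv K = {absv c | c. c \<in> K \<and> c \<noteq> 0}"

definition type_II :: "('k::field \<Rightarrow> real) \<Rightarrow> ('k poly \<Rightarrow> real) option \<Rightarrow> bool" where
  "type_II absv \<zeta> \<longleftrightarrow> (\<exists>a r. r \<in> value_group absv UNIV \<and> \<zeta> = Some (zeta_disk absv a r))"

definition l_split :: "('k::field \<Rightarrow> real) \<Rightarrow> 'k set \<Rightarrow> ('k poly \<Rightarrow> real) option \<Rightarrow> bool" where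
  "l_split absv L \<zeta> \<longleftrightarrow> (\<exists>a\<in>L. \<exists>r\<in>value_group absv L. \<zeta> = Some (zeta_disk absv a r))"

definition vertex_set :: "('k::field \<Rightarrow> real) \<Rightarrow> ('k poly \<Rightarrow> real) option set \<Rightarrow> bool" where
  "vertex_set absv \<Gamma> \<longleftrightarrow> finite \<Gamma> \<and> \<Gamma> \<noteq> {} \<and> (\<forall>\<zeta>\<in>\<Gamma>. type_II absv \<zeta>)"

text \<open>Q^(deg g) * g(P/Q), a polynomial.\<close>
definition hcomp :: "'k::field poly \<Rightarrow> 'k poly \<Rightarrow> 'k poly \<Rightarrow> 'k poly" where
  "hcomp P Q g = (\<Sum>i\<le>degree g. smult (coeff g i) (P ^ i * Q ^ (degree g - i)))"

text \<open>Standard action: [g]_{f(\<zeta>)} = [g \<circ> f]_\<zeta>; f(\<zeta>) = \<infinity> iff [Q]_\<zeta> = 0;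
  f(\<infinity>) is the type I point lim_{z\<rightarrow>\<infinity>} f(z).\<close>
definition berk_map :: "('k::field \<Rightarrow> real) \<Rightarrow> 'k poly \<Rightarrow> 'k poly
     \<Rightarrow> ('k poly \<Rightarrow> real) option \<Rightarrow> ('k poly \<Rightarrow> real) option" where
  "berk_map absv P Q \<zeta> =
     (case \<zeta> of
        None \<Rightarrow> (if degree P > degree Q then None
                 else Some (zeta1 absv (if degree P = degree Q then lead_coeff P / lead_coeff Q else 0)))
      | Some z \<Rightarrow> (if z Q = 0 then None
                   else Some (\<lambda>g. z (hcomp P Q g) / (z Q) ^ degree g)))"

definition Gamma_domains :: "('k::field \<Rightarrow> real) \<Rightarrow> ('k poly \<Rightarrow> real) option set
     \<Rightarrow> ('k poly \<Rightarrow> real) option set set" where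
  "Gamma_domains absv \<Gamma> =
     connected_components_of (subtopology (berk_P1_top absv) (berk_P1 absv - \<Gamma>))"

definition F_domain :: "('k::field \<Rightarrow> real) \<Rightarrow> 'k poly \<Rightarrow> 'k poly
     \<Rightarrow> ('k poly \<Rightarrow> real) option set \<Rightarrow> ('k poly \<Rightarrow> real) option set \<Rightarrow> bool" where
  "F_domain absv P Q \<Gamma> U \<longleftrightarrow> U \<in> Gamma_domains absv \<Gamma> \<and>
     (\<forall>n\<ge>1. (berk_map absv P Q ^^ n) ` U \<inter> \<Gamma> = {})"

definition analytically_stable :: "('k::field \<Rightarrow> real) \<Rightarrow> 'k poly \<Rightarrow> 'k poly
     \<Rightarrow> ('k poly \<Rightarrow> real) option set \<Rightarrow> bool" where
  "analytically_stable absv P Q \<Gamma> \<longleftrightarrow>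
     (\<forall>\<zeta>\<in>\<Gamma>. berk_map absv P Q \<zeta> \<in> \<Gamma> \<or>
        (\<exists>U. F_domain absv P Q \<Gamma> U \<and> berk_map absv P Q \<zeta> \<in> U))"

end

theory Submission
  imports Defs "HOL-Algebra.Finite_Extensions"
begin

text \<open>
  The \<open>\<ell>\<close>-split points form a discrete tree that \<open>f\<close> maps into itself. Let \<open>S\<close> be a finite set
  containing \<open>0\<close>, the zeros and poles of \<open>f\<close>, its finite critical points, and the centres of the
  given vertices. In residue characteristic zero \<open>f\<close> is linear on every disk avoiding \<open>S\<close>. The
  depth of a point is its distance to the hull of \<open>S\<close> and \<open>\<infinity>\<close>. Given a split point \<open>x\<close> with infinite
  orbit, consider the times \<open>n\<close> at which the depth of \<open>f^n(x)\<close> is minimal among all later times, and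
  project \<open>f^n(x)\<close> to a point \<open>\<rho>(n)\<close> of the hull. The direction at \<open>\<rho>(n)\<close> towards \<open>f^n(x)\<close> is then
  mapped forward univalently, without ever meeting the hull.

  If \<open>\<rho>(n) = \<rho>(n')\<close> for two such times, then either \<open>\<rho>(n)\<close> is periodic and the orbit of this direction
  is bounded by the cycle of \<open>\<rho>(n)\<close>, or the direction returns into itself. Otherwise the points \<open>\<rho>(n)\<close>
  are pairwise distinct; the hull being locally finite, they run into one of its finitely many
  ends, and a small disk around that end returns into itself. In all cases the orbit of \<open>x\<close> enters
  a forward invariant open set that avoids the given vertices and is bounded by finitely many split
  points. Adjoining these boundary points and the orbits up to their entry into the invariant
  sets gives an analytically stable vertex set.

  Points of type II are split over a finite extension of \<open>\<ell>\<close>, because by minimality of \<open>k\<close> the elements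
  algebraic over \<open>\<ell>\<close> are dense; such an extension is again discretely valued.
\<close>

hide_const (open) Polynomials.degree Polynomials.lead_coeff Coset.order up_ring.coeff up_ring.monom module.smult

section \<open>Multiplicative seminorms and type II points\<close>

text \<open>Closing the vertex set under \<open>f\<close> fails when an orbit is infinite, and
  adjoining the boundary of an invariant open set creates new vertices whose orbits raise the same
  problem. A \<open>trap\<close> therefore demands that each of its boundary points has a finite
  orbit or enters the trap, so that one round of adjoining suffices. The centres of the given
  vertices are marked so that these vertices lie on the hull: a disk avoiding \<open>S\<close> then
  misses them, and near an end only hull points in a fixed range of levels have to be avoided. At a
  time of minimal later depth, the disks between \<open>f^n(x)\<close> and the hull and all their
  images along the orbit avoid \<open>S\<close>, so \<open>f\<close> acts on this whole path by
  shifting levels. Discreteness enters twice: a strict inequality between values of \<open>L\<close>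
  gains a whole level, and finitely many marked points leave finitely many candidates for the
  projections in a bounded range of levels.\<close>

locale nonarch_closed =
  fixes absv :: "'k::field \<Rightarrow> real"
  assumes nonarch: "nonarch_abs absv"
    and alg_closed: "alg_closed_in (UNIV :: 'k set)"
    and res_char_zero: "residue_char_zero absv"
begin

abbreviation lin :: "'k \<Rightarrow> 'k poly" where "lin c \<equiv> [:-c, 1:]"

declare mult_pCons_left [simp del] mult_pCons_right [simp del]

lemma abs_nonneg [simp]: "0 \<le> absv x"
  using nonarch by (auto simp: nonarch_abs_def)

lemma abs_eq_0_iff [simp]: "absv x = 0 \<longleftrightarrow> x = 0"
  using nonarch by (auto simp: nonarch_abs_def)

lemma abs_pos_iff [simp]: "0 < absv x \<longleftrightarrow> x \<noteq> 0"
  using abs_nonneg[of x] abs_eq_0_iff[of x] by linarith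

lemma abs_0 [simp]: "absv 0 = 0"
  using nonarch by (auto simp: nonarch_abs_def)

lemma abs_mult: "absv (x * y) = absv x * absv y"
  using nonarch by (auto simp: nonarch_abs_def)

lemma abs_add_le_max: "absv (x + y) \<le> max (absv x) (absv y)"
  using nonarch by (auto simp: nonarch_abs_def)

lemma abs_one [simp]: "absv 1 = 1"
  using abs_mult[of 1 1] abs_eq_0_iff[of 1] by (metis mult.right_neutral mult_cancel_left zero_neq_one)

lemma abs_minus [simp]: "absv (- x) = absv x"
proof -
  have "absv (-1) * absv (-1) = 1" using abs_mult[of "-1" "-1"] by simp
  then have "absv (-1) = 1" using abs_nonneg[of "-1"] square_eq_1_iff[of "absv (-1)"] by fastforce
  then show ?thesis using abs_mult[of "-1" x] by simp
qed

lemma abs_minus_commute: "absv (x - y) = absv (y - x)"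
  using abs_minus[of "x - y"] by simp

lemma abs_power: "absv (x ^ n) = absv x ^ n"
  by (induction n) (auto simp: abs_mult)

lemma abs_inverse: "absv (inverse x) = inverse (absv x)"
proof (cases "x = 0")
  case False
  then have "absv x * absv (inverse x) = 1" using abs_mult[of x "inverse x"] by simp
  then show ?thesis by (simp add: inverse_unique)
qed simp

lemma abs_divide: "absv (x / y) = absv x / absv y"
  by (simp add: divide_inverse abs_mult abs_inverse)

lemma abs_diff_le_max: "absv (x - y) \<le> max (absv x) (absv y)"
  using abs_add_le_max[of x "- y"] by simp

lemma abs_diff_triangle: "absv (x - z) \<le> max (absv (x - y)) (absv (y - z))"
  using abs_add_le_max[of "x - y" "y - z"] by simp

lemma abs_add_eq_right: "absv x < absv y \<Longrightarrow> absv (x + y) = absv y"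
  using abs_add_le_max[of x y] abs_diff_le_max[of "x + y" x] by (simp add: max_def split: if_splits)

lemma abs_diff_eq_right: "absv x < absv y \<Longrightarrow> absv (x - y) = absv y"
  using abs_add_eq_right[of x "- y"] by simp

lemma abs_diff_eq_left: "absv x < absv y \<Longrightarrow> absv (y - x) = absv y"
  using abs_diff_eq_right[of x y] by (simp add: abs_minus_commute)

lemma abs_sum_le:
  assumes "\<And>i. i \<in> I \<Longrightarrow> absv (g i) \<le> B" "0 \<le> B"
  shows "absv (sum g I) \<le> B"
  using assms(1)
proof (induction I rule: infinite_finite_induct)
  case (insert i I)
  then show ?case using abs_add_le_max[of "g i" "sum g I"] by force
qed (use assms(2) in auto)

lemma abs_of_nat_le: "absv (of_nat n) \<le> 1"
proof (cases "n = 0")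
  case False
  then have "n \<ge> 1" by simp
  then have "absv (of_nat n) = 1" using res_char_zero unfolding residue_char_zero_def by blast
  then show ?thesis by simp
qed simp

lemma abs_of_nat: "n \<ge> 1 \<Longrightarrow> absv (of_nat n) = 1"
  using res_char_zero by (auto simp: residue_char_zero_def)

text \<open>Polynomials over an algebraically closed field split, so estimates on multiplicative
  seminorms reduce to linear factors; in particular a seminorm is determined by its values on the
  \<open>lin c\<close>.\<close>

lemma linear_factor_induct [case_names zero const mult]:
  fixes p :: "'k poly"
  assumes zero: "A 0" and const: "\<And>c. c \<noteq> 0 \<Longrightarrow> A [:c:]"
    and mult: "\<And>c p. p \<noteq> 0 \<Longrightarrow> A p \<Longrightarrow> A (lin c * p)"
  shows "A p"
proof (induction "degree p" arbitrary: p)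
  case 0
  then obtain c where "p = [:c:]" by (metis degree_eq_zeroE)
  then show ?case using zero const[of c] by (cases "c = 0") auto
next
  case (Suc n)
  then obtain c where "poly p c = 0"
    using alg_closed unfolding alg_closed_in_def by (metis UNIV_I le_add1 plus_1_eq_Suc)
  then obtain q where q: "p = lin c * q" by (metis dvd_def poly_eq_0_iff_dvd)
  with Suc have "q \<noteq> 0" by auto
  then have "degree p = Suc (degree q)" unfolding q by (subst degree_mult_eq) auto
  then show ?case using Suc q mult \<open>q \<noteq> 0\<close> by auto
qed

abbreviation "A1 \<equiv> berk_A1 absv"

lemma A1_nonneg: "\<xi> \<in> A1 \<Longrightarrow> 0 \<le> \<xi> p"
  and A1_mult: "\<xi> \<in> A1 \<Longrightarrow> \<xi> (p * q) = \<xi> p * \<xi> q"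
  and A1_add_le: "\<xi> \<in> A1 \<Longrightarrow> \<xi> (p + q) \<le> max (\<xi> p) (\<xi> q)"
  and A1_const: "\<xi> \<in> A1 \<Longrightarrow> \<xi> [:c:] = absv c"
  by (auto simp: berk_A1_def)

lemma A1_0: "\<xi> \<in> A1 \<Longrightarrow> \<xi> 0 = 0"
  using A1_const[of \<xi> 0] by simp

lemma A1_1: "\<xi> \<in> A1 \<Longrightarrow> \<xi> 1 = 1"
  using A1_const[of \<xi> 1] by (simp add: one_pCons)

lemma A1_smult: "\<xi> \<in> A1 \<Longrightarrow> \<xi> (smult c p) = absv c * \<xi> p"
  using A1_mult[of \<xi> "[:c:]" p] A1_const[of \<xi> c] by (simp add: mult_pCons_left)

lemma A1_minus: "\<xi> \<in> A1 \<Longrightarrow> \<xi> (- p) = \<xi> p"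
  using A1_smult[of \<xi> "-1" p] by simp

lemma A1_diff_le: "\<xi> \<in> A1 \<Longrightarrow> \<xi> (p - q) \<le> max (\<xi> p) (\<xi> q)"
  using A1_add_le[of \<xi> p "- q"] A1_minus[of \<xi> q] by simp

lemma A1_add_eq_right: "\<xi> \<in> A1 \<Longrightarrow> \<xi> p < \<xi> q \<Longrightarrow> \<xi> (p + q) = \<xi> q"
  using A1_add_le[of \<xi> p q] A1_diff_le[of \<xi> "p + q" p] by (simp add: max_def split: if_splits)

lemma A1_power: "\<xi> \<in> A1 \<Longrightarrow> \<xi> (p ^ n) = \<xi> p ^ n"
  by (induction n) (auto simp: A1_mult A1_1)

lemma A1_lin_le: "\<xi> \<in> A1 \<Longrightarrow> \<xi> (lin c) \<le> max (\<xi> (lin a)) (absv (a - c))"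
  using A1_add_le[of \<xi> "lin a" "[:a - c:]"] A1_const[of \<xi> "a - c"] by simp

lemma A1_lin_eq_abs: "\<xi> \<in> A1 \<Longrightarrow> \<xi> (lin a) < absv (a - c) \<Longrightarrow> \<xi> (lin c) = absv (a - c)"
  using A1_add_eq_right[of \<xi> "lin a" "[:a - c:]"] A1_const[of \<xi> "a - c"] by simp

lemma A1_lin_eq_lin: "\<xi> \<in> A1 \<Longrightarrow> absv (a - c) < \<xi> (lin a) \<Longrightarrow> \<xi> (lin c) = \<xi> (lin a)"
  using A1_add_eq_right[of \<xi> "[:a - c:]" "lin a"] A1_const[of \<xi> "a - c"] by simp

lemma A1_mono:
  assumes "\<xi> \<in> A1" "\<xi>' \<in> A1" "\<And>c. \<xi> (lin c) \<le> \<xi>' (lin c)"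
  shows "\<xi> p \<le> \<xi>' p"
proof (induction p rule: linear_factor_induct)
  case (mult c p)
  then show ?case using assms A1_nonneg by (auto simp: A1_mult intro!: mult_mono)
qed (use assms in \<open>auto simp: A1_const A1_0\<close>)

lemma A1_eqI:
  assumes "\<xi> \<in> A1" "\<xi>' \<in> A1" "\<And>c. \<xi> (lin c) = \<xi>' (lin c)"
  shows "\<xi> = \<xi>'"
  using A1_mono[OF assms(1,2)] A1_mono[OF assms(2,1)] assms(3) by (auto intro!: ext antisym)

lemma A1_eq_eval:
  assumes "\<xi> \<in> A1" "\<And>c. poly p c = 0 \<Longrightarrow> \<xi> (lin c) = absv (a - c)"
  shows "\<xi> p = absv (poly p a)"
  using assms(2)
proof (induction p rule: linear_factor_induct)
  case (mult c p)
  then show ?case using assms(1) by (simp add: A1_mult abs_mult)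
qed (use assms in \<open>auto simp: A1_const A1_0\<close>)

lemma A1_eval_no_zero:
  assumes "\<xi> \<in> A1" "\<xi> (lin a) < r" "\<And>c. poly p c = 0 \<Longrightarrow> r \<le> absv (a - c)"
  shows "\<xi> p = absv (poly p a)"
  using assms(2,3) by (intro A1_eq_eval[OF assms(1)] A1_lin_eq_abs[OF assms(1)]) force

lemma A1_eval_outside:
  assumes "\<xi> \<in> A1" "p \<noteq> 0" "\<And>c. poly p c = 0 \<Longrightarrow> \<xi> (lin c) = \<xi> (lin a)"
  shows "\<xi> p = absv (lead_coeff p) * \<xi> (lin a) ^ degree p"
  using assms(2,3)
proof (induction p rule: linear_factor_induct)
  case (mult c p)
  have "degree (lin c * p) = Suc (degree p)" using mult(1) by (simp add: degree_mult_eq)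
  moreover have "lead_coeff (lin c * p) = lead_coeff p" by (subst lead_coeff_mult) simp
  ultimately show ?case using mult assms(1) by (simp add: A1_mult)
qed (use assms in \<open>auto simp: A1_const A1_0\<close>)

lemma zeta1_A1: "zeta1 absv a \<in> A1"
  by (auto simp: berk_A1_def zeta1_def abs_mult abs_add_le_max)

section \<open>Sup norms of closed disks and generic points\<close>

abbreviation "VG \<equiv> value_group absv UNIV"
abbreviation "Z \<equiv> zeta_disk absv"

lemma VG_pos: "r \<in> VG \<Longrightarrow> 0 < r"
  by (auto simp: value_group_def)

lemma UNIV_subfield: "is_subfield UNIV"
  by (simp add: is_subfield_def)

text \<open>The residue field is infinite, since the integers have pairwise distinct residues.\<close>
lemma exists_generic:
  assumes K: "is_subfield K" "a \<in> K" "r \<in> value_group absv K" and "finite C"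
  obtains x where "x \<in> K" "absv (x - a) \<le> r"
    "\<And>c. c \<in> C \<Longrightarrow> absv (x - c) = max r (absv (a - c))"
proof -
  obtain \<rho> where \<rho>: "\<rho> \<in> K" "\<rho> \<noteq> 0" "absv \<rho> = r" using K(3) by (auto simp: value_group_def)
  have r: "0 < r" using \<rho> by auto
  \<comment> \<open>These points have pairwise distance exactly \<open>r\<close>, so an open disk of
    radius \<open>r\<close> around a given \<open>c\<close> contains at most one of them.\<close>
  define x where "x n = a + \<rho> * of_nat n" for n
  have "of_nat n \<in> K" for n using K(1) by (induction n) (auto simp: is_subfield_def)
  then have xK: "x n \<in> K" for n using K \<rho>(1) by (auto simp: x_def is_subfield_def)
  have dx: "absv (x m - x n) = r" if "m < n" for m n
  proof -
    have "x n - x m = \<rho> * of_nat (n - m)" using that by (simp add: x_def of_nat_diff algebra_simps)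
    then show ?thesis using that \<rho> abs_of_nat[of "n - m"] by (simp add: abs_mult abs_minus_commute[of "x m"])
  qed
  have xa: "absv (x n - a) \<le> r" for n
    using \<rho> abs_of_nat_le[of n] r by (simp add: x_def abs_mult mult_left_le)
  define bad where "bad c = {n. absv (x n - c) < r}" for c
  have "finite (bad c)" for c
  proof (rule ccontr)
    assume inf: "infinite (bad c)"
    then obtain m where m: "m \<in> bad c" by (metis finite.emptyI ex_in_conv)
    obtain n where n: "n \<in> bad c" "m < n" using inf by (metis infinite_nat_iff_unbounded)
    have "absv (x m - x n) < r"
      using abs_diff_triangle[of "x m" "x n" c] m n by (auto simp: bad_def abs_minus_commute[of c])
    then show False using dx[OF n(2)] by simp
  qed
  then have "finite (\<Union>c\<in>C. bad c)" using assms(4) by auto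
  then obtain n where n: "n \<notin> (\<Union>c\<in>C. bad c)" by (meson ex_new_if_finite infinite_UNIV_nat)
  show thesis
  proof (rule that[of "x n"])
    show "x n \<in> K" "absv (x n - a) \<le> r" by (rule xK xa)+
    fix c assume "c \<in> C"
    then have "r \<le> absv (x n - c)" using n by (auto simp: bad_def not_less)
    moreover have "absv (x n - c) \<le> max r (absv (a - c))"
      using abs_diff_triangle[of "x n" c a] xa[of n] by auto
    moreover have "absv (x n - c) = absv (a - c)" if "absv (a - c) > r"
      using abs_add_eq_right[of "x n - a" "a - c"] xa[of n] that by auto
    ultimately show "absv (x n - c) = max r (absv (a - c))" by (smt (verit) max_def)
  qed
qed

text \<open>Maximum principle: a point of the disk that is as far as possible from each zero of
  \<open>p\<close> maximises all linear factors at once, so the supremum is attained there.\<close>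

lemma zeta_disk_eq_eval:
  assumes "absv (x - a) \<le> r" "\<And>c. poly p c = 0 \<Longrightarrow> absv (x - c) = max r (absv (a - c))"
  shows "Z a r p = absv (poly p x)"
  unfolding zeta_disk_def
proof (rule cSup_eq_maximum)
  show "absv (poly p x) \<in> (\<lambda>x. absv (poly p x)) ` {x. absv (x - a) \<le> r}" using assms(1) by auto
  fix t assume "t \<in> (\<lambda>x. absv (poly p x)) ` {x. absv (x - a) \<le> r}"
  then obtain y where y: "t = absv (poly p y)" "absv (y - a) \<le> r" by auto
  have "absv (poly p y) \<le> absv (poly p x)" using assms(2)
  proof (induction p rule: linear_factor_induct)
    case (mult c p)
    have "absv (y - c) \<le> absv (x - c)"
      using mult(3)[of c] abs_diff_triangle[of y c a] y(2) by (auto simp: max_def split: if_splits)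
    moreover have "absv (poly p y) \<le> absv (poly p x)" using mult by simp
    ultimately show ?case
      using mult_mono[of "absv (y - c)" "absv (x - c)" "absv (poly p y)" "absv (poly p x)"]
      by (simp add: abs_mult)
  qed auto
  then show "t \<le> absv (poly p x)" using y by simp
qed

text \<open>One point computes finitely many sup norms, which turns relations between them into
  relations of absolute values. That it can be taken in \<open>K\<close> is what keeps images of
  split points split.\<close>

lemma exists_generic_polys:
  assumes K: "is_subfield K" "a \<in> K" "r \<in> value_group absv K" and "finite F"
  obtains x where "x \<in> K" "absv (x - a) \<le> r" "\<And>p. p \<in> F \<Longrightarrow> Z a r p = absv (poly p x)"
proof -
  have "finite (\<Union>p\<in>F - {0}. {c. poly p c = 0})" using assms(4) by (auto intro: poly_roots_finite)
  then obtain x where x: "x \<in> K" "absv (x - a) \<le> r"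
    "\<And>c. c \<in> (\<Union>p\<in>F - {0}. {c. poly p c = 0}) \<Longrightarrow> absv (x - c) = max r (absv (a - c))"
    using exists_generic[OF K] by metis
  have z0: "Z a r 0 = 0"
  proof -
    have "(\<lambda>x. absv (poly 0 x)) ` {x. absv (x - a) \<le> r} = {0}" using x(2) by auto
    then show ?thesis unfolding zeta_disk_def by (metis cSup_singleton)
  qed
  have "Z a r p = absv (poly p x)" if "p \<in> F" for p
  proof (cases "p = 0")
    case False
    show ?thesis
    proof (rule zeta_disk_eq_eval[OF x(2)])
      fix c assume "poly p c = 0"
      then show "absv (x - c) = max r (absv (a - c))" using False that by (intro x(3)) blast
    qed
  qed (simp add: z0)
  then show thesis by (rule that[OF x(1,2)])
qed

lemma zeta_A1: assumes "r \<in> VG" shows "Z a r \<in> A1"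
proof -
  have "0 \<le> Z a r p \<and> Z a r (p * q) = Z a r p * Z a r q \<and> Z a r (p + q) \<le> max (Z a r p) (Z a r q)"
    for p q
  proof -
    \<comment> \<open>A point generic for all four polynomials transfers the axioms from
      \<open>absv\<close>; multiplicativity is Gauss's lemma.\<close>
    obtain x where "\<And>s. s \<in> {p, q, p * q, p + q} \<Longrightarrow> Z a r s = absv (poly s x)"
      using exists_generic_polys[OF UNIV_subfield UNIV_I assms, of "{p, q, p * q, p + q}"] by (metis finite.emptyI finite.insertI)
    then show ?thesis by (simp add: abs_mult abs_add_le_max)
  qed
  moreover have "Z a r [:c:] = absv c" for c
    using exists_generic_polys[OF UNIV_subfield UNIV_I assms, of "{[:c:]}"] by force
  ultimately show ?thesis by (auto simp: berk_A1_def)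
qed

lemma zeta_lin:
  assumes "r \<in> VG"
  shows "Z a r (lin c) = max r (absv (a - c))"
proof -
  obtain x where "absv (x - a) \<le> r" "absv (x - c) = max r (absv (a - c))"
    using exists_generic[OF UNIV_subfield UNIV_I assms, of "{c}"] by (metis finite.emptyI finite.insertI singletonI)
  then show ?thesis by (subst zeta_disk_eq_eval[of x]) auto
qed

lemma zeta_lin_self: "r \<in> VG \<Longrightarrow> Z a r (lin a) = r"
  using VG_pos by (simp add: zeta_lin max_def) (meson less_le not_le)

lemma zeta_eqI:
  assumes "\<xi> \<in> A1" "r \<in> VG" "\<And>c. \<xi> (lin c) = max r (absv (a - c))"
  shows "\<xi> = Z a r"
  using assms by (intro A1_eqI) (auto simp: zeta_A1 zeta_lin)

lemma zeta_in_VG: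
  assumes "r \<in> VG" "p \<noteq> 0"
  shows "Z a r p \<in> VG"
  using assms(2)
proof (induction p rule: linear_factor_induct)
  case (mult c p)
  obtain x where x: "absv (x - a) \<le> r" "absv (x - c) = max r (absv (a - c))"
    using exists_generic[OF UNIV_subfield UNIV_I assms(1), of "{c}"] by (metis finite.emptyI finite.insertI singletonI)
  then have "x - c \<noteq> 0" using VG_pos[OF assms(1)] by force
  moreover obtain d where "Z a r p = absv d" "d \<noteq> 0" using mult by (auto simp: value_group_def)
  ultimately have "Z a r (lin c * p) = absv ((x - c) * d)" "(x - c) * d \<noteq> 0"
    using x zeta_lin[OF assms(1)] by (auto simp: A1_mult[OF zeta_A1[OF assms(1)]] abs_mult)
  then show ?case unfolding value_group_def by blast
next
  case (const c)
  then show ?case using A1_const[OF zeta_A1[OF assms(1)]] by (auto simp: value_group_def)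
qed auto

lemma zeta_pos: "r \<in> VG \<Longrightarrow> p \<noteq> 0 \<Longrightarrow> 0 < Z a r p"
  using zeta_in_VG VG_pos by blast

lemma zeta_eq_iff:
  assumes "r \<in> VG" "s \<in> VG"
  shows "Z a r = Z b s \<longleftrightarrow> r = s \<and> absv (a - b) \<le> r"
proof
  assume eq: "Z a r = Z b s"
  have "r = max s (absv (b - a))" using zeta_lin_self[OF assms(1), of a] eq zeta_lin[OF assms(2)] by simp
  moreover have "s = max r (absv (a - b))" using zeta_lin_self[OF assms(2), of b] eq[symmetric] zeta_lin[OF assms(1)] by simp
  ultimately show "r = s \<and> absv (a - b) \<le> r" by (auto simp: abs_minus_commute[of b])
next
  assume "r = s \<and> absv (a - b) \<le> r"
  then have "{x. absv (x - a) \<le> r} = {x. absv (x - b) \<le> s}"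
    using abs_diff_triangle[of _ a b] abs_diff_triangle[of _ b a] abs_minus_commute[of a b]
    by (auto simp: max_def) (smt (verit, best))+
  then show "Z a r = Z b s" by (simp add: zeta_disk_def)
qed

lemma zeta_ge_eval:
  assumes "r \<in> VG" "absv (c - a) \<le> r"
  shows "absv (poly p c) \<le> Z a r p"
proof -
  have "zeta1 absv c p \<le> Z a r p"
  proof (rule A1_mono[OF zeta1_A1 zeta_A1[OF assms(1)]])
    fix d
    show "zeta1 absv c (lin d) \<le> Z a r (lin d)"
      using abs_diff_triangle[of c d a] assms by (auto simp: zeta1_def zeta_lin)
  qed
  then show ?thesis by (simp add: zeta1_def)
qed

lemma zeta_ge_lead:
  assumes "r \<in> VG" "p \<noteq> 0"
  shows "absv (lead_coeff p) * r ^ degree p \<le> Z a r p"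
  using assms(2)
proof (induction p rule: linear_factor_induct)
  case (mult c p)
  have "degree (lin c * p) = Suc (degree p)" using mult(1) by (simp add: degree_mult_eq)
  moreover have "lead_coeff (lin c * p) = lead_coeff p" by (subst lead_coeff_mult) simp
  moreover have "r * (absv (lead_coeff p) * r ^ degree p) \<le> max r (absv (a - c)) * Z a r p"
    using mult VG_pos[OF assms(1)] by (intro mult_mono) auto
  ultimately show ?case
    using zeta_lin[OF assms(1), of a c] A1_mult[OF zeta_A1[OF assms(1)], of a "lin c" p]
    by (simp add: mult.left_commute[of r])
qed (use assms in \<open>auto simp: A1_const zeta_A1\<close>)

end

section \<open>The action of a rational map on disks\<close>

context nonarch_closed begin

text \<open>For \<open>r\<close> in \<open>VG\<close>, \<open>disk a r\<close> and
  \<open>disk_inf a r\<close> are two of the directions at \<open>pt a r\<close>: the one around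
  \<open>a\<close> and the one around infinity.\<close>

definition disk :: "'k \<Rightarrow> real \<Rightarrow> ('k poly \<Rightarrow> real) option set" where
  "disk a r = {Some \<xi> | \<xi>. \<xi> \<in> A1 \<and> \<xi> (lin a) < r}"

definition disk_inf :: "'k \<Rightarrow> real \<Rightarrow> ('k poly \<Rightarrow> real) option set" where
  "disk_inf a r = insert None {Some \<xi> | \<xi>. \<xi> \<in> A1 \<and> r < \<xi> (lin a)}"

abbreviation pt :: "'k \<Rightarrow> real \<Rightarrow> ('k poly \<Rightarrow> real) option" where "pt a r \<equiv> Some (Z a r)"

lemma infinite_UNIV_k: "infinite (UNIV :: 'k set)"
proof
  assume fin: "finite (UNIV :: 'k set)"
  have "inj (of_nat :: nat \<Rightarrow> 'k)"
  proof (rule linorder_injI)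
    fix m n :: nat assume "m < n"
    then have "absv (of_nat (n - m)) = 1" by (intro abs_of_nat) simp
    moreover have "of_nat (n - m) = (of_nat n - of_nat m :: 'k)" using \<open>m < n\<close> by (simp add: of_nat_diff)
    ultimately show "of_nat m \<noteq> (of_nat n :: 'k)" by auto
  qed
  then show False using fin by (metis finite_imageD finite_subset infinite_UNIV_nat subset_UNIV)
qed

text \<open>Newton polygon criterion, with converse \<open>dominated_no_zero\<close>: in a factor
  \<open>lin c\<close> with \<open>R \<le> absv c\<close> the constant term dominates at radius
  \<open>R\<close>, and products preserve such dominance.\<close>

lemma coeff_dominated:
  assumes "0 < R" "\<And>c. poly p c = 0 \<Longrightarrow> R \<le> absv c"
  shows "absv (coeff p i) * R ^ i \<le> absv (coeff p 0)"
  using assms(2)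
proof (induction p arbitrary: i rule: linear_factor_induct)
  case zero
  then show ?case by simp
next
  case (const c)
  then show ?case by (cases i) auto
next
  case (mult c p)
  have IH: "absv (coeff p i) * R ^ i \<le> absv (coeff p 0)" for i using mult by auto
  have c: "R \<le> absv c" using mult(3)[of c] by auto
  have eq: "coeff (lin c * p) i = - c * coeff p i + (case i of 0 \<Rightarrow> 0 | Suc j \<Rightarrow> coeff p j)" for i
    by (cases i) (auto simp: mult_pCons_left)
  have "absv (- c * coeff p i) * R ^ i \<le> absv c * absv (coeff p 0)"
    using IH[of i] mult_left_mono[of "absv (coeff p i) * R ^ i" "absv (coeff p 0)" "absv c"]
    by (simp add: abs_mult mult.assoc)
  moreover have "absv (case i of 0 \<Rightarrow> 0 | Suc j \<Rightarrow> coeff p j) * R ^ i \<le> absv c * absv (coeff p 0)"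
  proof (cases i)
    case (Suc j)
    have "R * (absv (coeff p j) * R ^ j) \<le> absv c * absv (coeff p 0)"
      using IH[of j] c assms(1) by (intro mult_mono) auto
    then show ?thesis using Suc by (simp add: algebra_simps)
  qed auto
  ultimately have "absv (coeff (lin c * p) i) * R ^ i \<le> absv c * absv (coeff p 0)"
    using abs_add_le_max[of "- c * coeff p i" "case i of 0 \<Rightarrow> 0 | Suc j \<Rightarrow> coeff p j"] assms(1)
    unfolding eq by (smt (verit) max_def mult_right_mono zero_less_power)
  then show ?case by (simp add: eq[of 0] abs_mult)
qed

lemma dominated_no_zero:
  assumes "0 < R" "\<And>i. absv (coeff p i) * R ^ i \<le> absv (coeff p 0)" "coeff p 0 \<noteq> 0" "poly p c = 0"
  shows "R \<le> absv c"
proof (rule ccontr)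
  assume "\<not> R \<le> absv c"
  then have c: "absv c < R" by simp
  \<comment> \<open>At a zero of absolute value below \<open>R\<close> each nonconstant term loses
    at least one factor \<open>absv c / R\<close>, so together they cannot cancel the constant
    term.\<close>
  define B where "B = absv (coeff p 0) * (absv c / R)"
  have "absv (coeff p i * c ^ i) \<le> B" if "i \<noteq> 0" for i
  proof -
    have "absv (coeff p i * c ^ i) = absv (coeff p i) * R ^ i * (absv c / R) ^ i"
      using assms(1) by (simp add: abs_mult abs_power power_divide)
    also have "\<dots> \<le> absv (coeff p 0) * (absv c / R) ^ i"
      using assms(1,2) by (intro mult_right_mono) auto
    also have "\<dots> \<le> B" unfolding B_def
      using c assms(1) that power_decreasing[of 1 i "absv c / R"] by (intro mult_left_mono) auto
    finally show ?thesis .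
  qed
  then have "absv (\<Sum>i\<in>{..degree p} - {0}. coeff p i * c ^ i) \<le> B"
    using assms(1) by (intro abs_sum_le) (auto simp: B_def)
  moreover have "(\<Sum>i\<in>{..degree p} - {0}. coeff p i * c ^ i) = - coeff p 0"
    using assms(4) by (simp add: poly_altdef sum.remove[of _ 0] add_eq_0_iff)
  moreover have "B < absv (coeff p 0)" unfolding B_def using c assms(1,3) by (simp add: field_simps)
  ultimately show False by simp
qed

end

section \<open>Push-forward of seminorms under a rational map\<close>

locale rational_map = nonarch_closed absv for absv :: "'k::field \<Rightarrow> real" +
  fixes P Q :: "'k poly"
  assumes Q_nz: "Q \<noteq> 0" and coprime: "coprime P Q" and deg: "max (degree P) (degree Q) \<ge> 1"
begin

abbreviation "fm \<equiv> berk_map absv P Q"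

text \<open>Numerator of \<open>g(P/Q)\<close> over the fixed denominator \<open>Q ^ n\<close>.
  Unlike \<open>hcomp\<close>, whose denominator depends on the degree of \<open>g\<close>, it is
  additive in \<open>g\<close>; this gives the ultrametric inequality for
  \<open>push\<close>.\<close>

definition hcn :: "nat \<Rightarrow> 'k poly \<Rightarrow> 'k poly" where
  "hcn n g = (\<Sum>i\<le>n. smult (coeff g i) (P ^ i * Q ^ (n - i)))"

definition push :: "('k poly \<Rightarrow> real) \<Rightarrow> 'k poly \<Rightarrow> real" where
  "push \<xi> g = \<xi> (hcomp P Q g) / \<xi> Q ^ degree g"

definition ev :: "'k \<Rightarrow> 'k" where "ev a = poly P a / poly Q a"

lemma fm_Some: "\<xi> Q \<noteq> 0 \<Longrightarrow> fm (Some \<xi>) = Some (push \<xi>)"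
  by (simp add: berk_map_def push_def fun_eq_iff)

lemma fm_Some_None: "\<xi> Q = 0 \<Longrightarrow> fm (Some \<xi>) = None"
  by (simp add: berk_map_def)

lemma nonconst: "P - smult b Q \<noteq> 0"
proof
  assume "P - smult b Q = 0"
  then have eq: "P = smult b Q" by simp
  then have "Q dvd P" by (simp add: dvd_smult)
  then have "is_unit Q" using coprime by (meson coprime_common_divisor dvd_refl)
  then have "degree Q = 0" by (metis is_unit_polyE degree_pCons_0)
  then show False using deg eq by (cases "b = 0") auto
qed

lemma no_common_zero: "poly Q c = 0 \<Longrightarrow> poly P c \<noteq> 0"
proof
  assume "poly Q c = 0" "poly P c = 0"
  then have "is_unit (lin c)" using coprime by (meson coprime_common_divisor poly_eq_0_iff_dvd)
  then show False by (metis degree_pCons_eq_if is_unit_polyE one_neq_zero pCons_eq_0_iff degree_pCons_0 nat.distinct(1))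
qed

lemma hcn_mult_power:
  assumes "degree g \<le> n"
  shows "hcn n g = Q ^ (n - degree g) * hcomp P Q g"
proof -
  have "hcn n g = (\<Sum>i\<le>degree g. smult (coeff g i) (P ^ i * Q ^ (n - i)))"
    unfolding hcn_def using assms by (intro sum.mono_neutral_right) (auto simp: coeff_eq_0)
  also have "\<dots> = (\<Sum>i\<le>degree g. Q ^ (n - degree g) * smult (coeff g i) (P ^ i * Q ^ (degree g - i)))"
  proof (rule sum.cong[OF refl])
    fix i assume "i \<in> {..degree g}"
    then have "n - i = (n - degree g) + (degree g - i)" using assms by auto
    then have "Q ^ (n - i) = Q ^ (n - degree g) * Q ^ (degree g - i)" by (simp only: power_add)
    then show "smult (coeff g i) (P ^ i * Q ^ (n - i)) = Q ^ (n - degree g) * smult (coeff g i) (P ^ i * Q ^ (degree g - i))"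
      by (simp add: ac_simps)
  qed
  finally show ?thesis by (simp add: hcomp_def sum_distrib_left)
qed

lemma poly_hcomp: "poly Q x \<noteq> 0 \<Longrightarrow> poly (hcomp P Q g) x = poly Q x ^ degree g * poly g (ev x)"
  unfolding hcomp_def poly_sum poly_altdef[of g] sum_distrib_left
  by (intro sum.cong) (auto simp: ev_def power_divide power_diff)

lemma hcomp_mult: "hcomp P Q (p * q) = hcomp P Q p * hcomp P Q q"
proof (cases "p = 0 \<or> q = 0")
  case True
  then show ?thesis by (auto simp: hcomp_def)
next
  case False
  \<comment> \<open>The factor \<open>Q\<close> covers the zeros of \<open>Q\<close>, where
    \<open>ev\<close> does not describe \<open>hcomp\<close>; a polynomial vanishing on the whole
    infinite field is zero.\<close>
  define d where "d = Q * (hcomp P Q (p * q) - hcomp P Q p * hcomp P Q q)"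
  have "poly d x = 0" for x
    using False by (cases "poly Q x = 0") (auto simp: d_def poly_hcomp degree_mult_eq power_add)
  then have "{x. poly d x = 0} = UNIV" by auto
  then have "d = 0" using infinite_UNIV_k poly_roots_finite[of d] by auto
  then show ?thesis using Q_nz by (simp add: d_def)
qed

lemma push_A1:
  assumes \<xi>: "\<xi> \<in> A1" and Q: "\<xi> Q \<noteq> 0"
  shows "push \<xi> \<in> A1"
proof -
  have pos: "0 < \<xi> Q" using A1_nonneg[OF \<xi>, of Q] Q by simp
  have hcn: "push \<xi> g = \<xi> (hcn n g) / \<xi> Q ^ n" if "degree g \<le> n" for g n
  proof -
    have "\<xi> Q ^ n = \<xi> Q ^ (n - degree g) * \<xi> Q ^ degree g" using that by (simp flip: power_add)
    then show ?thesis
      using pos by (simp add: push_def hcn_mult_power[OF that] A1_mult[OF \<xi>] A1_power[OF \<xi>])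
  qed
  have "push \<xi> (p * q) = push \<xi> p * push \<xi> q" for p q
  proof (cases "p = 0 \<or> q = 0")
    case True
    then show ?thesis by (auto simp: push_def hcomp_def A1_0[OF \<xi>])
  next
    case False
    then show ?thesis by (auto simp: push_def hcomp_mult A1_mult[OF \<xi>] degree_mult_eq power_add)
  qed
  moreover have "push \<xi> (p + q) \<le> max (push \<xi> p) (push \<xi> q)" for p q
  proof -
    define n where "n = max (degree p) (degree q)"
    have "degree (p + q) \<le> n" unfolding n_def by (rule degree_add_le_max)
    moreover have "hcn n (p + q) = hcn n p + hcn n q"
      by (simp add: hcn_def smult_add_left sum.distrib)
    ultimately have "push \<xi> (p + q) = \<xi> (hcn n p + hcn n q) / \<xi> Q ^ n" by (simp add: hcn)
    also have "\<dots> \<le> max (\<xi> (hcn n p)) (\<xi> (hcn n q)) / \<xi> Q ^ n"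
      using pos A1_add_le[OF \<xi>] by (intro divide_right_mono) auto
    also have "\<dots> = max (push \<xi> p) (push \<xi> q)"
      using pos by (simp add: hcn[of p n] hcn[of q n] n_def max_divide_distrib_right)
    finally show ?thesis .
  qed
  moreover have "push \<xi> [:c:] = absv c" for c
    by (simp add: push_def hcomp_def A1_const[OF \<xi>])
  moreover have "0 \<le> push \<xi> p" for p using pos A1_nonneg[OF \<xi>] by (simp add: push_def)
  ultimately show ?thesis by (auto simp: berk_A1_def)
qed

lemma push_lin: "push \<xi> (lin c) = \<xi> (P - smult c Q) / \<xi> Q"
proof -
  have "hcomp P Q (lin c) = P - smult c Q" by (simp add: hcomp_def)
  then show ?thesis by (simp add: push_def)
qed

text \<open>A type II image is recognised from one centre \<open>b\<close>: off the circle
  \<open>absv (b - c) = s\<close> the ultrametric inequality decides the value, and on it only a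
  lower bound has to be supplied.\<close>

lemma push_eqI:
  assumes z: "z \<in> A1" "z Q \<noteq> 0" and s: "s \<in> VG"
    and b: "z (P - smult b Q) = s * z Q"
    and c: "\<And>c. absv (b - c) = s \<Longrightarrow> s * z Q \<le> z (P - smult c Q)"
  shows "push z = Z b s"
proof (rule zeta_eqI[OF push_A1[OF z] s])
  fix c
  have Q: "0 < z Q" using z A1_nonneg[OF z(1), of Q] by simp
  have split: "P - smult c Q = (P - smult b Q) + smult (b - c) Q" by (simp add: smult_diff_left)
  have v: "z (smult (b - c) Q) = absv (b - c) * z Q" using A1_smult[OF z(1)] by simp
  have "z (P - smult c Q) = max s (absv (b - c)) * z Q"
  proof (rule linorder_cases[of "absv (b - c)" s])
    assume "absv (b - c) < s"
    then have "z (smult (b - c) Q + (P - smult b Q)) = z (P - smult b Q)"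
      using Q by (intro A1_add_eq_right[OF z(1)]) (simp add: v b)
    then show ?thesis using \<open>absv (b - c) < s\<close> by (simp add: split b add.commute)
  next
    assume "s < absv (b - c)"
    then have "z (P - smult b Q + smult (b - c) Q) = z (smult (b - c) Q)"
      using Q by (intro A1_add_eq_right[OF z(1)]) (simp add: v b)
    then show ?thesis using \<open>s < absv (b - c)\<close> by (simp add: split v)
  next
    assume eq: "absv (b - c) = s"
    have "z (P - smult c Q) \<le> max (s * z Q) (absv (b - c) * z Q)"
      using A1_add_le[OF z(1), of "P - smult b Q" "smult (b - c) Q"] by (simp add: split b v)
    then show ?thesis using c[OF eq] by (simp add: eq)
  qed
  then show "push z (lin c) = max s (absv (b - c))" using Q by (simp add: push_lin)
qed

text \<open>Centre and radius of the image are read off at points of \<open>K\<close>: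
  \<open>b = f(x)\<close> for \<open>x\<close> generic for \<open>Q\<close>, then
  \<open>s = absv (f(y) - b)\<close> for \<open>y\<close> generic for \<open>Q\<close> and
  \<open>P - smult b Q\<close>. The second polynomial depends on \<open>x\<close>, hence two
  points.\<close>

lemma fm_l_split:
  assumes K: "is_subfield K" "a \<in> K" "r \<in> value_group absv K"
    and coeffs: "\<And>i. coeff P i \<in> K" "\<And>i. coeff Q i \<in> K"
  obtains b s where "b \<in> K" "s \<in> value_group absv K" "fm (pt a r) = pt b s"
proof -
  have VG: "r \<in> VG" using K(3) by (auto simp: value_group_def)
  note z = zeta_A1[OF VG, of a]
  have polyK: "poly p x \<in> K" if "\<And>i. coeff p i \<in> K" "x \<in> K" for p x
    using that(1)
  proof (induction p)
    case 0
    then show ?case using K(1) by (simp add: is_subfield_def)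
  next
    case (pCons c p)
    have "c \<in> K" using pCons(3)[of 0] by simp
    moreover have "coeff p i \<in> K" for i using pCons(3)[of "Suc i"] by simp
    ultimately show ?case using pCons(2) K(1) that(2) by (simp add: is_subfield_def)
  qed
  have Kdiv: "x / y \<in> K" if "x \<in> K" "y \<in> K" for x y
    using K(1) that by (simp add: is_subfield_def divide_inverse)
  obtain x where x: "x \<in> K" "absv (x - a) \<le> r" "Z a r Q = absv (poly Q x)"
    using exists_generic_polys[OF K, of "{Q}"] by auto
  have zQ: "0 < Z a r Q" using zeta_pos[OF VG Q_nz] .
  define b where "b = ev x"
  have bK: "b \<in> K" unfolding b_def ev_def using polyK coeffs x(1) by (intro Kdiv) auto
  have "finite {Q, P - smult b Q}" by simp
  from exists_generic_polys[OF K this] obtain y where "y \<in> K" "absv (y - a) \<le> r"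
    and *: "\<And>p. p \<in> {Q, P - smult b Q} \<Longrightarrow> Z a r p = absv (poly p y)" by auto
  then have y: "y \<in> K" "absv (y - a) \<le> r" "Z a r Q = absv (poly Q y)"
      "Z a r (P - smult b Q) = absv (poly (P - smult b Q) y)"
    using *[of Q] *[of "P - smult b Q"] by auto
  define s where "s = absv (ev y - b)"
  have Qx: "poly Q x \<noteq> 0" and Qy: "poly Q y \<noteq> 0" using zQ x y by auto
  have s: "Z a r (P - smult b Q) = s * Z a r Q"
  proof -
    have "poly (P - smult b Q) y = (ev y - b) * poly Q y" using Qy by (simp add: ev_def left_diff_distrib)
    then show ?thesis unfolding y(3,4) s_def by (simp add: abs_mult)
  qed
  have "0 < s" using zeta_pos[OF VG nonconst[of b], of a] s zQ by (simp add: zero_less_mult_iff)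
  moreover have "ev y - b \<in> K" 
  proof -
    have "ev y \<in> K" unfolding ev_def using polyK coeffs y(1) by (intro Kdiv) auto
    then show ?thesis using bK K(1) by (simp add: is_subfield_def)
  qed
  ultimately have sK: "s \<in> value_group absv K" by (auto simp: value_group_def s_def)
  have "push (Z a r) = Z b s"
  proof (rule push_eqI[OF z _ _ s])
    show "Z a r Q \<noteq> 0" using zQ by simp
    show "s \<in> VG" using sK by (auto simp: value_group_def)
    fix c assume c: "absv (b - c) = s"
    have "poly (P - smult c Q) x = (b - c) * poly Q x" using Qx by (simp add: b_def ev_def left_diff_distrib)
    then show "s * Z a r Q \<le> Z a r (P - smult c Q)"
      using zeta_ge_eval[OF VG x(2), of "P - smult c Q"] by (simp add: abs_mult c x(3))
  qed
  then show thesis using that[OF bK sK] fm_Some[of "Z a r"] zQ by simp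
qed

text \<open>Without poles \<open>Q\<close> has constant norm on the open disk, so the numerator
  \<open>P - smult (ev a) Q\<close> governs the image. It contains the factor \<open>lin a\<close>,
  whose norm is strictly below \<open>r\<close> inside the disk; hence the strict bound for the
  image.\<close>

lemma disk_map:
  assumes r: "r \<in> VG" and Q: "\<And>c. poly Q c = 0 \<Longrightarrow> r \<le> absv (a - c)"
  defines "s \<equiv> Z a r (P - smult (ev a) Q) / absv (poly Q a)"
  shows "s \<in> VG" "fm (pt a r) = pt (ev a) s" "fm ` disk a r \<subseteq> disk (ev a) s"
proof -
  have r0: "0 < r" by (rule VG_pos[OF r])
  have Qa: "poly Q a \<noteq> 0" using Q[of a] r0 by auto
  define N where "N = P - smult (ev a) Q"
  have N: "N \<noteq> 0" "poly N a = 0" using nonconst Qa by (auto simp: N_def ev_def)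
  obtain d where d: "Z a r N = absv d" "d \<noteq> 0" using zeta_in_VG[OF r N(1)] by (auto simp: value_group_def)
  then have "s = absv (d / poly Q a)" "d / poly Q a \<noteq> 0" using Qa by (auto simp: s_def N_def abs_divide)
  then show s: "s \<in> VG" by (auto simp: value_group_def)
  have zQ: "Z a r Q = absv (poly Q a)"
    using Q by (intro A1_eq_eval zeta_A1 r) (auto simp: zeta_lin[OF r])
  have sQ: "Z a r N = s * Z a r Q" using Qa by (simp add: s_def N_def zQ)
  have "push (Z a r) = Z (ev a) s"
  proof (rule push_eqI[OF zeta_A1[OF r] _ s])
    show "Z a r Q \<noteq> 0" using zQ Qa by simp
    show "Z a r (P - smult (ev a) Q) = s * Z a r Q" using sQ by (simp add: N_def)
    fix c assume c: "absv (ev a - c) = s"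
    have "poly (P - smult c Q) a = (ev a - c) * poly Q a" using Qa by (simp add: ev_def left_diff_distrib)
    then show "s * Z a r Q \<le> Z a r (P - smult c Q)"
      using zeta_ge_eval[OF r, of a a "P - smult c Q"] r0 by (simp add: abs_mult c zQ)
  qed
  then show "fm (pt a r) = pt (ev a) s" using fm_Some[of "Z a r"] zQ Qa by simp
  show "fm ` disk a r \<subseteq> disk (ev a) s"
  proof
    fix y assume "y \<in> fm ` disk a r"
    then obtain \<xi> where \<xi>: "\<xi> \<in> A1" "\<xi> (lin a) < r" "y = fm (Some \<xi>)" by (auto simp: disk_def)
    have \<xi>Q: "\<xi> Q = absv (poly Q a)" using A1_eval_no_zero[OF \<xi>(1,2) Q] .
    obtain g where g: "N = lin a * g" using N(2) by (metis dvd_def poly_eq_0_iff_dvd)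
    have "\<xi> g \<le> Z a r g"
    proof (rule A1_mono[OF \<xi>(1) zeta_A1[OF r]])
      fix c show "\<xi> (lin c) \<le> Z a r (lin c)" using A1_lin_le[OF \<xi>(1), of c a] \<xi>(2) by (auto simp: zeta_lin[OF r])
    qed
    moreover have "0 < Z a r g" using N g by (intro zeta_pos[OF r]) auto
    ultimately have "\<xi> (lin a) * \<xi> g < r * Z a r g"
      using \<xi>(2) A1_nonneg[OF \<xi>(1)] r0 by (meson le_less_trans mult_left_mono mult_strict_right_mono)
    then have "\<xi> N < Z a r N"
      using A1_mult[OF \<xi>(1)] A1_mult[OF zeta_A1[OF r]] zeta_lin_self[OF r] by (simp add: g)
    then have "push \<xi> (lin (ev a)) < s" unfolding push_lin \<xi>Q s_def N_def[symmetric]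
      using Qa by (intro divide_strict_right_mono) auto
    moreover have "\<xi> Q \<noteq> 0" using \<xi>Q Qa by simp
    ultimately show "y \<in> disk (ev a) s" using \<xi> push_A1[OF \<xi>(1)] fm_Some by (auto simp: disk_def)
  qed
qed

end

section \<open>Linearity on disks without poles and critical points\<close>

context nonarch_closed begin

lemma abs_of_nat_diff_le: "absv (of_nat m - of_nat n) \<le> 1"
  using abs_diff_le_max[of "of_nat m" "of_nat n"] abs_of_nat_le[of m] abs_of_nat_le[of n] by linarith

lemma of_nat_Suc_nz: "(of_nat (Suc n) :: 'k) \<noteq> 0"
  using abs_of_nat[of "Suc n"] by auto

lemma pderiv_0_imp_const: "pderiv p = 0 \<Longrightarrow> degree p = 0" for p :: "'k poly"
proof (rule ccontr)
  assume "pderiv p = 0" "degree p \<noteq> 0"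
  then obtain n where n: "degree p = Suc n" by (cases "degree p") auto
  have "coeff (pderiv p) n = of_nat (Suc n) * lead_coeff p" by (simp add: coeff_pderiv n)
  then have "lead_coeff p = 0" using of_nat_Suc_nz[of n] \<open>pderiv p = 0\<close> by (simp del: of_nat_Suc)
  then show False using n by (metis Suc_neq_Zero degree_0 leading_coeff_0_iff)
qed

text \<open>If \<open>X h / q\<close> has derivative \<open>w / q^2\<close>, then the coefficients of \<open>h\<close> satisfy a recursion
  in which \<open>h i\<close> is multiplied by the unit \<open>i + 1\<close>; this is where the residue
  characteristic enters.\<close>
lemma dominated_of_wronskian:
  assumes R: "0 < R" and w: "w = pderiv (pCons 0 h) * q - pCons 0 h * pderiv q"
    and q: "\<And>i. absv (coeff q i) * R ^ i \<le> absv (coeff q 0)" "coeff q 0 \<noteq> 0"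
    and dw: "\<And>i. absv (coeff w i) * R ^ i \<le> absv (coeff w 0)"
  shows "absv (coeff h i) * R ^ i \<le> absv (coeff h 0)"
proof (induction i rule: less_induct)
  case (less i)
  \<comment> \<open>Contribution of \<open>coeff h j * coeff q (i - j)\<close> to
    \<open>coeff w i\<close>: the factor \<open>j + 1\<close> comes from differentiating
    \<open>X h\<close>, and \<open>i - j\<close> from differentiating \<open>q\<close>.\<close>
  define t where "t i j = (of_nat (Suc j) - of_nat (i - j)) * (coeff h j * coeff q (i - j))" for i j
  have w_coeff: "coeff w i = (\<Sum>j\<le>i. t i j)" for i
  proof -
    have "coeff (pderiv (pCons 0 h) * q) i = (\<Sum>j\<le>i. of_nat (Suc j) * (coeff h j * coeff q (i - j)))"
      by (simp add: coeff_mult coeff_pderiv mult.assoc del: of_nat_Suc)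
    moreover have "coeff (pCons 0 h * pderiv q) i = (\<Sum>j\<le>i. of_nat (i - j) * (coeff h j * coeff q (i - j)))"
    proof (cases i)
      case (Suc i')
      have "coeff (pCons 0 h * pderiv q) i = (\<Sum>j\<le>i'. coeff h j * (of_nat (Suc (i' - j)) * coeff q (Suc (i' - j))))"
        unfolding Suc by (simp add: mult_pCons_left coeff_mult coeff_pderiv del: of_nat_Suc)
      also have "\<dots> = (\<Sum>j\<le>i'. of_nat (i - j) * (coeff h j * coeff q (i - j)))"
        by (intro sum.cong) (auto simp: Suc Suc_diff_le simp del: of_nat_Suc)
      finally show ?thesis by (simp add: Suc)
    qed (simp add: mult_pCons_left)
    ultimately show ?thesis
      by (simp only: w t_def left_diff_distrib sum_subtractf coeff_diff)
  qed
  have w0: "coeff w 0 = coeff h 0 * coeff q 0" by (simp add: w_coeff t_def)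
  have bound: "absv (- t i j) * R ^ i \<le> absv (coeff h 0) * absv (coeff q 0)" if "j < i" for j
  proof -
    have Rij: "R ^ i = R ^ j * R ^ (i - j)" using that by (simp flip: power_add)
    have "absv (- t i j) * R ^ i \<le> 1 * (absv (coeff h j) * absv (coeff q (i - j))) * R ^ i"
      unfolding t_def abs_minus abs_mult using R abs_of_nat_diff_le
      by (intro mult_right_mono) (auto simp del: of_nat_Suc)
    also have "\<dots> = (absv (coeff h j) * R ^ j) * (absv (coeff q (i - j)) * R ^ (i - j))"
      by (simp add: Rij)
    also have "\<dots> \<le> absv (coeff h 0) * absv (coeff q 0)"
      using less[OF that] q(1)[of "i - j"] R by (intro mult_mono) auto
    finally show ?thesis .
  qed
  define B where "B = absv (coeff h 0) * absv (coeff q 0) / R ^ i"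
  have "absv (\<Sum>j<i. - t i j) \<le> B"
    using bound R by (intro abs_sum_le) (auto simp: B_def field_simps)
  moreover have "absv (coeff w i) \<le> B" using dw[of i] R by (simp add: B_def w0 abs_mult field_simps)
  moreover have "t i i = coeff w i + (\<Sum>j<i. - t i j)"
    by (simp add: w_coeff sum_negf lessThan_Suc_atMost[symmetric])
  ultimately have "absv (t i i) \<le> B" using abs_add_le_max[of "coeff w i" "\<Sum>j<i. - t i j"] by simp
  moreover have "absv (t i i) = absv (coeff h i) * absv (coeff q 0)"
    using abs_of_nat[of "Suc i"] by (simp add: t_def abs_mult del: of_nat_Suc)
  ultimately have "(absv (coeff h i) * R ^ i) * absv (coeff q 0) \<le> absv (coeff h 0) * absv (coeff q 0)"
    using R by (simp add: B_def field_simps)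
  then show ?case using q(2) by simp
qed

end

context rational_map begin

definition wronskian :: "'k poly" where "wronskian = pderiv P * Q - P * pderiv Q"

lemma dvd_of_no_common_zero:
  fixes p q r :: "'k poly"
  assumes "p dvd q * r" "p \<noteq> 0" "\<And>c. poly p c = 0 \<Longrightarrow> poly q c \<noteq> 0"
  shows "p dvd r"
  using assms
proof (induction p arbitrary: r rule: linear_factor_induct)
  case (const c)
  then have "[:c:] * [:inverse c:] = 1" by (simp add: mult_pCons_left one_pCons)
  then have "is_unit [:c:]" by (metis dvdI)
  then show ?case by (rule unit_imp_dvd)
next
  case (mult c p)
  have "poly (q * r) c = 0" using dvd_mult_left[OF mult(3)] unfolding poly_eq_0_iff_dvd .
  then have "poly r c = 0" using mult(5)[of c] by simp
  then obtain r' where r': "r = lin c * r'" by (metis dvd_def poly_eq_0_iff_dvd)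
  have "lin c * p dvd lin c * (q * r')" using mult(3) by (simp add: r' mult.left_commute)
  then have "p dvd q * r'" by (subst (asm) dvd_mult_cancel_left) auto
  moreover have "poly q d \<noteq> 0" if "poly p d = 0" for d using mult(5)[of d] that by simp
  ultimately have "p dvd r'" using mult(1,2) by blast
  then show ?case unfolding r' by (rule mult_dvd_mono[OF dvd_refl])
qed simp

text \<open>If the derivative of \<open>f\<close> vanished, coprimality would give
  \<open>Q dvd pderiv Q\<close> and \<open>P dvd pderiv P\<close>, which in characteristic zero
  forces both to be constant.\<close>

lemma wronskian_nz: "wronskian \<noteq> 0"
proof
  assume "wronskian = 0"
  then have eq: "pderiv P * Q = P * pderiv Q" by (simp add: wronskian_def)
  have const: "degree p = 0" if "p dvd pderiv p" for p :: "'k poly"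
  proof (rule ccontr)
    assume "degree p \<noteq> 0"
    then have "pderiv p \<noteq> 0" using pderiv_0_imp_const[of p] by auto
    then have "degree p \<le> degree (pderiv p)" using dvd_imp_degree_le[OF that] by simp
    moreover have "degree (pderiv p) \<le> degree p - 1"
      by (rule degree_le) (auto simp: coeff_pderiv coeff_eq_0)
    ultimately show False using \<open>degree p \<noteq> 0\<close> by linarith
  qed
  have "Q dvd P * pderiv Q" unfolding eq[symmetric] by simp
  then have "Q dvd pderiv Q" using Q_nz no_common_zero by (rule dvd_of_no_common_zero)
  moreover have "P dvd pderiv P"
  proof (cases "P = 0")
    case False
    have "P dvd Q * pderiv P" unfolding mult.commute[of Q] eq by simp
    moreover have "poly Q c \<noteq> 0" if "poly P c = 0" for c using no_common_zero[of c] that by blast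
    ultimately show ?thesis using False dvd_of_no_common_zero by metis
  qed simp
  ultimately have "degree P = 0" "degree Q = 0" by (simp_all only: const)
  then show False using deg by simp
qed

text \<open>By \<open>disk_map\<close> the left-hand side is the radius of the image. Write the
  numerator as \<open>lin a * g\<close>: the Wronskian estimate makes the value of \<open>g\<close>
  at \<open>a\<close> dominant, so \<open>g\<close> has no zero in the open disk and its norm is
  constant there, while \<open>lin a\<close> contributes \<open>r\<close>.\<close>

lemma linear_on_disk:
  assumes R: "0 < R" and Q: "\<And>c. poly Q c = 0 \<Longrightarrow> R \<le> absv (a - c)"
    and wronskian: "\<And>c. poly wronskian c = 0 \<Longrightarrow> R \<le> absv (a - c)"
  obtains l where "\<And>r. r \<in> VG \<Longrightarrow> r \<le> R \<Longrightarrow> Z a r (P - smult (ev a) Q) / absv (poly Q a) = l * r"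
proof -
  have Qa: "poly Q a \<noteq> 0" using Q[of a] R by auto
  define N where "N = P - smult (ev a) Q"
  have N: "poly N a = 0" using Qa by (auto simp: N_def ev_def)
  obtain g where g: "N = lin a * g" using N by (metis dvd_def poly_eq_0_iff_dvd)
  define sh where "sh p = pcompose p [:a, 1:]" for p :: "'k poly"
  have poly_sh: "poly (sh p) x = poly p (a + x)" for p x by (simp add: sh_def poly_pcompose)
  have sh_0: "coeff (sh p) 0 = poly p a" for p using poly_sh[of p 0] by (simp add: poly_0_coeff_0)
  have dom: "absv (coeff (sh p) i) * R ^ i \<le> absv (coeff (sh p) 0)"
    if "\<And>c. poly p c = 0 \<Longrightarrow> R \<le> absv (a - c)" for p i
  proof (rule coeff_dominated[OF R])
    fix c assume "poly (sh p) c = 0"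
    then have "R \<le> absv (a - (a + c))" by (intro that) (simp add: poly_sh)
    then show "R \<le> absv c" by simp
  qed
  have sh_N: "sh N = pCons 0 (sh g)"
    unfolding g sh_def pcompose_mult by (simp add: pcompose_pCons mult_pCons_left)
  have sh_d: "pderiv (sh p) = sh (pderiv p)" for p
    by (simp add: sh_def pderiv_pcompose pderiv_pCons)
  \<comment> \<open>The Wronskian does not change when a multiple of \<open>Q\<close> is subtracted
    from \<open>P\<close>.\<close>
  have "wronskian = pderiv N * Q - N * pderiv Q"
    by (simp add: N_def wronskian_def pderiv_diff pderiv_smult algebra_simps)
  then have "sh wronskian = sh (pderiv N) * sh Q - sh N * sh (pderiv Q)"
    by (simp add: sh_def pcompose_diff pcompose_mult)
  then have w: "sh wronskian = pderiv (pCons 0 (sh g)) * sh Q - pCons 0 (sh g) * pderiv (sh Q)"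
    by (simp only: sh_d sh_N[symmetric])
  have domg: "absv (coeff (sh g) i) * R ^ i \<le> absv (coeff (sh g) 0)" for i
    using dominated_of_wronskian[OF R w dom[OF Q] _ dom[OF wronskian]] Qa by (simp add: sh_0)
  have "coeff (sh wronskian) 0 = coeff (sh g) 0 * coeff (sh Q) 0"
    by (simp add: w coeff_mult_0 pderiv_pCons mult_pCons_left)
  moreover have "poly wronskian a \<noteq> 0" using wronskian[of a] R by auto
  ultimately have ga: "poly g a \<noteq> 0" by (auto simp: sh_0)
  have g_zero: "R \<le> absv (a - c)" if "poly g c = 0" for c
    using dominated_no_zero[OF R domg, of "c - a"] ga that
    by (simp add: sh_0 poly_sh abs_minus_commute)
  show thesis
  proof (rule that[of "absv (poly g a) / absv (poly Q a)"])
    fix r assume r: "r \<in> VG" "r \<le> R"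
    have "Z a r g = absv (poly g a)"
      using r g_zero by (intro A1_eq_eval zeta_A1) (force simp: zeta_lin)+
    then show "Z a r (P - smult (ev a) Q) / absv (poly Q a) = absv (poly g a) / absv (poly Q a) * r"
      using A1_mult[OF zeta_A1[OF r(1)]] zeta_lin_self[OF r(1)] by (simp add: N_def[symmetric] g)
  qed
qed

text \<open>Near a pole \<open>s\<close> of order \<open>m\<close> the absolute value of
  \<open>f\<close> is that of \<open>C / (z - s)^m\<close>, because no other zero of
  \<open>P\<close> or \<open>Q\<close> is closer to \<open>s\<close> than \<open>r0\<close>.\<close>

lemma pole_map:
  assumes s: "poly Q s = 0"
    and isolated: "\<And>c. poly (P * Q) c = 0 \<Longrightarrow> c = s \<or> r0 \<le> absv (s - c)"
  obtains C m where "0 < C" "1 \<le> m"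
    "\<And>r. r \<in> VG \<Longrightarrow> r \<le> r0 \<Longrightarrow> C / r ^ m \<in> VG \<and> fm (pt s r) = pt 0 (C / r ^ m) \<and> fm ` disk s r \<subseteq> disk_inf 0 (C / r ^ m)"
proof -
  define m where "m = order s Q"
  obtain q where q: "Q = lin s ^ m * q" "\<not> lin s dvd q" using order_decomp[OF Q_nz] m_def by blast
  have m: "1 \<le> m" using s Q_nz order_root[of Q s] by (auto simp: m_def)
  have qs: "poly q s \<noteq> 0" using q(2) by (simp add: poly_eq_0_iff_dvd)
  have Ps: "poly P s \<noteq> 0" using no_common_zero[OF s] .
  define C where "C = absv (poly P s / poly q s)"
  have C: "0 < C" using Ps qs by (simp add: C_def)
  have zP: "r0 \<le> absv (s - c)" if "poly P c = 0" for c using isolated[of c] that Ps by auto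
  have zq: "r0 \<le> absv (s - c)" if "poly q c = 0" for c using isolated[of c] that qs q(1) by auto
  show thesis
  proof (rule that[OF C m], intro conjI)
    fix r assume r: "r \<in> VG" "r \<le> r0"
    have r0: "0 < r" by (rule VG_pos[OF r(1)])
    obtain \<rho> where \<rho>: "\<rho> \<noteq> 0" "r = absv \<rho>" using r(1) by (auto simp: value_group_def)
    have "C / r ^ m = absv (poly P s / poly q s / \<rho> ^ m)" by (simp add: C_def abs_divide abs_power abs_mult \<rho>)
    then show VG: "C / r ^ m \<in> VG" using Ps qs \<rho> by (auto simp: value_group_def)
    have P_eval: "\<xi> P = absv (poly P s)" if "\<xi> \<in> A1" "\<And>c. r0 \<le> absv (s - c) \<Longrightarrow> \<xi> (lin c) = absv (s - c)" for \<xi>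
      using that zP by (intro A1_eq_eval) auto
    have Q_eval: "\<xi> Q = \<xi> (lin s) ^ m * absv (poly q s)"
      if "\<xi> \<in> A1" "\<And>c. r0 \<le> absv (s - c) \<Longrightarrow> \<xi> (lin c) = absv (s - c)" for \<xi>
    proof -
      have "\<xi> q = absv (poly q s)" using that zq by (intro A1_eq_eval) auto
      then show ?thesis using A1_mult[OF that(1)] A1_power[OF that(1)] by (simp add: q(1))
    qed
    have zl: "r0 \<le> absv (s - c) \<Longrightarrow> Z s r (lin c) = absv (s - c)" for c using r by (simp add: zeta_lin)
    note zev = P_eval[OF zeta_A1[OF r(1)] zl] Q_eval[OF zeta_A1[OF r(1)] zl]
    have zQ: "Z s r Q = r ^ m * absv (poly q s)" using zev by (simp add: zeta_lin_self[OF r(1)])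
    have "push (Z s r) = Z 0 (C / r ^ m)"
    proof (rule push_eqI[OF zeta_A1[OF r(1)] _ VG])
      show "Z s r Q \<noteq> 0" using zQ r0 qs by simp
      have eq: "C / r ^ m * Z s r Q = absv (poly P s)" using r0 qs by (simp add: zQ C_def abs_divide)
      then show "Z s r (P - smult 0 Q) = C / r ^ m * Z s r Q" using zev by simp
      fix c
      show "C / r ^ m * Z s r Q \<le> Z s r (P - smult c Q)"
        using zeta_ge_eval[OF r(1), of s s "P - smult c Q"] r0 s eq by simp
    qed
    moreover have "Z s r Q \<noteq> 0" using zQ r0 qs by simp
    ultimately show "fm (pt s r) = pt 0 (C / r ^ m)" by (simp add: fm_Some)
    show "fm ` disk s r \<subseteq> disk_inf 0 (C / r ^ m)"
    proof
      fix y assume "y \<in> fm ` disk s r"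
      then obtain \<xi> where \<xi>: "\<xi> \<in> A1" "\<xi> (lin s) < r" "y = fm (Some \<xi>)" by (auto simp: disk_def)
      show "y \<in> disk_inf 0 (C / r ^ m)"
      proof (cases "\<xi> Q = 0")
        case True
        then show ?thesis using \<xi> by (simp add: fm_Some_None disk_inf_def)
      next
        case False
        have xl: "r0 \<le> absv (s - c) \<Longrightarrow> \<xi> (lin c) = absv (s - c)" for c
          using \<xi> r by (intro A1_lin_eq_abs) auto
        note xev = P_eval[OF \<xi>(1) xl] Q_eval[OF \<xi>(1) xl]
        have "0 \<le> \<xi> (lin s)" by (rule A1_nonneg[OF \<xi>(1)])
        moreover have "\<xi> (lin s) \<noteq> 0" using False xev m by (auto simp: power_0_left)
        ultimately have x0: "0 < \<xi> (lin s)" by simp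
        have "push \<xi> (lin 0) = C / \<xi> (lin s) ^ m"
          unfolding push_lin using xev by (simp add: C_def abs_divide)
        moreover have "\<xi> (lin s) ^ m < r ^ m" using \<xi>(2) x0 m by (intro power_strict_mono) auto
        then have "C / r ^ m < C / \<xi> (lin s) ^ m" using C x0 r0 by (intro divide_strict_left_mono) auto
        ultimately show ?thesis using \<xi> False push_A1[OF \<xi>(1) False] by (simp add: disk_inf_def fm_Some)
      qed
    qed
  qed
qed

lemma eval_outside_lin:
  assumes "\<xi> \<in> A1" "p \<noteq> 0" "R < \<xi> (lin 0)" "\<And>c. poly p c = 0 \<Longrightarrow> absv c \<le> R"
  shows "\<xi> p = absv (lead_coeff p) * \<xi> (lin 0) ^ degree p"
proof (rule A1_eval_outside[OF assms(1,2)])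
  fix c assume "poly p c = 0"
  then show "\<xi> (lin c) = \<xi> (lin 0)" using assms(3,4) by (intro A1_lin_eq_lin[OF assms(1)]) force
qed

lemma zeta_outside:
  assumes "R \<in> VG" "p \<noteq> 0" "\<And>c. poly p c = 0 \<Longrightarrow> absv c \<le> R"
  shows "Z 0 R p = absv (lead_coeff p) * R ^ degree p"
  using A1_eval_outside[OF zeta_A1[OF assms(1)] assms(2), of 0 0] assms(3)
  by (simp add: zeta_lin_self[OF assms(1), of 0, simplified] zeta_lin[OF assms(1)])

text \<open>Outside all zeros of \<open>P\<close> and \<open>Q\<close> the leading terms decide, so
  \<open>f\<close> grows like the power \<open>m = degree P - degree Q\<close>.\<close>

lemma infinity_map_pole:
  assumes dg: "degree Q < degree P"
    and zeros: "\<And>c. poly (P * Q) c = 0 \<Longrightarrow> absv c \<le> R0"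
  obtains C m where "0 < C" "1 \<le> m"
    "\<And>R. R \<in> VG \<Longrightarrow> R0 \<le> R \<Longrightarrow> C * R ^ m \<in> VG \<and> fm (pt 0 R) = pt 0 (C * R ^ m) \<and> fm ` disk_inf 0 R \<subseteq> disk_inf 0 (C * R ^ m)"
proof -
  have P: "P \<noteq> 0" using dg by auto
  define m where "m = degree P - degree Q"
  define C where "C = absv (lead_coeff P / lead_coeff Q)"
  have C: "0 < C" using P Q_nz by (simp add: C_def)
  have dm: "degree P = degree Q + m" using dg by (simp add: m_def)
  show thesis
  proof (rule that[OF C, of m], goal_cases)
    case 1
    then show ?case using dg by (simp add: m_def)
  next
    case (2 R)
    have R: "0 < R" by (rule VG_pos[OF 2(1)])
    obtain \<rho> where \<rho>: "\<rho> \<noteq> 0" "R = absv \<rho>" using 2(1) by (auto simp: value_group_def)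
    have "C * R ^ m = absv (lead_coeff P / lead_coeff Q * \<rho> ^ m)" unfolding C_def abs_mult abs_power \<rho>(2) ..
    moreover have "lead_coeff P / lead_coeff Q * \<rho> ^ m \<noteq> 0" using P Q_nz \<rho> by simp
    ultimately have VG: "C * R ^ m \<in> VG" by (auto simp: value_group_def simp del: divide_eq_0_iff)
    have zP: "absv c \<le> R" if "poly P c = 0" for c using zeros[of c] that 2(2) by simp
    have zQ: "absv c \<le> R" if "poly Q c = 0" for c using zeros[of c] that 2(2) by simp
    have ZP: "Z 0 R P = absv (lead_coeff P) * R ^ degree P" by (rule zeta_outside[OF 2(1) P zP])
    have ZQ: "Z 0 R Q = absv (lead_coeff Q) * R ^ degree Q" by (rule zeta_outside[OF 2(1) Q_nz zQ])
    have eq: "C * R ^ m * Z 0 R Q = absv (lead_coeff P) * R ^ degree P"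
      using Q_nz by (simp add: ZQ C_def abs_divide dm power_add)
    have ZQ0: "Z 0 R Q \<noteq> 0" using zeta_pos[OF 2(1) Q_nz, of 0] by simp
    have "push (Z 0 R) = Z 0 (C * R ^ m)"
    proof (rule push_eqI[OF zeta_A1[OF 2(1)] ZQ0 VG])
      show "Z 0 R (P - smult 0 Q) = C * R ^ m * Z 0 R Q" using ZP eq by simp
      fix c
      have "degree (P - smult c Q) = degree P" "lead_coeff (P - smult c Q) = lead_coeff P"
        using dg degree_add_eq_left[of "- smult c Q" P] by (auto simp: coeff_eq_0 degree_smult_le le_less_trans)
      then show "C * R ^ m * Z 0 R Q \<le> Z 0 R (P - smult c Q)"
        using zeta_ge_lead[OF 2(1) nonconst[of c], of 0] eq by metis
    qed
    then have 1: "fm (pt 0 R) = pt 0 (C * R ^ m)" using ZQ0 by (simp add: fm_Some)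
    have "fm y \<in> disk_inf 0 (C * R ^ m)" if "y \<in> disk_inf 0 R" for y
    proof (cases y)
      case None
      then show ?thesis using dg by (simp add: berk_map_def disk_inf_def)
    next
      case (Some \<xi>)
      then have \<xi>: "\<xi> \<in> A1" "R < \<xi> (lin 0)" using that by (auto simp: disk_inf_def)
      have xP: "\<xi> P = absv (lead_coeff P) * \<xi> (lin 0) ^ degree P" by (rule eval_outside_lin[OF \<xi>(1) P \<xi>(2) zP])
      have xQ: "\<xi> Q = absv (lead_coeff Q) * \<xi> (lin 0) ^ degree Q" by (rule eval_outside_lin[OF \<xi>(1) Q_nz \<xi>(2) zQ])
      have x0: "0 < \<xi> (lin 0)" using \<xi> R by linarith
      have "push \<xi> (lin 0) = C * \<xi> (lin 0) ^ m"
        unfolding push_lin using xP xQ x0 Q_nz by (simp add: C_def abs_divide dm power_add)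
      moreover have "R ^ m < \<xi> (lin 0) ^ m" using \<xi>(2) R dg by (intro power_strict_mono) (auto simp: m_def)
      ultimately have "C * R ^ m < push \<xi> (lin 0)" using C by simp
      moreover have "\<xi> Q \<noteq> 0" using xQ x0 Q_nz by simp
      ultimately show ?thesis using push_A1[OF \<xi>(1)] by (simp add: disk_inf_def fm_Some Some)
    qed
    then show ?case using 1 VG by auto
  qed
qed

text \<open>Here infinity goes to the finite point \<open>b\<close>, and \<open>f - b\<close>
  vanishes there to the order \<open>m\<close> by which \<open>degree Q\<close> exceeds the degree
  of \<open>P - smult b Q\<close>.\<close>

lemma infinity_map_finite:
  assumes dg: "degree P \<le> degree Q"
  defines "b \<equiv> (if degree P = degree Q then lead_coeff P / lead_coeff Q else 0)"
  assumes zeros: "\<And>c. poly ((P - smult b Q) * Q) c = 0 \<Longrightarrow> absv c \<le> R0"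
  obtains C m where "0 < C" "1 \<le> m"
    "\<And>R. R \<in> VG \<Longrightarrow> R0 \<le> R \<Longrightarrow> C / R ^ m \<in> VG \<and> fm (pt 0 R) = pt b (C / R ^ m) \<and> fm ` disk_inf 0 R \<subseteq> disk b (C / R ^ m)"
proof -
  define N where "N = P - smult b Q"
  have N: "N \<noteq> 0" unfolding N_def by (rule nonconst)
  have dN: "degree N < degree Q"
  proof -
    have "coeff N (degree Q) = 0" using Q_nz dg by (auto simp: N_def b_def coeff_eq_0)
    moreover have "degree N \<le> degree Q" unfolding N_def using dg
      by (intro degree_diff_le) (auto intro: order_trans[OF degree_smult_le])
    ultimately show ?thesis using N by (metis leading_coeff_0_iff le_neq_implies_less)
  qed
  define m where "m = degree Q - degree N"
  define C where "C = absv (lead_coeff N / lead_coeff Q)"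
  have C: "0 < C" using N Q_nz by (simp add: C_def)
  have dm: "degree Q = degree N + m" using dN by (simp add: m_def)
  show thesis
  proof (rule that[OF C, of m], goal_cases)
    case 1
    then show ?case using dN by (simp add: m_def)
  next
    case (2 R)
    have R: "0 < R" by (rule VG_pos[OF 2(1)])
    obtain \<rho> where \<rho>: "\<rho> \<noteq> 0" "R = absv \<rho>" using 2(1) by (auto simp: value_group_def)
    have "C / R ^ m = absv (lead_coeff N / lead_coeff Q / \<rho> ^ m)" unfolding C_def abs_divide abs_power \<rho>(2) ..
    moreover have "lead_coeff N / lead_coeff Q / \<rho> ^ m \<noteq> 0" using N Q_nz \<rho> by simp
    ultimately have VG: "C / R ^ m \<in> VG" by (auto simp: value_group_def simp del: divide_eq_0_iff)
    have zN: "absv c \<le> R" if "poly N c = 0" for c using zeros[of c] that 2(2) by (simp add: N_def)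
    have zQ: "absv c \<le> R" if "poly Q c = 0" for c using zeros[of c] that 2(2) by simp
    have ZN: "Z 0 R N = absv (lead_coeff N) * R ^ degree N" by (rule zeta_outside[OF 2(1) N zN])
    have ZQ: "Z 0 R Q = absv (lead_coeff Q) * R ^ degree Q" by (rule zeta_outside[OF 2(1) Q_nz zQ])
    have eq: "C / R ^ m * Z 0 R Q = Z 0 R N"
    proof -
      have "absv (lead_coeff Q) \<noteq> 0" using Q_nz by simp
      then show ?thesis unfolding ZQ ZN C_def abs_divide using R by (simp add: power_add flip: dm) (simp add: dm power_add)
    qed
    have ZQ0: "Z 0 R Q \<noteq> 0" using zeta_pos[OF 2(1) Q_nz, of 0] by simp
    have "push (Z 0 R) = Z b (C / R ^ m)"
    proof (rule push_eqI[OF zeta_A1[OF 2(1)] ZQ0 VG])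
      show "Z 0 R (P - smult b Q) = C / R ^ m * Z 0 R Q" using eq by (simp add: N_def)
      \<comment> \<open>Such a \<open>c\<close> differs from \<open>b\<close>, so
        \<open>P - smult c Q\<close> has full degree and its leading term provides the lower
        bound.\<close>
      fix c assume c: "absv (b - c) = C / R ^ m"
      then have bc: "b - c \<noteq> 0" using C R by auto
      have split: "P - smult c Q = N + smult (b - c) Q" by (simp add: N_def smult_diff_left)
      have "degree (P - smult c Q) = degree Q" unfolding split using dN bc
        by (subst degree_add_eq_right) auto
      moreover from this have "lead_coeff (P - smult c Q) = (b - c) * lead_coeff Q"
        unfolding split using dN by (simp add: coeff_eq_0)
      ultimately show "C / R ^ m * Z 0 R Q \<le> Z 0 R (P - smult c Q)"
        using zeta_ge_lead[OF 2(1) nonconst[of c], of 0] by (simp add: abs_mult c ZQ mult.assoc)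
    qed
    then have 1: "fm (pt 0 R) = pt b (C / R ^ m)" using ZQ0 by (simp add: fm_Some)
    have "fm y \<in> disk b (C / R ^ m)" if "y \<in> disk_inf 0 R" for y
    proof (cases y)
      case None
      then show ?thesis using dg C R zeta1_A1[of b]
        by (simp add: berk_map_def disk_def b_def[symmetric]) (simp add: zeta1_def)
    next
      case (Some \<xi>)
      then have \<xi>: "\<xi> \<in> A1" "R < \<xi> (lin 0)" using that by (auto simp: disk_inf_def)
      have xN: "\<xi> N = absv (lead_coeff N) * \<xi> (lin 0) ^ degree N" by (rule eval_outside_lin[OF \<xi>(1) N \<xi>(2) zN])
      have xQ: "\<xi> Q = absv (lead_coeff Q) * \<xi> (lin 0) ^ degree Q" by (rule eval_outside_lin[OF \<xi>(1) Q_nz \<xi>(2) zQ])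
      have x0: "0 < \<xi> (lin 0)" using \<xi> R by linarith
      have "push \<xi> (lin b) = C / \<xi> (lin 0) ^ m"
        unfolding push_lin using xN xQ x0 Q_nz by (simp add: N_def[symmetric] C_def abs_divide dm power_add)
      moreover have "R ^ m < \<xi> (lin 0) ^ m" using \<xi>(2) R dN by (intro power_strict_mono) (auto simp: m_def)
      then have "C / \<xi> (lin 0) ^ m < C / R ^ m" using C R x0 by (intro divide_strict_left_mono) auto
      moreover have "\<xi> Q \<noteq> 0" using xQ x0 Q_nz by simp
      ultimately show ?thesis using push_A1[OF \<xi>(1)] by (simp add: disk_def fm_Some Some)
    qed
    then show ?case using 1 VG by auto
  qed
qed

end

section \<open>Topology of the Berkovich line\<close>

context nonarch_closed begin

abbreviation "PT \<equiv> berk_P1_top absv"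
abbreviation "AT \<equiv> berk_A1_top absv"

lemma openin_AT_basic: "openin AT {\<xi> \<in> A1. a < \<xi> g \<and> \<xi> g < b}"
  unfolding berk_A1_top_def openin_subtopology
  by (rule exI[of _ "{\<xi> \<in> A1. a < \<xi> g \<and> \<xi> g < b}"]) (auto intro!: topology_generated_by_Basis)

lemma openin_AT_greater: "openin AT {\<xi> \<in> A1. a < \<xi> g}"
proof -
  have "{\<xi> \<in> A1. a < \<xi> g} = (\<Union>b. {\<xi> \<in> A1. a < \<xi> g \<and> \<xi> g < b})"
    by (auto intro: gt_ex)
  then show ?thesis by (auto intro!: openin_AT_basic)
qed

lemma topspace_AT: "topspace AT = A1"
proof
  show "topspace AT \<subseteq> A1" by (auto simp: berk_A1_top_def)
  have "A1 \<subseteq> {\<xi> \<in> A1. -1 < \<xi> 0}" by (auto simp: A1_0)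
  then show "A1 \<subseteq> topspace AT" using openin_subset[OF openin_AT_greater[of "-1" 0]] by blast
qed

lemma openin_PT_subset: "openin PT U \<Longrightarrow> U \<subseteq> berk_P1 absv"
  by (auto simp: berk_P1_top_def openin_subtopology)

lemma openin_PT_Some:
  assumes "openin AT W"
  shows "openin PT (Some ` W)"
proof -
  have "Some ` W \<subseteq> berk_P1 absv" using openin_subset[OF assms] topspace_AT by (auto simp: berk_P1_def)
  moreover have "openin (topology_generated_by
        ({Some ` V | V. openin AT V} \<union>
         {insert None (Some ` (A1 - K)) | K. compactin AT K \<and> closedin AT K})) (Some ` W)"
    using assms by (intro topology_generated_by_Basis) auto
  ultimately show ?thesis unfolding berk_P1_top_def openin_subtopology by blast
qed

lemma openin_PT_None:
  assumes "compactin AT K" "closedin AT K"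
  shows "openin PT (insert None (Some ` (A1 - K)))"
proof -
  have "insert None (Some ` (A1 - K)) \<subseteq> berk_P1 absv" by (auto simp: berk_P1_def)
  moreover have "openin (topology_generated_by
        ({Some ` V | V. openin AT V} \<union>
         {insert None (Some ` (A1 - K)) | K. compactin AT K \<and> closedin AT K})) (insert None (Some ` (A1 - K)))"
    using assms by (intro topology_generated_by_Basis) auto
  ultimately show ?thesis unfolding berk_P1_top_def openin_subtopology by blast
qed

text \<open>The topology of the affine line is that of pointwise convergence, so compactness of
  closed disks follows from Tychonoff's theorem.\<close>
lemma compactin_closed_disk: "compactin AT {\<xi> \<in> A1. \<xi> (lin a) \<le> r}" (is "compactin AT ?K")
proof -
  have "\<exists>B. \<forall>\<xi>\<in>?K. \<xi> p \<le> B" for p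
  proof (induction p rule: linear_factor_induct)
    case zero
    then show ?case by (auto simp: A1_0)
  next
    case (const c)
    then show ?case by (auto simp: A1_const)
  next
    case (mult c p)
    then obtain B where B: "\<And>\<xi>. \<xi> \<in> ?K \<Longrightarrow> \<xi> p \<le> B" by auto
    have "\<xi> (lin c * p) \<le> max r (absv (a - c)) * B" if "\<xi> \<in> ?K" for \<xi>
    proof -
      have \<xi>: "\<xi> \<in> A1" "\<xi> (lin a) \<le> r" using that by auto
      have "\<xi> (lin c) \<le> max r (absv (a - c))" using A1_lin_le[OF \<xi>(1), of c a] \<xi>(2) by auto
      then have "\<xi> (lin c) * \<xi> p \<le> max r (absv (a - c)) * B"
        using B[OF that] A1_nonneg[OF \<xi>(1)] by (intro mult_mono) (auto intro: le_max_iff_disj[THEN iffD2])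
      then show ?thesis by (simp add: A1_mult[OF \<xi>(1)])
    qed
    then show ?case by blast
  qed
  then have "\<exists>B. \<forall>p. \<forall>\<xi>\<in>?K. \<xi> p \<le> B p" by (intro choice allI)
  then obtain B where B: "\<And>p \<xi>. \<xi> \<in> ?K \<Longrightarrow> \<xi> p \<le> B p" by blast
  have coord: "continuous_on UNIV (\<lambda>\<xi> :: 'k poly \<Rightarrow> real. \<xi> p)" for p
    by (rule continuous_on_product_coordinates)
  have "closed ({\<xi>. \<forall>p. 0 \<le> \<xi> p} \<inter> {\<xi>. \<forall>p q. \<xi> (p * q) = \<xi> p * \<xi> q} \<inter>
       {\<xi>. \<forall>p q. \<xi> (p + q) \<le> max (\<xi> p) (\<xi> q)} \<inter> {\<xi>. \<forall>c. \<xi> [:c:] = absv c} \<inter> {\<xi> :: 'k poly \<Rightarrow> real. \<xi> (lin a) \<le> r})"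
    by (intro closed_Int closed_Collect_all closed_Collect_le closed_Collect_eq coord
        continuous_on_const continuous_on_mult continuous_on_max)
  also have "\<dots> = ?K" by (auto simp: berk_A1_def)
  finally have closed: "closed ?K" .
  have "compactin (product_topology (\<lambda>p::'k poly. euclideanreal) UNIV) (PiE UNIV (\<lambda>p. {0..B p}))"
    by (subst compactin_PiE) (auto simp: compactin_euclidean_iff)
  then have "compact (PiE UNIV (\<lambda>p. {0..B p}))"
    by (simp add: euclidean_product_topology)
  moreover have "?K \<subseteq> PiE UNIV (\<lambda>p. {0..B p})" using B A1_nonneg by (auto simp: PiE_def)
  ultimately have "compact ?K" using closed compact_Int_closed[of "PiE UNIV (\<lambda>p. {0..B p})" ?K]
    by (simp add: Int_absorb1)
  then have K: "compactin (subtopology euclidean A1) ?K" by (auto simp: compactin_subtopology)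
  have "continuous_map (subtopology euclidean A1) AT (\<lambda>x. x)"
    unfolding berk_A1_top_def
  proof (intro continuous_map_into_subtopology)
    show "continuous_map (subtopology euclidean A1)
       (topology_generated_by {{\<zeta> \<in> A1. a < \<zeta> g \<and> \<zeta> g < b} |g a b. True}) (\<lambda>x. x)"
      unfolding continuous_on_generated_topo_iff
    proof (intro conjI allI impI)
      fix U assume "U \<in> {{\<zeta> \<in> A1. a < \<zeta> g \<and> \<zeta> g < b} |g a b. True}"
      then obtain g b c where U: "U = {\<zeta> \<in> A1. b < \<zeta> g \<and> \<zeta> g < c}" by auto
      have "open {\<zeta> :: 'k poly \<Rightarrow> real. b < \<zeta> g \<and> \<zeta> g < c}"
        by (intro open_Collect_conj open_Collect_less coord continuous_on_const)
      then show "openin (top_of_set A1) ((\<lambda>x. x) -` U \<inter> topspace (top_of_set A1))"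
        unfolding openin_open U by auto
    next
      have "A1 \<subseteq> {\<zeta> \<in> A1. -1 < \<zeta> 0 \<and> \<zeta> 0 < 1}" by (auto simp: A1_0)
      then show "(\<lambda>x. x) ` topspace (top_of_set A1) \<subseteq> \<Union> {{\<zeta> \<in> A1. a < \<zeta> g \<and> \<zeta> g < b} |g a b. True}"
        by auto
    qed
  qed auto
  from image_compactin[OF K this] show ?thesis by simp
qed

lemma openin_disk: "openin PT (disk a r)"
proof -
  have "disk a r = Some ` {\<xi> \<in> A1. -1 < \<xi> (lin a) \<and> \<xi> (lin a) < r}"
    using A1_nonneg[of _ "lin a"] by (fastforce simp: disk_def image_iff intro: less_le_trans[of "-1" 0])
  then show ?thesis using openin_PT_Some[OF openin_AT_basic] by simp
qed

lemma openin_disk_inf: "openin PT (disk_inf a r)"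
proof -
  let ?K = "{\<xi> \<in> A1. \<xi> (lin a) \<le> r}"
  have "disk_inf a r = insert None (Some ` (A1 - ?K))" by (auto simp: disk_inf_def)
  moreover have "A1 - ?K = {\<xi> \<in> A1. r < \<xi> (lin a)}" by auto
  then have "closedin AT ?K" using openin_AT_greater[of r "lin a"] by (auto simp: closedin_def topspace_AT)
  ultimately show ?thesis using openin_PT_None[OF compactin_closed_disk] by simp
qed

lemma disk_mono:
  assumes "absv (a - b) < s" "r \<le> s"
  shows "disk a r \<subseteq> disk b s"
proof
  fix y assume "y \<in> disk a r"
  then obtain \<xi> where "y = Some \<xi>" "\<xi> \<in> A1" "\<xi> (lin a) < r" by (auto simp: disk_def)
  then show "y \<in> disk b s" using A1_lin_le[of \<xi> b a] assms by (auto simp: disk_def)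
qed

lemma disk_overlap: "y \<in> disk a r \<Longrightarrow> y \<in> disk b s \<Longrightarrow> absv (a - b) < max r s"
proof -
  assume "y \<in> disk a r" "y \<in> disk b s"
  then obtain \<xi> where "\<xi> \<in> A1" "\<xi> (lin a) < r" "\<xi> (lin b) < s" by (auto simp: disk_def)
  then show ?thesis using A1_lin_eq_abs[of \<xi> a b] by (auto simp: max_def) (smt (verit))+
qed

lemma pt_in_disk: "r \<in> VG \<Longrightarrow> pt a r \<in> disk b s \<longleftrightarrow> max r (absv (a - b)) < s"
  by (auto simp: disk_def zeta_A1 zeta_lin)

lemma pt_in_disk_inf: "r \<in> VG \<Longrightarrow> pt a r \<in> disk_inf b s \<longleftrightarrow> s < max r (absv (a - b))"
  by (auto simp: disk_inf_def zeta_A1 zeta_lin)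

text \<open>If \<open>\<xi> (lin b)\<close> were \<open>r\<close> for every \<open>b\<close> in the
  closed disk, the values of \<open>\<xi>\<close> on linear polynomials would be those of
  \<open>Z a r\<close>, and these determine it.\<close>

lemma direction_exists:
  assumes "r \<in> VG" "\<xi> \<in> A1" "\<xi> (lin a) \<le> r" "\<xi> \<noteq> Z a r"
  obtains b where "absv (b - a) \<le> r" "Some \<xi> \<in> disk b r"
proof -
  have "\<exists>b. absv (b - a) \<le> r \<and> \<xi> (lin b) < r"
  proof (rule ccontr)
    assume *: "\<not> ?thesis"
    have "\<xi> = Z a r"
    proof (rule zeta_eqI[OF assms(2,1)])
      fix c
      show "\<xi> (lin c) = max r (absv (a - c))"
      proof (cases "absv (a - c) \<le> r")
        case True
        then have "r \<le> \<xi> (lin c)" using * by (auto simp: abs_minus_commute[of a])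
        then show ?thesis using A1_lin_le[OF assms(2), of c a] assms(3) True by auto
      next
        case False
        then show ?thesis using A1_lin_eq_abs[OF assms(2), of a c] assms(3) by auto
      qed
    qed
    then show False using assms(4) by simp
  qed
  then show thesis using that assms(2) by (auto simp: disk_def)
qed

text \<open>The complement is the union of the remaining directions at \<open>pt a r\<close>. The
  set \<open>B\<close> may be infinite, as \<open>trap_periodic\<close> requires: an orbit may visit
  infinitely many directions at one periodic point.\<close>

lemma openin_compl_directions:
  assumes r: "r \<in> VG" and B: "\<And>b. b \<in> B \<Longrightarrow> absv (b - a) \<le> r"
  shows "openin PT (berk_P1 absv - ((\<Union>b\<in>B. disk b r) \<union> {pt a r}))"
proof -
  define C where "C = {b. absv (b - a) \<le> r \<and> disk b r \<inter> (\<Union>b\<in>B. disk b r) = {}}"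
  have "berk_P1 absv - ((\<Union>b\<in>B. disk b r) \<union> {pt a r}) = disk_inf a r \<union> (\<Union>b\<in>C. disk b r)"
  proof (intro subset_antisym subsetI)
    fix y assume y: "y \<in> berk_P1 absv - ((\<Union>b\<in>B. disk b r) \<union> {pt a r})"
    show "y \<in> disk_inf a r \<union> (\<Union>b\<in>C. disk b r)"
    proof (cases "y \<in> disk_inf a r")
      case False
      then have y': "y \<in> berk_P1 absv" "y \<notin> disk_inf a r" "y \<noteq> pt a r" using y by auto
      then obtain \<xi> where \<xi>0: "y = Some \<xi>" "\<xi> \<in> A1" by (auto simp: disk_inf_def berk_P1_def)
      then have \<xi>: "y = Some \<xi>" "\<xi> \<in> A1" "\<xi> (lin a) \<le> r" "\<xi> \<noteq> Z a r" using y' by (auto simp: disk_inf_def)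
      obtain b where b: "absv (b - a) \<le> r" "y \<in> disk b r" using direction_exists[OF r \<xi>(2-4)] \<xi>(1) by auto
      have "disk b r \<inter> disk b' r = {}" if "b' \<in> B" for b'
      proof (rule ccontr)
        assume "disk b r \<inter> disk b' r \<noteq> {}"
        then have "absv (b - b') < r" using disk_overlap by fastforce
        then have "y \<in> disk b' r" using b(2) disk_mono[of b b' r r] by auto
        then show False using y that by auto
      qed
      then show ?thesis using b by (auto simp: C_def)
    qed auto
  next
    fix y assume y: "y \<in> disk_inf a r \<union> (\<Union>b\<in>C. disk b r)"
    have P1: "y \<in> berk_P1 absv" using y by (auto simp: disk_inf_def disk_def berk_P1_def)
    have ne: "y \<noteq> pt a r" using y pt_in_disk_inf[OF r, of a a r] pt_in_disk[OF r, of a] VG_pos[OF r] by auto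
    have disj: "y \<notin> disk b r" if "y \<in> disk_inf a r" "absv (b - a) \<le> r" for b
      using that A1_lin_le[of _ a b] by (auto simp: disk_inf_def disk_def) (smt (verit))
    from y P1 ne show "y \<in> berk_P1 absv - ((\<Union>b\<in>B. disk b r) \<union> {pt a r})"
      using disj B by (auto simp: C_def)
  qed
  then show ?thesis by (simp only:) (intro openin_Un openin_disk_inf openin_Union; auto intro: openin_disk)
qed

lemma openin_compl_disk: "r \<in> VG \<Longrightarrow> openin PT (berk_P1 absv - (disk b r \<union> {pt b r}))"
  using openin_compl_directions[of r "{b}" b] VG_pos[of r] by simp

lemma openin_compl_disk_inf:
  assumes r: "r \<in> VG"
  shows "openin PT (berk_P1 absv - (disk_inf a r \<union> {pt a r}))"
proof -
  have "berk_P1 absv - (disk_inf a r \<union> {pt a r}) = (\<Union>b\<in>{b. absv (b - a) \<le> r}. disk b r)"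
  proof (intro subset_antisym subsetI)
    fix y assume "y \<in> berk_P1 absv - (disk_inf a r \<union> {pt a r})"
    then have y: "y \<in> berk_P1 absv" "y \<notin> disk_inf a r" "y \<noteq> pt a r" by auto
    then obtain \<xi> where \<xi>0: "y = Some \<xi>" "\<xi> \<in> A1" by (auto simp: disk_inf_def berk_P1_def)
    then have \<xi>: "y = Some \<xi>" "\<xi> \<in> A1" "\<xi> (lin a) \<le> r" "\<xi> \<noteq> Z a r" using y by (auto simp: disk_inf_def)
    then show "y \<in> (\<Union>b\<in>{b. absv (b - a) \<le> r}. disk b r)" using direction_exists[OF r \<xi>(2-4)] by auto
  next
    fix y assume "y \<in> (\<Union>b\<in>{b. absv (b - a) \<le> r}. disk b r)"
    then obtain b \<xi> where "absv (b - a) \<le> r" "y = Some \<xi>" "\<xi> \<in> A1" "\<xi> (lin b) < r" by (auto simp: disk_def)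
    then show "y \<in> berk_P1 absv - (disk_inf a r \<union> {pt a r})"
      using A1_lin_le[of \<xi> a b] zeta_lin[OF r, of a b] by (auto simp: disk_inf_def berk_P1_def)
  qed
  then show ?thesis using openin_disk by auto
qed

text \<open>With the boundary \<open>B\<close> among the vertices, \<open>G\<close> and the open
  exterior of \<open>G \<union> B\<close> separate the complement of \<Gamma>, so a component
  meeting \<open>G\<close> stays in it.\<close>

lemma domain_subset:
  assumes G: "openin PT G" "openin PT (berk_P1 absv - (G \<union> B))" and "B \<subseteq> \<Gamma>" "G \<inter> \<Gamma> = {}" "y \<in> G"
  obtains U where "U \<in> Gamma_domains absv \<Gamma>" "y \<in> U" "U \<subseteq> G"
proof -
  define Y where "Y = subtopology PT (berk_P1 absv - \<Gamma>)"
  have GP: "G \<subseteq> berk_P1 absv" "G \<subseteq> topspace PT" using openin_PT_subset[OF G(1)] openin_subset[OF G(1)] by auto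
  define U where "U = connected_component_of_set Y y"
  have y: "y \<in> topspace Y" using GP assms by (auto simp: Y_def)
  have "U \<in> Gamma_domains absv \<Gamma>" unfolding Gamma_domains_def U_def Y_def[symmetric]
    using y by (simp add: connected_component_in_connected_components_of)
  moreover have yU: "y \<in> U" using y by (simp add: U_def connected_component_of_refl)
  moreover have "U \<subseteq> G"
  proof -
    have conn: "connectedin Y U" unfolding U_def by (rule connectedin_connected_component_of)
    then have UP: "U \<subseteq> berk_P1 absv - \<Gamma>" using connectedin_subset_topspace by (fastforce simp: Y_def)
    have o1: "openin Y ((berk_P1 absv - \<Gamma>) \<inter> G)" unfolding Y_def by (rule openin_subtopology_Int2[OF G(1)])
    have o2: "openin Y ((berk_P1 absv - \<Gamma>) \<inter> (berk_P1 absv - (G \<union> B)))"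
      unfolding Y_def by (rule openin_subtopology_Int2[OF G(2)])
    have cover: "U \<subseteq> (berk_P1 absv - \<Gamma>) \<inter> G \<union> (berk_P1 absv - \<Gamma>) \<inter> (berk_P1 absv - (G \<union> B))"
      using UP assms(3) by auto
    have "(berk_P1 absv - \<Gamma>) \<inter> (berk_P1 absv - (G \<union> B)) \<inter> U = {}"
    proof (rule ccontr)
      assume ne: "\<not> ?thesis"
      have "(berk_P1 absv - \<Gamma>) \<inter> G \<inter> U \<noteq> {}" using yU assms(5) UP by auto
      then show False using conn o1 o2 cover ne unfolding connectedin by blast
    qed
    then show ?thesis using cover by auto
  qed
  ultimately show thesis by (rule that)
qed

end

section \<open>Orbits of split points\<close>

locale split_dynamics = rational_map absv P Q for absv :: "'k::field \<Rightarrow> real" and P Q +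
  fixes L :: "'k set" and q :: real
  assumes L_subfield: "is_subfield L" and q_bounds: "0 < q" "q < 1"
    and value_group_L: "value_group absv L = range (\<lambda>n :: int. q powi n)"
    and coeffs_L: "\<And>i. coeff P i \<in> L" "\<And>i. coeff Q i \<in> L"
begin

text \<open>Since \<open>q < 1\<close>, levels run against radii: a larger \<open>m\<close> means a
  smaller disk, and levels tend to minus infinity towards infinity.\<close>

abbreviation D :: "'k \<Rightarrow> int \<Rightarrow> ('k poly \<Rightarrow> real) option" where "D a m \<equiv> pt a (q powi m)"

definition split_pts :: "('k poly \<Rightarrow> real) option set" where "split_pts = {D a m | a m. a \<in> L}"

lemma q_pos [simp]: "0 < q powi m"
  using q_bounds by simp

lemma q_nonneg [simp]: "0 \<le> q powi m"
  using q_pos[of m] by linarith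

lemma q_less_iff [simp]: "q powi m < q powi n \<longleftrightarrow> n < m"
proof -
  have "q powi j < q powi i" if "i < j" for i j
    by (intro power_int_strict_decreasing that q_bounds)
  then show ?thesis by (metis less_asym less_irrefl linorder_neqE)
qed

lemma q_le_iff [simp]: "q powi m \<le> q powi n \<longleftrightarrow> n \<le> m"
  using q_less_iff[of n m] by (meson not_less)

lemma q_eq_iff [simp]: "q powi m = q powi n \<longleftrightarrow> m = n"
  using q_less_iff[of n m] q_less_iff[of m n] by (metis less_irrefl linorder_neqE)

lemma q_VG [simp]: "q powi m \<in> VG"
proof -
  have "q powi m \<in> value_group absv L" by (simp add: value_group_L)
  then show ?thesis by (auto simp: value_group_def)
qed

lemma L_diff: "a \<in> L \<Longrightarrow> b \<in> L \<Longrightarrow> a - b \<in> L"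
  using L_subfield by (simp add: is_subfield_def)

text \<open>Centres in \<open>L\<close> at distance less than \<open>q powi m\<close> thus define
  the same split point at level \<open>m + 1\<close>; this is how discreteness acts on the
  tree.\<close>

lemma discrete: "x \<in> L \<Longrightarrow> absv x < q powi m \<Longrightarrow> absv x \<le> q powi (m + 1)"
proof (cases "x = 0")
  case False
  assume x: "x \<in> L" "absv x < q powi m"
  have "absv x \<in> value_group absv L" using x False by (auto simp: value_group_def)
  then obtain n where n: "absv x = q powi n" by (auto simp: value_group_L)
  then show ?thesis using x(2) by simp
qed (simp add: less_imp_le)

lemma D_eq_iff: "Z a (q powi m) = Z b (q powi n) \<longleftrightarrow> m = n \<and> absv (a - b) \<le> q powi m"
  using zeta_eq_iff[of "q powi m" "q powi n" a b] by auto

lemma fm_split: "y \<in> split_pts \<Longrightarrow> fm y \<in> split_pts"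
proof -
  assume "y \<in> split_pts"
  then obtain a m where y: "y = D a m" "a \<in> L" by (auto simp: split_pts_def)
  have "q powi m \<in> value_group absv L" by (simp add: value_group_L)
  from fm_l_split[OF L_subfield y(2) this coeffs_L] obtain b s
    where "b \<in> L" "s \<in> value_group absv L" "fm y = pt b s" using y(1) by metis
  then show ?thesis by (auto simp: split_pts_def value_group_L)
qed

text \<open>Forward invariant open sets bounded by finitely many \<open>L\<close>-split points; adding
  the boundary to the vertex set turns their components into F-domains.\<close>
definition trap :: "('k poly \<Rightarrow> real) option set \<Rightarrow> ('k poly \<Rightarrow> real) option set \<Rightarrow> bool" where
  "trap G B \<longleftrightarrow> openin PT G \<and> openin PT (berk_P1 absv - (G \<union> B)) \<and> fm ` G \<subseteq> G \<and> finite B \<and> B \<subseteq> split_pts \<and>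
     (\<forall>b\<in>B. finite (range (\<lambda>n. (fm ^^ n) b)) \<or> (\<exists>n. (fm ^^ n) b \<in> G))"

lemma openin_compl_Union:
  assumes "finite I" "I \<noteq> {}" "\<And>i. i \<in> I \<Longrightarrow> openin PT (berk_P1 absv - H i)" "(\<Union>i\<in>I. H i) = G"
  shows "openin PT (berk_P1 absv - G)"
proof -
  have "berk_P1 absv - G = (\<Inter>i\<in>I. berk_P1 absv - H i)" using assms(2,4) by auto
  also have "openin PT \<dots>" using assms(1-3) by (intro openin_INT2) auto
  finally show ?thesis .
qed

text \<open>Each domain is bounded by a single orbit point. As \<open>b T\<close> lies in
  \<open>U 0\<close>, every boundary point enters the union, which is the last clause of
  \<open>trap\<close>.\<close>

lemma trap_of_chain:
  assumes T: "1 \<le> T"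
    and U: "\<And>t. t < T \<Longrightarrow> openin PT (U t)" "\<And>t. t < T \<Longrightarrow> openin PT (berk_P1 absv - (U t \<union> {b t}))"
    and b: "\<And>t. t < T \<Longrightarrow> b t \<in> split_pts" "\<And>t. t < T \<Longrightarrow> fm (b t) = b (Suc t)"
    and maps: "\<And>t. t < T \<Longrightarrow> fm ` U t \<subseteq> U (Suc t)"
    and ret: "U T \<subseteq> U 0" "b T \<in> U 0"
  shows "trap (\<Union>t<T. U t) (b ` {..<T})"
  unfolding trap_def
proof (intro conjI ballI)
  show "openin PT (\<Union>t<T. U t)" using U by auto
  show "openin PT (berk_P1 absv - ((\<Union>t<T. U t) \<union> b ` {..<T}))"
    by (rule openin_compl_Union[of "{..<T}" "\<lambda>t. U t \<union> {b t}"]) (use T U in \<open>auto simp: lessThan_empty_iff bot_nat_def\<close>)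
  show "fm ` (\<Union>t<T. U t) \<subseteq> (\<Union>t<T. U t)"
  proof
    fix y assume "y \<in> fm ` (\<Union>t<T. U t)"
    then obtain t where t: "t < T" "y \<in> U (Suc t)" using maps by blast
    show "y \<in> (\<Union>t<T. U t)"
    proof (cases "Suc t = T")
      case True
      then have "y \<in> U 0" using t ret by auto
      then show ?thesis using T by auto
    next
      case False
      then have "Suc t < T" using t by simp
      then show ?thesis using t by blast
    qed
  qed
  show "finite (b ` {..<T})" "b ` {..<T} \<subseteq> split_pts" using b by auto
  fix c assume "c \<in> b ` {..<T}"
  then obtain t where t: "t < T" "c = b t" by auto
  have "(fm ^^ s) (b t) = b (t + s)" if "t + s \<le> T" for s
    using that by (induction s) (auto simp: b)
  from this[of "T - t"] have "(fm ^^ (T - t)) c = b T" using t by simp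
  then have "(fm ^^ (T - t)) c \<in> (\<Union>t<T. U t)" using ret T by auto
  then show "finite (range (\<lambda>n. (fm ^^ n) c)) \<or> (\<exists>n. (fm ^^ n) c \<in> (\<Union>t<T. U t))" by blast
qed

end

section \<open>Marked points and disks avoiding them\<close>

locale marked_dynamics = split_dynamics absv P Q L q for absv :: "'k::field \<Rightarrow> real" and P Q L q +
  fixes S :: "'k set"
  assumes finite_S: "finite S" and zero_S: "0 \<in> S" and zeros_S: "\<And>c. poly (P * Q * wronskian) c = 0 \<Longrightarrow> c \<in> S"
begin

text \<open>The open disk of radius \<open>q powi m\<close> about \<open>a\<close> avoids the marked points, so \<open>f\<close> has neither
  critical points nor poles there and scales distances by a constant.\<close>
definition free :: "'k \<Rightarrow> int \<Rightarrow> bool" where "free a m \<longleftrightarrow> (\<forall>s\<in>S. q powi m \<le> absv (a - s))"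

lemma free_mono: "free a m \<Longrightarrow> m \<le> n \<Longrightarrow> free a n"
  unfolding free_def by (meson order_trans q_le_iff)

text \<open>The scaling factor of \<open>linear_on_disk\<close> is a real number; since the image of
  one split point is split, it is a power of \<open>q\<close>. Hence one shift \<open>l\<close>
  serves all levels from \<mu> on.\<close>

lemma free_linear:
  assumes "a \<in> L" "free a \<mu>"
  obtains l where "\<And>\<nu>. \<mu> \<le> \<nu> \<Longrightarrow> fm (D a \<nu>) = D (ev a) (\<nu> + l)"
    "\<And>\<nu>. \<mu> \<le> \<nu> \<Longrightarrow> fm ` disk a (q powi \<nu>) \<subseteq> disk (ev a) (q powi (\<nu> + l))"
proof -
  have zQ: "q powi \<mu> \<le> absv (a - c)" if "poly Q c = 0" for c
    using zeros_S[of c] that assms(2) by (auto simp: free_def)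
  have zw: "q powi \<mu> \<le> absv (a - c)" if "poly wronskian c = 0" for c
    using zeros_S[of c] that assms(2) by (auto simp: free_def)
  obtain k where k: "\<And>r. r \<in> VG \<Longrightarrow> r \<le> q powi \<mu> \<Longrightarrow> Z a r (P - smult (ev a) Q) / absv (poly Q a) = k * r"
    using linear_on_disk[OF q_pos zQ zw] by metis
  have fm: "fm (D a \<nu>) = pt (ev a) (k * q powi \<nu>)" "fm ` disk a (q powi \<nu>) \<subseteq> disk (ev a) (k * q powi \<nu>)"
    "k * q powi \<nu> \<in> VG" if "\<mu> \<le> \<nu>" for \<nu>
  proof -
    have le: "q powi \<nu> \<le> q powi \<mu>" using that by simp
    then have zQ': "q powi \<nu> \<le> absv (a - c)" if "poly Q c = 0" for c using zQ[OF that] by linarith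
    show "fm (D a \<nu>) = pt (ev a) (k * q powi \<nu>)" "fm ` disk a (q powi \<nu>) \<subseteq> disk (ev a) (k * q powi \<nu>)"
      "k * q powi \<nu> \<in> VG"
      using disk_map[OF q_VG zQ'] k[OF q_VG le] by simp_all
  qed
  have "D a \<mu> \<in> split_pts" using assms(1) by (auto simp: split_pts_def)
  then obtain b n where b: "fm (D a \<mu>) = D b n" using fm_split[of "D a \<mu>"] by (auto simp: split_pts_def)
  then have "k * q powi \<mu> = q powi n"
    using fm(1)[of \<mu>] zeta_eq_iff[OF fm(3)[of \<mu>] q_VG, of "ev a" b n] by auto
  then have "k = q powi (n - \<mu>)" using q_bounds by (simp add: power_int_diff field_simps)
  then have "k * q powi \<nu> = q powi (\<nu> + (n - \<mu>))" for \<nu> using q_bounds by (simp add: power_int_add[symmetric] add.commute)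
  then show thesis using fm that[of "n - \<mu>"] by simp
qed

end

section \<open>Depth along an infinite orbit and the recurrent cases\<close>

locale split_orbit = marked_dynamics absv P Q L q S
  for absv :: "'k::field \<Rightarrow> real" and P Q L q S +
  fixes x :: "nat \<Rightarrow> ('k poly \<Rightarrow> real) option" and a :: "nat \<Rightarrow> 'k" and m :: "nat \<Rightarrow> int"
  assumes x_eq: "\<And>n. x n = D (a n) (m n)" and a_L: "\<And>n. a n \<in> L"
    and x_Suc: "\<And>n. fm (x n) = x (Suc n)" and inj_x: "inj x"
begin

text \<open>The distance, in the tree of \<open>L\<close>-split points, from \<open>x n\<close> to the hull of \<open>S\<close> and infinity.
  A point \<open>n\<close> at which all later depths are at least as large has the property that the disk
  between \<open>x n\<close> and this hull is mapped forward univalently forever.\<close>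
definition depth :: "nat \<Rightarrow> nat" where "depth n = (LEAST j. \<not> free (a n) (m n - int (Suc j)))"

text \<open>\<open>anc n j\<close> lies \<open>j\<close> levels from \<open>x n\<close> on the path
  to infinity; for \<open>1 \<le> j\<close> the disk \<open>W n j\<close> is the direction at
  \<open>anc n j\<close> containing \<open>x n\<close>.\<close>

abbreviation "anc n j \<equiv> D (a n) (m n - int j)"
abbreviation "W n j \<equiv> disk (a n) (q powi (m n - int j))"

text \<open>Large disks around \<open>a n\<close> contain the marked point \<open>0\<close>, so the
  depth is finite. The case \<open>j = 0\<close> is excluded because \<open>depth n = 0\<close> says
  nothing about the disk of \<open>x n\<close> itself.\<close>

lemma free_iff_depth: "1 \<le> j \<Longrightarrow> free (a n) (m n - int j) \<longleftrightarrow> j \<le> depth n"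
proof -
  have ex: "\<exists>j. \<not> free (a n) (m n - int (Suc j))"
  proof -
    obtain N where N: "absv (a n) / q powi (m n) < (1/q) ^ N"
      using real_arch_pow[of "1/q"] q_bounds by auto
    have "q powi (m n - int N) = q powi (m n) * (1/q) ^ N"
      using q_bounds by (simp add: power_int_diff power_divide)
    then have "absv (a n - 0) < q powi (m n - int N)" using N by (simp add: pos_divide_less_eq mult.commute)
    also have "\<dots> \<le> q powi (m n - int (Suc N))" by simp
    finally show ?thesis using zero_S by (force simp: free_def not_le)
  qed
  assume j: "1 \<le> j"
  show ?thesis
  proof
    assume f: "free (a n) (m n - int j)"
    show "j \<le> depth n"
    proof (rule ccontr)
      assume "\<not> j \<le> depth n"
      then have "m n - int j \<le> m n - int (Suc (depth n))" by simp
      then have "free (a n) (m n - int (Suc (depth n)))" using free_mono f by blast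
      then show False using LeastI_ex[OF ex] by (simp add: depth_def)
    qed
  next
    assume "j \<le> depth n"
    then have "\<not> \<not> free (a n) (m n - int (Suc (j - 1)))" using j unfolding depth_def by (intro not_less_Least) auto
    then show "free (a n) (m n - int j)" using j by simp
  qed
qed

text \<open>On a free disk all levels shift by the same amount, so \<open>f\<close> commutes with
  passing to the ancestor within the depth.\<close>

lemma orbit_step:
  assumes "j \<le> depth n"
  shows "fm (anc n j) = anc (Suc n) j" and "1 \<le> j \<Longrightarrow> fm ` W n j \<subseteq> W (Suc n) j"
proof -
  have "fm (anc n j) = anc (Suc n) j \<and> fm ` W n j \<subseteq> W (Suc n) j" if "1 \<le> j"
  proof -
    have "free (a n) (m n - int j)" using free_iff_depth that assms by blast
    then obtain l where l: "\<And>\<nu>. m n - int j \<le> \<nu> \<Longrightarrow> fm (D (a n) \<nu>) = D (ev (a n)) (\<nu> + l)"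
      "\<And>\<nu>. m n - int j \<le> \<nu> \<Longrightarrow> fm ` disk (a n) (q powi \<nu>) \<subseteq> disk (ev (a n)) (q powi (\<nu> + l))"
      using free_linear[OF a_L] by metis
    have "D (ev (a n)) (m n + l) = D (a (Suc n)) (m (Suc n))" using l(1)[of "m n"] x_Suc[of n] by (simp add: x_eq)
    then have eq: "m (Suc n) = m n + l" "absv (ev (a n) - a (Suc n)) \<le> q powi m (Suc n)"
      by (auto simp: D_eq_iff)
    have "q powi m (Suc n) < q powi (m (Suc n) - int j)" using that by simp
    then have lt: "absv (ev (a n) - a (Suc n)) < q powi (m (Suc n) - int j)" using eq(2) by linarith
    have "fm (anc n j) = D (ev (a n)) (m n - int j + l)" using l(1) by simp
    also have "\<dots> = anc (Suc n) j" using eq(1) lt by (simp add: D_eq_iff algebra_simps)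
    finally have 1: "fm (anc n j) = anc (Suc n) j" .
    have "fm ` W n j \<subseteq> disk (ev (a n)) (q powi (m n - int j + l))" using l(2) by simp
    also have "\<dots> \<subseteq> W (Suc n) j" using eq(1) lt by (intro disk_mono) auto
    finally show ?thesis using 1 by simp
  qed
  then show "fm (anc n j) = anc (Suc n) j" and "1 \<le> j \<Longrightarrow> fm ` W n j \<subseteq> W (Suc n) j"
    using x_Suc[of n] by (cases "j = 0"; auto simp: x_eq)+
qed

definition tail_min :: "nat set" where "tail_min = {n. \<forall>k\<ge>n. depth n \<le> depth k}"

abbreviation "rho n \<equiv> anc n (depth n)"

lemma tail_min_unbounded: "\<exists>n\<ge>N. n \<in> tail_min"
proof -
  obtain n where n: "n \<ge> N" "\<And>k. k \<ge> N \<Longrightarrow> depth n \<le> depth k"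
    using ex_has_least_nat[of "\<lambda>n. n \<ge> N" N depth] by auto
  then show ?thesis by (intro exI[of _ n]) (auto simp: tail_min_def)
qed

lemma tail_min_depth: "n \<in> tail_min \<Longrightarrow> depth n \<le> depth (n + t)"
  by (simp add: tail_min_def)

lemma funpow_anc: "n \<in> tail_min \<Longrightarrow> j \<le> depth n \<Longrightarrow> (fm ^^ t) (anc n j) = anc (n + t) j"
  using tail_min_depth[of n] by (induction t) (auto simp: orbit_step order_trans)

lemma anc_split: "anc n j \<in> split_pts"
  using a_L by (auto simp: split_pts_def)

lemma x_in_W: "1 \<le> j \<Longrightarrow> x n \<in> W n j"
  by (simp add: x_eq pt_in_disk)

lemma W_free: "1 \<le> j \<Longrightarrow> j \<le> depth n \<Longrightarrow> s \<in> S \<Longrightarrow> D s \<mu> \<notin> W n j"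
  using free_iff_depth[of j n] by (auto simp: pt_in_disk free_def abs_minus_commute[of s])

text \<open>Equal depths make \<open>rho n\<close> periodic, and its cycle is the finite boundary.
  The directions \<open>W (n + t) i\<close> at the cycle points may never repeat, so all of them are
  put into the trap.\<close>

lemma trap_periodic:
  assumes n: "n \<in> tail_min" "n' \<in> tail_min" "n < n'" and rho: "rho n = rho n'" and depth: "depth n = depth n'"
  shows "\<exists>G B. trap G B \<and> x n \<in> G \<and> (\<forall>s\<in>S. \<forall>\<mu>. D s \<mu> \<notin> G)"
proof -
  define i where "i = depth n"
  define T where "T = n' - n"
  \<comment> \<open>Depth zero would make \<open>x n\<close> equal to \<open>x n'\<close>.\<close>
  have i: "1 \<le> i"
  proof (rule ccontr)
    assume "\<not> 1 \<le> i"
    then have "depth n = 0" "depth n' = 0" using depth by (auto simp: i_def)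
    then have "x n = x n'" using rho by (simp add: x_eq)
    then show False using inj_x n(3) by (metis inj_eq less_irrefl)
  qed
  have orbit: "(fm ^^ t) (rho n) = anc (n + t) i" for t using funpow_anc[OF n(1)] by (simp add: i_def)
  have "(fm ^^ T) (rho n) = rho n" using orbit[of T] n(3) rho depth by (simp add: T_def i_def)
  then have per: "(fm ^^ t) (rho n) = (fm ^^ (t mod T)) (rho n)" for t
    by (metis funpow_mod_eq)
  define Orb where "Orb = range (\<lambda>t. anc (n + t) i)"
  have "Orb \<subseteq> (\<lambda>t. (fm ^^ t) (rho n)) ` {..<T}"
  proof
    fix y assume "y \<in> Orb"
    then obtain t where "y = (fm ^^ t) (rho n)" using orbit by (auto simp: Orb_def)
    then show "y \<in> (\<lambda>t. (fm ^^ t) (rho n)) ` {..<T}" using per[of t] n(3) by (auto simp: T_def)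
  qed
  then have finO: "finite Orb" by (rule finite_subset) auto
  define G where "G = (\<Union>t. W (n + t) i)"
  have step: "fm ` W (n + t) i \<subseteq> W (n + Suc t) i" for t
    using orbit_step(2)[of i "n + t"] tail_min_depth[OF n(1), of t] i by (simp add: i_def)
  have "trap G Orb"
    unfolding trap_def
  proof (intro conjI ballI)
    show "openin PT G" unfolding G_def using openin_disk by auto
    show "fm ` G \<subseteq> G" unfolding G_def using step by blast
    show "finite Orb" by (rule finO)
    show "Orb \<subseteq> split_pts" using anc_split by (auto simp: Orb_def)
    show "openin PT (berk_P1 absv - (G \<union> Orb))"
    proof (rule openin_compl_Union[OF finO, of "\<lambda>y. (\<Union>t\<in>{t. anc (n + t) i = y}. W (n + t) i) \<union> {y}"])
      show "Orb \<noteq> {}" by (auto simp: Orb_def)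
      show "(\<Union>y\<in>Orb. (\<Union>t\<in>{t. anc (n + t) i = y}. W (n + t) i) \<union> {y}) = G \<union> Orb"
        by (auto simp: G_def Orb_def)
      fix y assume "y \<in> Orb"
      then obtain u where u: "y = anc (n + u) i" by (auto simp: Orb_def)
      define r where "r = q powi (m (n + u) - int i)"
      have *: "anc (n + t) i = y \<longleftrightarrow> m (n + t) = m (n + u) \<and> absv (a (n + t) - a (n + u)) \<le> r" for t
        by (auto simp: u D_eq_iff r_def)
      have eq: "(\<Union>t\<in>{t. anc (n + t) i = y}. W (n + t) i)
          = (\<Union>b\<in>(\<lambda>t. a (n + t)) ` {t. anc (n + t) i = y}. disk b r)"
        unfolding image_image UN_simps by (intro SUP_cong refl) (auto simp: * r_def)
      show "openin PT (berk_P1 absv - ((\<Union>t\<in>{t. anc (n + t) i = y}. W (n + t) i) \<union> {y}))"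
      proof -
        have y: "y = pt (a (n + u)) r" by (simp add: u r_def)
        have r: "r \<in> VG" by (simp add: r_def)
        have "absv (b - a (n + u)) \<le> r" if "b \<in> (\<lambda>t. a (n + t)) ` {t. anc (n + t) i = y}" for b
          using that * by auto
        from openin_compl_directions[OF r this] show ?thesis unfolding eq unfolding y by blast
      qed
    qed
    fix b assume "b \<in> Orb"
    then obtain t where "b = (fm ^^ t) (rho n)" using orbit by (auto simp: Orb_def)
    then have "(fm ^^ k) b = anc (n + (k + t)) i" for k using orbit[of "k + t"] by (simp add: funpow_add)
    then have "range (\<lambda>k. (fm ^^ k) b) \<subseteq> Orb" by (auto simp: Orb_def)
    then show "finite (range (\<lambda>k. (fm ^^ k) b)) \<or> (\<exists>n. (fm ^^ n) b \<in> G)"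
      by (intro disjI1 finite_subset[OF _ finO])
  qed
  moreover have "x n \<in> G" using x_in_W[OF i, of n] UN_I[of 0 UNIV "x n" "\<lambda>t. W (n + t) i"] unfolding G_def by simp
  moreover have "D s \<mu> \<notin> G" if "s \<in> S" for s \<mu>
    using W_free[OF i _ that] tail_min_depth[OF n(1)] by (auto simp: G_def i_def)
  ultimately show ?thesis by blast
qed

text \<open>The disk \<open>W n' i\<close> at \<open>rho n'\<close> returns to a disk whose boundary point lies inside \<open>W n' i\<close> and
  which does not contain \<open>rho n'\<close>, hence it returns into itself.\<close>
lemma trap_contracting:
  assumes n: "n \<in> tail_min" "n' \<in> tail_min" "n < n'" and rho: "rho n = rho n'" and depth: "depth n < depth n'"
  shows "\<exists>G B. trap G B \<and> x n' \<in> G \<and> (\<forall>s\<in>S. \<forall>\<mu>. D s \<mu> \<notin> G)"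
proof -
  define i where "i = depth n'"
  define T where "T = n' - n"
  have i: "1 \<le> i" using depth by (simp add: i_def)
  \<comment> \<open>Since \<open>rho n' = rho n\<close>, the time \<open>T\<close> takes
    \<open>rho n'\<close> to the ancestor of \<open>x n'\<close> at the smaller height
    \<open>depth n\<close>.\<close>
  have "anc (n' + T) i = (fm ^^ T) (rho n')" using funpow_anc[OF n(2)] by (simp add: i_def)
  also have "\<dots> = anc n' (depth n)" using funpow_anc[OF n(1), of "depth n" T] n(3) by (simp add: rho[symmetric] T_def)
  finally have top: "anc (n' + T) i = anc n' (depth n)" .
  have U_T: "W (n' + T) i \<subseteq> W n' i"
  proof (rule disk_mono)
    have eq: "m (n' + T) - int i = m n' - int (depth n)"
      "absv (a (n' + T) - a n') \<le> q powi (m n' - int (depth n))" using top by (auto simp: D_eq_iff)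
    have "q powi (m n' - int (depth n)) < q powi (m n' - int i)" using depth by (simp add: i_def)
    then show "absv (a (n' + T) - a n') < q powi (m n' - int i)" using eq by linarith
    show "q powi (m (n' + T) - int i) \<le> q powi (m n' - int i)" using eq depth by (simp add: i_def)
  qed
  have "trap (\<Union>t<T. W (n' + t) i) ((\<lambda>t. anc (n' + t) i) ` {..<T})"
  proof (rule trap_of_chain)
    show "1 \<le> T" using n(3) by (simp add: T_def)
    show "openin PT (W (n' + t) i)" for t by (rule openin_disk)
    show "openin PT (berk_P1 absv - (W (n' + t) i \<union> {anc (n' + t) i}))" for t
      by (rule openin_compl_disk[OF q_VG])
    show "anc (n' + t) i \<in> split_pts" for t by (rule anc_split)
    have d: "i \<le> depth (n' + t)" for t using tail_min_depth[OF n(2)] by (simp add: i_def)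
    show "fm (anc (n' + t) i) = anc (n' + Suc t) i" for t using orbit_step(1)[OF d] by simp
    show "fm ` W (n' + t) i \<subseteq> W (n' + Suc t) i" for t using orbit_step(2)[OF d i] by simp
    show "W (n' + T) i \<subseteq> W (n' + 0) i" using U_T by simp
    show "anc (n' + T) i \<in> W (n' + 0) i" unfolding top using depth by (simp add: i_def pt_in_disk)
  qed
  moreover have "x n' \<in> (\<Union>t<T. W (n' + t) i)" using x_in_W[OF i, of n'] n(3) by (auto simp: T_def intro!: bexI[of _ 0])
  moreover have "D s \<mu> \<notin> (\<Union>t<T. W (n' + t) i)" if "s \<in> S" for s \<mu>
    using W_free[OF i _ that] tail_min_depth[OF n(2)] by (auto simp: i_def)
  ultimately show ?thesis by blast
qed

end

section \<open>Estimates near the ends of the hull\<close>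

context split_dynamics begin

lemma q_large: obtains n :: int where "\<And>k. k \<le> n \<Longrightarrow> B \<le> q powi k"
proof -
  obtain N where N: "B < (1/q) ^ N" using real_arch_pow[of "1/q" B] q_bounds by auto
  have "(1/q) ^ N = q powi (- int N)" by (simp add: power_int_minus power_divide divide_inverse power_inverse)
  then have "B \<le> q powi k" if "k \<le> - int N" for k using N q_le_iff[of "- int N" k] that by linarith
  then show thesis by (rule that)
qed

lemma q_small: assumes "0 < e" obtains n :: int where "\<And>k. n \<le> k \<Longrightarrow> q powi k \<le> e"
proof -
  obtain n where n: "\<And>k. k \<le> n \<Longrightarrow> 1 / e \<le> q powi k" using q_large by blast
  have "q powi k \<le> e" if "- n \<le> k" for k
  proof -
    have "1 / e \<le> q powi (- k)" using n that by simp
    then have "1 / e \<le> 1 / q powi k" by (simp add: power_int_minus divide_inverse)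
    then show ?thesis using assms q_pos[of k] by (simp add: field_simps)
  qed
  then show thesis by (rule that)
qed

end

context marked_dynamics begin

lemma uniform_bound:
  assumes "\<And>p. p \<in> S \<Longrightarrow> \<exists>h :: int. \<forall>M\<ge>h. R p M"
  obtains h :: int where "\<And>p M. p \<in> S \<Longrightarrow> h \<le> M \<Longrightarrow> R p M"
proof -
  obtain f :: "'k \<Rightarrow> int" where f: "\<And>p M. p \<in> S \<Longrightarrow> f p \<le> M \<Longrightarrow> R p M" using assms by metis
  have "R p M" if "p \<in> S" "Max (f ` S) \<le> M" for p M
    using f[OF that(1), of M] Max_ge[of "f ` S" "f p"] finite_S that by fastforce
  then show thesis by (rule that)
qed

lemma isolated_S: obtains h :: int where "\<And>p c. p \<in> S \<Longrightarrow> c \<in> S \<Longrightarrow> c = p \<or> q powi h \<le> absv (p - c)"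
proof -
  \<comment> \<open>The element \<open>1\<close> keeps \<open>E\<close> nonempty when
    \<open>S\<close> has a single point.\<close>
  define E where "E = insert 1 ((\<lambda>(p, c). absv (p - c)) ` (S \<times> S) - {0})"
  have E: "finite E" "E \<noteq> {}" using finite_S by (auto simp: E_def)
  have "0 < Min E" using E by (subst Min_gr_iff) (auto simp: E_def less_le)
  then obtain h where h: "\<And>k. h \<le> k \<Longrightarrow> q powi k \<le> Min E" using q_small by blast
  have "c = p \<or> q powi h \<le> absv (p - c)" if "p \<in> S" "c \<in> S" for p c
  proof (cases "c = p")
    case False
    then have "absv (p - c) \<in> E" using that by (auto simp: E_def)
    then show ?thesis using h[of h] E by (meson Min_le order_refl order_trans)
  qed simp
  then show thesis by (rule that)
qed

text \<open>Dividing the numerator by \<open>lin p\<close> leaves a cofactor whose norm is largest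
  at level \<open>h0\<close> among the levels considered; so the image radius is at most a constant
  times \<open>q powi M\<close>.\<close>

lemma small_disk_bound:
  assumes p: "p \<in> S" "poly Q p \<noteq> 0" and e: "0 < e"
  shows "\<exists>h. \<forall>M\<ge>h. \<exists>r\<in>VG. fm (D p M) = pt (ev p) r \<and> r \<le> e"
proof -
  obtain h0 where h0: "\<And>c. c \<in> S \<Longrightarrow> c = p \<or> q powi h0 \<le> absv (p - c)" using isolated_S p(1) by metis
  have "poly (P - smult (ev p) Q) p = 0" using p by (simp add: ev_def)
  then obtain g where g: "P - smult (ev p) Q = lin p * g" by (metis dvd_def poly_eq_0_iff_dvd)
  define K where "K = Z p (q powi h0) g / absv (poly Q p)"
  have K: "0 \<le> K" using A1_nonneg[OF zeta_A1] by (simp add: K_def)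
  have "0 < e / (K + 1)" using e K by simp
  then obtain h1 where h1: "\<And>k. h1 \<le> k \<Longrightarrow> q powi k \<le> e / (K + 1)" using q_small by blast
  have "\<exists>r\<in>VG. fm (D p M) = pt (ev p) r \<and> r \<le> e" if "max h0 h1 \<le> M" for M
  proof -
    have zQ: "q powi M \<le> absv (p - c)" if "poly Q c = 0" for c
    proof -
      have "c \<in> S" "c \<noteq> p" using zeros_S[of c] that p by auto
      then have "q powi h0 \<le> absv (p - c)" using h0 by auto
      moreover have "q powi M \<le> q powi h0" using \<open>max h0 h1 \<le> M\<close> by simp
      ultimately show ?thesis by linarith
    qed
    define r where "r = Z p (q powi M) (P - smult (ev p) Q) / absv (poly Q p)"
    have r: "r \<in> VG" "fm (D p M) = pt (ev p) r" using disk_map[OF q_VG zQ] by (auto simp: r_def)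
    have "Z p (q powi M) g \<le> Z p (q powi h0) g"
    proof (rule A1_mono[OF zeta_A1 zeta_A1])
      fix c
      have "q powi M \<le> q powi h0" using that by simp
      then show "Z p (q powi M) (lin c) \<le> Z p (q powi h0) (lin c)" unfolding zeta_lin[OF q_VG] by linarith
    qed simp_all
    moreover have "r = q powi M * (Z p (q powi M) g / absv (poly Q p))"
      using A1_mult[OF zeta_A1[OF q_VG]] zeta_lin_self[OF q_VG] by (simp add: r_def g)
    ultimately have "r \<le> q powi M * K" by (simp add: K_def divide_right_mono mult_left_mono)
    also have "\<dots> \<le> e / (K + 1) * K" using h1 that K by (intro mult_right_mono) auto
    also have "\<dots> \<le> e" using K e by (simp add: field_simps)
    finally show ?thesis using r by blast
  qed
  then show ?thesis by blast
qed

lemma small_disk_pole: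
  assumes s: "s \<in> S" "poly Q s = 0"
  shows "\<exists>h. \<forall>M\<ge>h. \<exists>R\<in>VG. fm (D s M) = pt 0 R \<and> fm ` disk s (q powi M) \<subseteq> disk_inf 0 R \<and> B < R"
proof -
  obtain h0 where h0: "\<And>c. c \<in> S \<Longrightarrow> c = s \<or> q powi h0 \<le> absv (s - c)" using isolated_S s(1) by metis
  have iso: "c = s \<or> q powi h0 \<le> absv (s - c)" if "poly (P * Q) c = 0" for c
    using h0[of c] zeros_S[of c] that by auto
  obtain C n where C: "0 < C" "1 \<le> n"
    "\<And>r. r \<in> VG \<Longrightarrow> r \<le> q powi h0 \<Longrightarrow> C / r ^ n \<in> VG \<and> fm (pt s r) = pt 0 (C / r ^ n) \<and> fm ` disk s r \<subseteq> disk_inf 0 (C / r ^ n)"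
    using pole_map[OF s(2) iso] by metis
  have "0 < C / (\<bar>B\<bar> + 1)" using C by simp
  then obtain h1 where h1: "\<And>k. h1 \<le> k \<Longrightarrow> q powi k \<le> C / (\<bar>B\<bar> + 1)" using q_small by blast
  have "\<exists>R\<in>VG. fm (D s M) = pt 0 R \<and> fm ` disk s (q powi M) \<subseteq> disk_inf 0 R \<and> B < R" if M: "max (max h0 h1) 0 \<le> M" for M
  proof -
    have "q powi M \<le> 1" using q_le_iff[of M 0] M by simp
    then have "(q powi M) ^ n \<le> q powi M" using C(2) power_decreasing[of 1 n "q powi M"] by simp
    also have "\<dots> \<le> C / (\<bar>B\<bar> + 1)" using h1 M by simp
    finally have "(q powi M) ^ n \<le> C / (\<bar>B\<bar> + 1)" .
    then have "\<bar>B\<bar> + 1 \<le> C / (q powi M) ^ n" by (simp add: field_simps)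
    then have "B < C / (q powi M) ^ n" by linarith
    then show ?thesis using C(3)[OF q_VG, of M] M by auto
  qed
  then show ?thesis by blast
qed

text \<open>Levels below \<open>lo\<close> describe neighbourhoods of infinity, levels above \<open>hi\<close> small
  neighbourhoods of the points of \<open>S\<close>.\<close>
definition end_bounds :: "int \<Rightarrow> int \<Rightarrow> bool" where
  "end_bounds lo hi \<longleftrightarrow> lo \<le> hi \<and> (\<forall>s\<in>S. absv s \<le> q powi lo) \<and>
     (\<forall>p\<in>S. \<forall>M\<ge>hi. poly Q p \<noteq> 0 \<longrightarrow> (\<exists>r\<in>VG. fm (D p M) = pt (ev p) r \<and> r \<le> q powi lo)) \<and>
     (\<forall>s\<in>S. \<forall>M\<ge>hi. poly Q s = 0 \<longrightarrow>
        (\<exists>R\<in>VG. fm (D s M) = pt 0 R \<and> fm ` disk s (q powi M) \<subseteq> disk_inf 0 R \<and> q powi lo < R)) \<and>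
     (\<forall>M<lo. (\<exists>R\<in>VG. fm (D 0 M) = pt 0 R \<and> fm ` disk_inf 0 (q powi M) \<subseteq> disk_inf 0 R \<and> q powi hi \<le> R) \<or>
        (\<exists>b. \<exists>r\<in>VG. fm (D 0 M) = pt b r \<and> fm ` disk_inf 0 (q powi M) \<subseteq> disk b r \<and> r \<le> q powi lo))"

text \<open>\<open>hi\<close> occurs only in a lower bound for \<open>R\<close>, which every large
  \<open>hi\<close> satisfies. So \<open>lo\<close> can be fixed first, and \<open>hi\<close> be
  enlarged later depending on \<open>lo\<close>.\<close>

lemma infinity_bounds:
  obtains lo hi0 where "lo \<le> l0" "\<And>s. s \<in> S \<Longrightarrow> absv s \<le> q powi lo"
    "\<And>M hi. M < lo \<Longrightarrow> hi0 \<le> hi \<Longrightarrow>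
      (\<exists>R\<in>VG. fm (D 0 M) = pt 0 R \<and> fm ` disk_inf 0 (q powi M) \<subseteq> disk_inf 0 R \<and> q powi hi \<le> R) \<or>
      (\<exists>b. \<exists>r\<in>VG. fm (D 0 M) = pt b r \<and> fm ` disk_inf 0 (q powi M) \<subseteq> disk b r \<and> r \<le> q powi lo)"
proof -
  obtain n1 where n1: "\<And>k. k \<le> n1 \<Longrightarrow> Max (absv ` S) \<le> q powi k" using q_large by blast
  have S_le: "absv s \<le> q powi k" if "s \<in> S" "k \<le> n1" for s k
    using that(1) finite_S by (intro order_trans[OF Max_ge n1[OF that(2)]]) auto
  show thesis
  proof (cases "degree Q < degree P")
    case True
    have zeros: "absv c \<le> q powi n1" if "poly (P * Q) c = 0" for c
      using S_le[of c n1] zeros_S[of c] that by auto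
    obtain C n where C: "0 < C" "1 \<le> n"
      "\<And>R. R \<in> VG \<Longrightarrow> q powi n1 \<le> R \<Longrightarrow> C * R ^ n \<in> VG \<and> fm (pt 0 R) = pt 0 (C * R ^ n) \<and> fm ` disk_inf 0 R \<subseteq> disk_inf 0 (C * R ^ n)"
      using infinity_map_pole[OF True zeros] by metis
    \<comment> \<open>The cap at \<open>0\<close> gives \<open>1 \<le> q powi M\<close>, so that its
      powers do not fall below it.\<close>
    define lo where "lo = min (min n1 l0) 0"
    obtain hi0 where hi0: "\<And>k. hi0 \<le> k \<Longrightarrow> q powi k \<le> C * q powi lo" using q_small[of "C * q powi lo"] C by auto
    show thesis
    proof (rule that[of lo hi0])
      fix M hi assume M: "M < lo" "hi0 \<le> hi"
      have "1 \<le> q powi M" using M q_le_iff[of 0 M] by (simp add: lo_def)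
      then have "q powi M \<le> (q powi M) ^ n" using C(2) power_increasing[of 1 n "q powi M"] by simp
      moreover have "q powi lo \<le> q powi M" using M by simp
      ultimately have "q powi lo \<le> (q powi M) ^ n" by linarith
      then have "C * q powi lo \<le> C * (q powi M) ^ n" using C by simp
      then have "q powi hi \<le> C * (q powi M) ^ n" using hi0[OF M(2)] by linarith
      moreover have "q powi n1 \<le> q powi M" using M by (simp add: lo_def)
      ultimately show "(\<exists>R\<in>VG. fm (D 0 M) = pt 0 R \<and> fm ` disk_inf 0 (q powi M) \<subseteq> disk_inf 0 R \<and> q powi hi \<le> R) \<or>
        (\<exists>b. \<exists>r\<in>VG. fm (D 0 M) = pt b r \<and> fm ` disk_inf 0 (q powi M) \<subseteq> disk b r \<and> r \<le> q powi lo)"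
        using C(3)[OF q_VG, of M] by blast
    qed (auto simp: lo_def S_le)
  next
    case False
    then have dg: "degree P \<le> degree Q" by simp
    define b where "b = (if degree P = degree Q then lead_coeff P / lead_coeff Q else 0)"
    define E where "E = {c. poly ((P - smult b Q) * Q) c = 0}"
    have "(P - smult b Q) * Q \<noteq> 0" using nonconst[of b] Q_nz by simp
    then have E: "finite E" unfolding E_def by (rule poly_roots_finite)
    obtain n2 where n2: "\<And>k. k \<le> n2 \<Longrightarrow> Max (insert 0 (absv ` E)) \<le> q powi k" using q_large by blast
    have zeros: "absv c \<le> q powi n2" if "poly ((P - smult b Q) * Q) c = 0" for c
      by (rule order_trans[OF Max_ge n2[OF order_refl]]) (use E that in \<open>auto simp: E_def\<close>)
    obtain C n where C: "0 < C" "1 \<le> n"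
      "\<And>R. R \<in> VG \<Longrightarrow> q powi n2 \<le> R \<Longrightarrow> C / R ^ n \<in> VG \<and> fm (pt 0 R) = pt b (C / R ^ n) \<and> fm ` disk_inf 0 R \<subseteq> disk b (C / R ^ n)"
      using infinity_map_finite[OF dg zeros[unfolded b_def]] unfolding b_def[symmetric] by metis
    obtain n3 where n3: "\<And>k. k \<le> n3 \<Longrightarrow> C \<le> q powi k" using q_large by blast
    define lo where "lo = min (min n1 l0) (min (min n2 n3) 0)"
    show thesis
    proof (rule that[of lo 0])
      fix M hi :: int assume M: "M < lo"
      have "1 \<le> q powi M" using M q_le_iff[of 0 M] by (simp add: lo_def)
      then have "1 \<le> (q powi M) ^ n" by simp
      then have "C / (q powi M) ^ n \<le> C" using C(1) by (simp add: field_simps)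
      also have "C \<le> q powi lo" by (rule n3) (simp add: lo_def)
      finally have "C / (q powi M) ^ n \<le> q powi lo" .
      moreover have "q powi n2 \<le> q powi M" using M by (simp add: lo_def)
      ultimately show "(\<exists>R\<in>VG. fm (D 0 M) = pt 0 R \<and> fm ` disk_inf 0 (q powi M) \<subseteq> disk_inf 0 R \<and> q powi hi \<le> R) \<or>
        (\<exists>b. \<exists>r\<in>VG. fm (D 0 M) = pt b r \<and> fm ` disk_inf 0 (q powi M) \<subseteq> disk b r \<and> r \<le> q powi lo)"
        using C(3)[OF q_VG, of M] by blast
    qed (auto simp: lo_def S_le)
  qed
qed

lemma end_bounds_exist: obtains lo hi where "lo \<le> l0" "u0 \<le> hi" "end_bounds lo hi"
proof -
  obtain lo hi0 where lo: "lo \<le> l0" "\<And>s. s \<in> S \<Longrightarrow> absv s \<le> q powi lo"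
    "\<And>M hi. M < lo \<Longrightarrow> hi0 \<le> hi \<Longrightarrow>
      (\<exists>R\<in>VG. fm (D 0 M) = pt 0 R \<and> fm ` disk_inf 0 (q powi M) \<subseteq> disk_inf 0 R \<and> q powi hi \<le> R) \<or>
      (\<exists>b. \<exists>r\<in>VG. fm (D 0 M) = pt b r \<and> fm ` disk_inf 0 (q powi M) \<subseteq> disk b r \<and> r \<le> q powi lo)"
    using infinity_bounds[of l0] by blast
  have "\<exists>h. \<forall>M\<ge>h. poly Q p \<noteq> 0 \<longrightarrow> (\<exists>r\<in>VG. fm (D p M) = pt (ev p) r \<and> r \<le> q powi lo)" if "p \<in> S" for p
    using small_disk_bound[OF that _ q_pos, of lo] by (cases "poly Q p = 0") auto
  then obtain h1 where h1: "\<And>p M. p \<in> S \<Longrightarrow> h1 \<le> M \<Longrightarrow> poly Q p \<noteq> 0 \<longrightarrow> (\<exists>r\<in>VG. fm (D p M) = pt (ev p) r \<and> r \<le> q powi lo)"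
    using uniform_bound[where R = "\<lambda>p M. poly Q p \<noteq> 0 \<longrightarrow> (\<exists>r\<in>VG. fm (D p M) = pt (ev p) r \<and> r \<le> q powi lo)"] by blast
  have "\<exists>h. \<forall>M\<ge>h. poly Q s = 0 \<longrightarrow> (\<exists>R\<in>VG. fm (D s M) = pt 0 R \<and> fm ` disk s (q powi M) \<subseteq> disk_inf 0 R \<and> q powi lo < R)" if "s \<in> S" for s
    using small_disk_pole[OF that, of "q powi lo"] by (cases "poly Q s = 0") auto
  then obtain h2 where h2: "\<And>s M. s \<in> S \<Longrightarrow> h2 \<le> M \<Longrightarrow> poly Q s = 0 \<longrightarrow> (\<exists>R\<in>VG. fm (D s M) = pt 0 R \<and> fm ` disk s (q powi M) \<subseteq> disk_inf 0 R \<and> q powi lo < R)"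
    using uniform_bound[where R = "\<lambda>s M. poly Q s = 0 \<longrightarrow> (\<exists>R\<in>VG. fm (D s M) = pt 0 R \<and> fm ` disk s (q powi M) \<subseteq> disk_inf 0 R \<and> q powi lo < R)"] by blast
  define hi where "hi = max (max hi0 u0) (max lo (max h1 h2))"
  have "end_bounds lo hi" unfolding end_bounds_def
  proof (intro conjI ballI allI impI)
    show "lo \<le> hi" by (simp add: hi_def)
    show "absv s \<le> q powi lo" if "s \<in> S" for s using lo(2) that .
    show "\<exists>r\<in>VG. fm (D p M) = pt (ev p) r \<and> r \<le> q powi lo" if "p \<in> S" "hi \<le> M" "poly Q p \<noteq> 0" for p M
      using h1[of p M] that by (simp add: hi_def)
    show "\<exists>R\<in>VG. fm (D s M) = pt 0 R \<and> fm ` disk s (q powi M) \<subseteq> disk_inf 0 R \<and> q powi lo < R" if "s \<in> S" "hi \<le> M" "poly Q s = 0" for s M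
      using h2[of s M] that by (simp add: hi_def)
    show "(\<exists>R\<in>VG. fm (D 0 M) = pt 0 R \<and> fm ` disk_inf 0 (q powi M) \<subseteq> disk_inf 0 R \<and> q powi hi \<le> R) \<or>
      (\<exists>b. \<exists>r\<in>VG. fm (D 0 M) = pt b r \<and> fm ` disk_inf 0 (q powi M) \<subseteq> disk b r \<and> r \<le> q powi lo)" if "M < lo" for M
      by (rule lo(3)[OF that]) (simp add: hi_def)
  qed
  moreover have "u0 \<le> hi" by (simp add: hi_def)
  ultimately show thesis using that[OF lo(1)] by blast
qed

end

section \<open>Orbits running into an end\<close>

context split_orbit begin

definition level :: "nat \<Rightarrow> int" where "level n = m n - int (depth n)"

text \<open>The bound is at \<open>level n - 1\<close>, not \<open>level n\<close>: marked points
  need not lie in \<open>L\<close>, so \<open>rho n\<close> can miss the path from \<open>s\<close>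
  to infinity by less than one level.\<close>

lemma rho_near: "\<exists>s\<in>S. absv (a n - s) < q powi (level n - 1)"
proof -
  have "\<not> free (a n) (m n - int (Suc (depth n)))" using free_iff_depth[of "Suc (depth n)" n] by simp
  moreover have "m n - int (Suc (depth n)) = level n - 1" by (simp add: level_def)
  ultimately have "\<not> free (a n) (level n - 1)" by metis
  then show ?thesis by (auto simp: free_def not_le)
qed

text \<open>Two projections of equal level near the same marked point have centres in
  \<open>L\<close> closer than one level, hence coincide. So a marked point and a level determine
  \<open>n\<close>.\<close>

lemma finite_window:
  assumes "inj_on rho tail_min"
  shows "finite {n \<in> tail_min. lo \<le> level n \<and> level n \<le> hi}"
proof -
  obtain s where s: "\<And>n. s n \<in> S" "\<And>n. absv (a n - s n) < q powi (level n - 1)" using rho_near by metis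
  have "inj_on (\<lambda>n. (s n, level n)) tail_min"
  proof (rule inj_onI)
    fix n n' assume n: "n \<in> tail_min" "n' \<in> tail_min" "(s n, level n) = (s n', level n')"
    then have eq: "s n' = s n" "level n' = level n" by auto
    have "absv (a n - a n') < q powi (level n - 1)"
      using abs_diff_triangle[of "a n" "a n'" "s n"] s(2)[of n] s(2)[of n'] by (simp add: eq abs_minus_commute[of "s n"])
    then have "absv (a n - a n') \<le> q powi level n" using discrete[OF L_diff[OF a_L a_L], of n n' "level n - 1"] by simp
    then have "rho n = rho n'" using eq by (simp add: D_eq_iff level_def)
    then show "n = n'" using assms n by (auto dest: inj_onD)
  qed
  then have "inj_on (\<lambda>n. (s n, level n)) {n \<in> tail_min. lo \<le> level n \<and> level n \<le> hi}" by (rule inj_on_subset) auto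
  moreover have "(\<lambda>n. (s n, level n)) ` {n \<in> tail_min. lo \<le> level n \<and> level n \<le> hi} \<subseteq> S \<times> {lo..hi}" using s by auto
  ultimately show ?thesis using finite_S by (meson finite_SigmaI finite_atLeastAtMost_int inj_on_finite)
qed

text \<open>The open disk \<open>U\<close> is a direction at the point \<open>anc (n + t) (depth n)\<close> of the orbit of
  \<open>rho n\<close>; affine disks bounded by a point close to infinity do not contain \<open>0\<close>.\<close>
definition direction :: "int \<Rightarrow> nat \<Rightarrow> nat \<Rightarrow> ('k poly \<Rightarrow> real) option set \<Rightarrow> bool" where
  "direction lo n t U \<longleftrightarrow>
     (\<exists>c. U = disk c (q powi (m (n + t) - int (depth n))) \<and> anc (n + t) (depth n) = D c (m (n + t) - int (depth n)) \<and>
        (m (n + t) - int (depth n) < lo \<longrightarrow> q powi (m (n + t) - int (depth n)) \<le> absv c)) \<or>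
     (U = disk_inf 0 (q powi (m (n + t) - int (depth n))) \<and> anc (n + t) (depth n) = D 0 (m (n + t) - int (depth n)) \<and>
        m (n + t) - int (depth n) < lo)"

section \<open>Following a direction while the tail minima stay outside a window of levels\<close>

context
  fixes lo hi n
  assumes bounds: "end_bounds lo hi" and n: "n \<in> tail_min"
    and window: "\<And>k. k \<in> tail_min \<Longrightarrow> n \<le> k \<Longrightarrow> hi < level k \<or> level k < lo"
begin

abbreviation "Mt t \<equiv> m (n + t) - int (depth n)"

lemma S_small: "s \<in> S \<Longrightarrow> absv s \<le> q powi lo"
  using bounds by (auto simp: end_bounds_def)

text \<open>Proximity to a marked point means that the depth at time \<open>n + t\<close> is down to
  \<open>depth n\<close>. Then \<open>n + t\<close> is again a tail minimum, and the window
  hypothesis applies to it.\<close>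

lemma near_S_level:
  assumes "anc (n + t) (depth n) = D c (Mt t)" "s \<in> S" "absv (c - s) < q powi (Mt t - 1)"
  shows "hi < Mt t \<or> Mt t < lo"
proof -
  have "absv (a (n + t) - c) \<le> q powi Mt t" using assms(1) by (simp add: D_eq_iff)
  moreover have "q powi Mt t < q powi (Mt t - 1)" by simp
  ultimately have "absv (a (n + t) - s) < q powi (Mt t - 1)"
    using abs_diff_triangle[of "a (n + t)" s c] assms(3) by linarith
  then have "\<not> free (a (n + t)) (m (n + t) - int (Suc (depth n)))" using assms(2) by (auto simp: free_def not_le algebra_simps)
  then have "\<not> Suc (depth n) \<le> depth (n + t)" using free_iff_depth[of "Suc (depth n)" "n + t"] by simp
  then have eq: "depth (n + t) = depth n" using tail_min_depth[OF n, of t] by simp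
  then have "n + t \<in> tail_min" using n by (auto simp: tail_min_def)
  then show ?thesis using window[of "n + t"] eq by (simp add: level_def)
qed

text \<open>At a level below \<open>lo\<close> all points of the disk have the absolute value of
  \<open>c\<close>, which exceeds that of every marked point. The window then leaves only levels
  above \<open>hi\<close>.\<close>

lemma affine_contains_S:
  assumes "anc (n + t) (depth n) = D c (Mt t)" "Mt t < lo \<longrightarrow> q powi Mt t \<le> absv c"
    and s: "s \<in> S" "absv (c - s) < q powi Mt t"
  shows "hi < Mt t"
proof (rule ccontr)
  assume "\<not> hi < Mt t"
  have "q powi Mt t < q powi (Mt t - 1)" by simp
  then have "absv (c - s) < q powi (Mt t - 1)" using s by linarith
  then have lt: "Mt t < lo" using near_S_level[OF assms(1) s(1)] \<open>\<not> hi < Mt t\<close> by blast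
  then have "absv (c - s) < absv c" using assms(2) s(2) by linarith
  then have "absv s = absv c" using abs_diff_eq_left[of "c - s" c] by simp
  moreover have "q powi lo < q powi Mt t" using lt by simp
  ultimately show False using S_small[OF s(1)] assms(2) lt by linarith
qed

lemma anc_orbit: "fm (anc (n + t) (depth n)) = anc (n + Suc t) (depth n)"
  using orbit_step(1)[OF tail_min_depth[OF n, of t]] by simp

lemma pt_eq_anc:
  assumes "anc (n + t) (depth n) = pt b r" "r \<in> VG"
  shows "r = q powi Mt t" "anc (n + t) (depth n) = D b (Mt t)"
proof -
  show "r = q powi Mt t" using assms zeta_eq_iff[OF q_VG assms(2)] by auto
  then show "anc (n + t) (depth n) = D b (Mt t)" using assms by simp
qed

text \<open>A direction containing a pole or infinity has its level outside the window, where
  \<open>end_bounds\<close> gives the image explicitly. Otherwise the image is an affine disk, and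
  it remains to see that it omits \<open>0\<close> when it is close to infinity.\<close>

lemma direction_step:
  assumes "direction lo n t U"
  shows "\<exists>U'. direction lo n (Suc t) U' \<and> fm ` U \<subseteq> U'"
  using assms[unfolded direction_def]
proof (elim disjE exE conjE)
  fix c assume U: "U = disk c (q powi Mt t)" and top: "anc (n + t) (depth n) = D c (Mt t)"
    and far: "Mt t < lo \<longrightarrow> q powi Mt t \<le> absv c"
  show ?thesis
  proof (cases "\<exists>s. poly Q s = 0 \<and> absv (c - s) < q powi Mt t")
    case True
    then obtain s where s: "poly Q s = 0" "absv (c - s) < q powi Mt t" by auto
    have sS: "s \<in> S" using zeros_S[of s] s by simp
    have "hi < Mt t" using affine_contains_S[OF top far sS s(2)] .
    then obtain R where R: "R \<in> VG" "fm (D s (Mt t)) = pt 0 R" "fm ` disk s (q powi Mt t) \<subseteq> disk_inf 0 R" "q powi lo < R"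
      using bounds sS s(1) unfolding end_bounds_def by (metis less_imp_le)
    have Vs: "disk c (q powi Mt t) \<subseteq> disk s (q powi Mt t)" using s(2) by (intro disk_mono) auto
    have "D c (Mt t) = D s (Mt t)" using s(2) by (simp add: D_eq_iff)
    then have "anc (n + Suc t) (depth n) = pt 0 R" using R(2) anc_orbit[of t] top by simp
    note nxt = pt_eq_anc[OF this R(1)]
    have "direction lo n (Suc t) (disk_inf 0 R)"
      unfolding direction_def using nxt R(4) by auto
    then show ?thesis using R(3) Vs U by blast
  next
    case False
    then have zQ: "q powi Mt t \<le> absv (c - s)" if "poly Q s = 0" for s using that by force
    define r where "r = Z c (q powi Mt t) (P - smult (ev c) Q) / absv (poly Q c)"
    have r: "r \<in> VG" "fm (D c (Mt t)) = pt (ev c) r" "fm ` disk c (q powi Mt t) \<subseteq> disk (ev c) r"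
      using disk_map[OF q_VG zQ] by (auto simp: r_def)
    have "anc (n + Suc t) (depth n) = pt (ev c) r" using anc_orbit[of t] r(2) top by simp
    note nxt = pt_eq_anc[OF this r(1)]
    \<comment> \<open>A disk containing a zero of \<open>f\<close> would be small about it, with
      image radius at most \<open>q powi lo\<close>; otherwise \<open>f\<close> has constant
      absolute value on the disk.\<close>
    have "r \<le> absv (ev c)" if lt: "Mt (Suc t) < lo"
    proof (cases "\<exists>p. poly P p = 0 \<and> absv (c - p) < q powi Mt t")
      case True
      then obtain p where p: "poly P p = 0" "absv (c - p) < q powi Mt t" by auto
      have pS: "p \<in> S" using zeros_S[of p] p by simp
      have "hi < Mt t" using affine_contains_S[OF top far pS p(2)] .
      moreover have "poly Q p \<noteq> 0" using p no_common_zero[of p] by auto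
      ultimately obtain r' where r': "r' \<in> VG" "fm (D p (Mt t)) = pt (ev p) r'" "r' \<le> q powi lo"
        using bounds pS unfolding end_bounds_def by (metis less_imp_le)
      have "D c (Mt t) = D p (Mt t)" using p(2) by (simp add: D_eq_iff)
      then have "r' = r" using r(1,2) r'(1,2) zeta_eq_iff[OF r'(1) r(1)] by auto
      then have "q powi Mt (Suc t) \<le> q powi lo" using r'(3) nxt(1) by simp
      then show ?thesis using lt by simp
    next
      case False
      then have zP: "q powi Mt t \<le> absv (c - s)" if "poly P s = 0" for s using that by force
      have ZP: "Z c (q powi Mt t) P = absv (poly P c)"
        using zP by (intro A1_eq_eval zeta_A1) (auto simp: zeta_lin)
      have ZQ: "Z c (q powi Mt t) Q = absv (poly Q c)"
        using zQ by (intro A1_eq_eval zeta_A1) (auto simp: zeta_lin)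
      have "push (Z c (q powi Mt t)) (lin 0) = absv (ev c)"
        unfolding push_lin using ZP ZQ by (simp add: ev_def abs_divide)
      moreover have "poly Q c \<noteq> 0" using zQ[of c] q_pos[of "Mt t"] by (auto simp del: q_pos)
      then have "push (Z c (q powi Mt t)) = Z (ev c) r" using r(2) fm_Some[of "Z c (q powi Mt t)"] ZQ by simp
      ultimately show ?thesis using zeta_lin[OF r(1), of "ev c" 0] by simp
    qed
    then have "direction lo n (Suc t) (disk (ev c) r)"
      unfolding direction_def using nxt by auto
    then show ?thesis using r(3) U by blast
  qed
next
  assume U: "U = disk_inf 0 (q powi Mt t)" and top: "anc (n + t) (depth n) = D 0 (Mt t)" and lt: "Mt t < lo"
  from bounds lt consider
    (inf) R where "R \<in> VG" "fm (D 0 (Mt t)) = pt 0 R" "fm ` disk_inf 0 (q powi Mt t) \<subseteq> disk_inf 0 R" "q powi hi \<le> R"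
  | (fin) b r where "r \<in> VG" "fm (D 0 (Mt t)) = pt b r" "fm ` disk_inf 0 (q powi Mt t) \<subseteq> disk b r" "r \<le> q powi lo"
    unfolding end_bounds_def by metis
  then show ?thesis
  proof cases
    case inf
    have "anc (n + Suc t) (depth n) = pt 0 R" using inf(2) anc_orbit[of t] top by simp
    note nxt = pt_eq_anc[OF this inf(1)]
    \<comment> \<open>The centre \<open>0\<close> is marked, so the image level is outside the
      window; a radius of at least \<open>q powi hi\<close> rules out levels above
      \<open>hi\<close>.\<close>
    have "hi < Mt (Suc t) \<or> Mt (Suc t) < lo" using near_S_level[OF nxt(2) zero_S] by simp
    then have "Mt (Suc t) < lo" using inf(4) by (auto simp: nxt(1))
    then have "direction lo n (Suc t) (disk_inf 0 R)" unfolding direction_def using nxt by auto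
    then show ?thesis using inf(3) U by blast
  next
    case fin
    have "anc (n + Suc t) (depth n) = pt b r" using fin(2) anc_orbit[of t] top by simp
    note nxt = pt_eq_anc[OF this fin(1)]
    have "\<not> Mt (Suc t) < lo" using fin(4) by (simp add: nxt(1))
    then have "direction lo n (Suc t) (disk b r)" unfolding direction_def using nxt by auto
    then show ?thesis using fin(3) U by blast
  qed
qed

lemma direction_avoids:
  assumes "direction lo n t U" "s \<in> S" "lo \<le> \<mu>" "\<mu> \<le> hi"
  shows "D s \<mu> \<notin> U"
  using assms(1)[unfolded direction_def]
proof (elim disjE exE conjE)
  fix c assume U: "U = disk c (q powi Mt t)" and top: "anc (n + t) (depth n) = D c (Mt t)"
    and far: "Mt t < lo \<longrightarrow> q powi Mt t \<le> absv c"
  show "D s \<mu> \<notin> U"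
  proof
    assume "D s \<mu> \<in> U"
    then have lt: "Mt t < \<mu>" "absv (c - s) < q powi Mt t" by (auto simp: U pt_in_disk abs_minus_commute[of c])
    then have "hi < Mt t" using affine_contains_S[OF top far assms(2)] by blast
    then show False using lt(1) assms(4) by simp
  qed
next
  assume U: "U = disk_inf 0 (q powi Mt t)" and lt: "Mt t < lo"
  have "q powi \<mu> \<le> q powi Mt t" "q powi lo \<le> q powi Mt t" using lt assms(3) by auto
  moreover have "absv (s - 0) \<le> q powi lo" using S_small[OF assms(2)] by simp
  ultimately have "max (q powi \<mu>) (absv (s - 0)) \<le> q powi Mt t" by linarith
  then show "D s \<mu> \<notin> U" unfolding U pt_in_disk_inf[OF q_VG] by linarith
qed

text \<open>The directions are chosen successively without control of the choice, so
  \<open>ret\<close> speaks about every possible direction at the return time.\<close>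

lemma trap_of_direction:
  assumes n': "n < n'"
    and U0: "direction lo n 0 U0"
    and ret: "anc n' (depth n) \<in> U0" "\<And>U. direction lo n (n' - n) U \<Longrightarrow> U \<subseteq> U0"
    and x: "x n' \<in> U0"
  shows "\<exists>G B. trap G B \<and> x n' \<in> G \<and> (\<forall>s\<in>S. \<forall>\<mu>. lo \<le> \<mu> \<longrightarrow> \<mu> \<le> hi \<longrightarrow> D s \<mu> \<notin> G)"
proof -
  define T where "T = n' - n"
  have "\<exists>U. \<forall>t. (direction lo n t (U t) \<and> (t = 0 \<longrightarrow> U t = U0)) \<and> fm ` U t \<subseteq> U (Suc t)"
  proof (rule dependent_nat_choice)
    show "\<exists>U. direction lo n 0 U \<and> (0 = 0 \<longrightarrow> U = U0)" using U0 by blast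
    show "\<exists>U'. (direction lo n (Suc t) U' \<and> (Suc t = 0 \<longrightarrow> U' = U0)) \<and> fm ` U \<subseteq> U'"
      if "direction lo n t U \<and> (t = 0 \<longrightarrow> U = U0)" for U t
      using direction_step[of t U] that by auto
  qed
  then obtain U where U: "\<And>t. direction lo n t (U t)" "U 0 = U0" "\<And>t. fm ` U t \<subseteq> U (Suc t)" by metis
  have disk: "openin PT (U t) \<and> openin PT (berk_P1 absv - (U t \<union> {anc (n + t) (depth n)}))" for t
    using U(1)[of t, unfolded direction_def]
  proof (elim disjE exE conjE)
    fix c assume "U t = disk c (q powi Mt t)" "anc (n + t) (depth n) = D c (Mt t)"
    then show ?thesis using openin_disk openin_compl_disk[OF q_VG] by simp
  next
    assume "U t = disk_inf 0 (q powi Mt t)" "anc (n + t) (depth n) = D 0 (Mt t)"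
    then show ?thesis using openin_disk_inf openin_compl_disk_inf[OF q_VG] by simp
  qed
  have "trap (\<Union>t<T. U t) ((\<lambda>t. anc (n + t) (depth n)) ` {..<T})"
  proof (rule trap_of_chain)
    show "1 \<le> T" using n' by (simp add: T_def)
    show "openin PT (U t)" "openin PT (berk_P1 absv - (U t \<union> {anc (n + t) (depth n)}))" for t
      using disk[of t] by blast+
    show "anc (n + t) (depth n) \<in> split_pts" for t by (rule anc_split)
    show "fm (anc (n + t) (depth n)) = anc (n + Suc t) (depth n)" for t by (rule anc_orbit)
    show "fm ` U t \<subseteq> U (Suc t)" for t by (rule U(3))
    show "U T \<subseteq> U 0" using ret(2) U(1)[of T] by (simp add: U(2) T_def)
    show "anc (n + T) (depth n) \<in> U 0" using ret(1) n' by (simp add: U(2) T_def)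
  qed
  moreover have "x n' \<in> (\<Union>t<T. U t)" using x n' by (auto simp: T_def U(2) intro!: bexI[of _ 0])
  moreover have "D s \<mu> \<notin> (\<Union>t<T. U t)" if "s \<in> S" "lo \<le> \<mu>" "\<mu> \<le> hi" for s \<mu>
    using direction_avoids[OF U(1) that] by blast
  ultimately show ?thesis by blast
qed

end

lemma trap_end:
  assumes inj: "inj_on rho tail_min"
  shows "\<exists>G B n. trap G B \<and> x n \<in> G \<and> (\<forall>s\<in>S. \<forall>\<mu>. l0 \<le> \<mu> \<longrightarrow> \<mu> \<le> u0 \<longrightarrow> D s \<mu> \<notin> G)"
proof -
  obtain lo hi where bd: "lo \<le> l0" "u0 \<le> hi" "end_bounds lo hi" using end_bounds_exist by metis
  have S_small: "absv s \<le> q powi lo" if "s \<in> S" for s using bd(3) that by (auto simp: end_bounds_def)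
  have "lo \<le> hi" using bd(3) by (auto simp: end_bounds_def)
  have fin: "finite {n \<in> tail_min. lo \<le> level n \<and> level n \<le> hi}" by (rule finite_window[OF inj])
  have inf_tail: "infinite tail_min" using tail_min_unbounded by (metis infinite_nat_iff_unbounded_le)
  obtain N where N: "\<And>k. k \<in> tail_min \<Longrightarrow> N \<le> k \<Longrightarrow> hi < level k \<or> level k < lo"
  proof -
    obtain N where N: "\<And>k. k \<in> {n \<in> tail_min. lo \<le> level n \<and> level n \<le> hi} \<Longrightarrow> k < N"
      using fin by (meson finite_nat_set_iff_bounded)
    show thesis
    proof (rule that[of N])
      fix k assume k: "k \<in> tail_min" "N \<le> k"
      then have "\<not> (lo \<le> level k \<and> level k \<le> hi)" using N[of k] by auto
      then show "hi < level k \<or> level k < lo" by linarith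
    qed
  qed
  have key: ?thesis if "\<exists>G B. trap G B \<and> x n' \<in> G \<and> (\<forall>s\<in>S. \<forall>\<mu>. lo \<le> \<mu> \<longrightarrow> \<mu> \<le> hi \<longrightarrow> D s \<mu> \<notin> G)" for n'
    using that bd(1,2) by (meson order_trans)
  have tail_split: "tail_min \<subseteq> {n \<in> tail_min. lo \<le> level n \<and> level n \<le> hi} \<union> {n \<in> tail_min. hi < level n} \<union> {n \<in> tail_min. level n < lo}" by auto
  \<comment> \<open>As \<open>rho\<close> is injective on tail minima, an infinite set of them has
    only finitely many members in a bounded window of levels.\<close>
  have infinite_above: "\<exists>k\<in>B. k > j \<and> level k \<notin> {l..u}" if "infinite B" "B \<subseteq> tail_min" for B j l u
  proof (rule ccontr)
    assume "\<not> ?thesis"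
    then have "B \<subseteq> {..j} \<union> {n \<in> tail_min. l \<le> level n \<and> level n \<le> u}" using that(2) by force
    moreover have "finite ({..j} \<union> {n \<in> tail_min. l \<le> level n \<and> level n \<le> u})" using finite_window[OF inj] by simp
    ultimately show False using that(1) finite_subset by blast
  qed
  have depth_le: "depth n \<le> depth n'" if "n \<in> tail_min" "n < n'" for n n'
    using that by (simp add: tail_min_def)
  show ?thesis
  proof (cases "infinite {n \<in> tail_min. level n < lo}")
    case True
    \<comment> \<open>The interval \<open>{1..0}\<close> is empty: only \<open>N < n\<close> is
      wanted here. In the next line, avoiding \<open>{level n..lo}\<close> means moving closer to
      infinity.\<close>
    obtain n where n: "n \<in> tail_min" "level n < lo" "N < n" using infinite_above[OF True, of N 1 0] by auto
    obtain n' where n': "n' \<in> tail_min" "level n' < lo" "n < n'" "level n' < level n"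
      using infinite_above[OF True, of n "level n" lo] by force
    have top: "rho n = D 0 (level n)"
    proof -
      obtain s where s: "s \<in> S" "absv (a n - s) < q powi (level n - 1)" using rho_near by blast
      have "q powi lo < q powi (level n - 1)" using n(2) by simp
      moreover have "absv (a n) \<le> max (absv (a n - s)) (absv s)" using abs_diff_triangle[of "a n" 0 s] by simp
      ultimately have "absv (a n) < q powi (level n - 1)" using s(2) S_small[OF s(1)] by linarith
      then have "absv (a n) \<le> q powi level n" using discrete[OF a_L, of n "level n - 1"] by simp
      then show ?thesis by (simp add: D_eq_iff level_def)
    qed
    \<comment> \<open>Positive depth makes the disk at \<open>rho n'\<close> avoid the marked point
      \<open>0\<close>. At depth zero \<open>x n'\<close> is \<open>rho n'\<close>, and comparing
      levels suffices.\<close>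
    have far: "q powi level n < absv (a n')" if "depth n' \<noteq> 0"
    proof -
      have "free (a n') (level n')" using free_iff_depth[of "depth n'" n'] that by (simp add: level_def)
      then have "q powi level n' \<le> absv (a n')" using zero_S by (force simp: free_def)
      moreover have "q powi level n < q powi level n'" using n'(4) by simp
      ultimately show ?thesis by linarith
    qed
    have "\<exists>G B. trap G B \<and> x n' \<in> G \<and> (\<forall>s\<in>S. \<forall>\<mu>. lo \<le> \<mu> \<longrightarrow> \<mu> \<le> hi \<longrightarrow> D s \<mu> \<notin> G)"
    proof (rule trap_of_direction[OF bd(3) n(1)])
      show "hi < level k \<or> level k < lo" if "k \<in> tail_min" "n \<le> k" for k using N that n(3) by simp
      show "n < n'" by (rule n')
      show "direction lo n 0 (disk_inf 0 (q powi level n))"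
        unfolding direction_def using top n(2) by (simp add: level_def)
      show ret: "anc n' (depth n) \<in> disk_inf 0 (q powi level n)"
      proof (cases "depth n' = 0")
        case True
        then have "m n' - int (depth n) = level n'" using depth_le[OF n(1) n'(3)] by (simp add: level_def)
        then have "q powi level n < q powi (m n' - int (depth n))" using n'(4) by simp
        then show ?thesis unfolding pt_in_disk_inf[OF q_VG] less_max_iff_disj by blast
      next
        case False
        then show ?thesis using far unfolding pt_in_disk_inf[OF q_VG] by simp
      qed
      show "x n' \<in> disk_inf 0 (q powi level n)"
      proof (cases "depth n' = 0")
        case True
        then have "m n' = level n'" by (simp add: level_def)
        then have "q powi level n < q powi m n'" using n'(4) by simp
        then show ?thesis unfolding x_eq pt_in_disk_inf[OF q_VG] less_max_iff_disj by blast
      next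
        case False
        then show ?thesis using far unfolding x_eq pt_in_disk_inf[OF q_VG] by simp
      qed
      fix U assume "direction lo n (n' - n) U"
      moreover have "n + (n' - n) = n'" using n'(3) by simp
      ultimately consider (aff) c where "U = disk c (q powi (m n' - int (depth n)))"
          "anc n' (depth n) = D c (m n' - int (depth n))"
          "m n' - int (depth n) < lo \<longrightarrow> q powi (m n' - int (depth n)) \<le> absv c"
        | (inf) "U = disk_inf 0 (q powi (m n' - int (depth n)))" "anc n' (depth n) = D 0 (m n' - int (depth n))"
        unfolding direction_def by metis
      then show "U \<subseteq> disk_inf 0 (q powi level n)"
      proof cases
        case aff
        define r where "r = q powi (m n' - int (depth n))"
        have gt: "q powi level n < max r (absv c)" using ret unfolding aff(2) pt_in_disk_inf[OF q_VG] by (simp add: r_def)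
        have "r \<le> absv c"
        proof (cases "m n' - int (depth n) < lo")
          case True
          then show ?thesis using aff(3) by (simp add: r_def)
        next
          case False
          then have "r \<le> q powi lo" by (simp add: r_def)
          moreover have "q powi lo < q powi level n" using n(2) by simp
          ultimately show ?thesis using gt by linarith
        qed
        then have "\<xi> (lin 0) = absv c" if "\<xi> \<in> A1" "\<xi> (lin c) < r" for \<xi>
          using A1_lin_eq_abs[OF that(1), of c 0] that(2) by simp
        then show ?thesis using gt \<open>r \<le> absv c\<close> by (auto simp: aff(1) disk_def disk_inf_def r_def)
      next
        case inf
        have "q powi level n < q powi (m n' - int (depth n))"
          using ret unfolding inf(2) pt_in_disk_inf[OF q_VG] by simp
        from less_trans[OF this] show ?thesis by (auto simp: inf(1) disk_inf_def)
      qed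
    qed
    then show ?thesis by (rule key)
  next
    case False
    \<comment> \<open>By pigeonhole infinitely many tail minima have projections near the same
      marked point.\<close>
    define Bs where "Bs s = {n \<in> tail_min. hi < level n \<and> absv (a n - s) < q powi (level n - 1)}" for s
    have "infinite {n \<in> tail_min. hi < level n}" 
    proof
      assume "finite {n \<in> tail_min. hi < level n}"
      then have "finite ({n \<in> tail_min. lo \<le> level n \<and> level n \<le> hi} \<union> {n \<in> tail_min. hi < level n} \<union> {n \<in> tail_min. level n < lo})"
        using False fin by simp
      from finite_subset[OF tail_split this] show False using inf_tail by simp
    qed
    moreover have "{n \<in> tail_min. hi < level n} \<subseteq> (\<Union>s\<in>S. Bs s)" using rho_near by (auto simp: Bs_def)
    ultimately have "infinite (\<Union>s\<in>S. Bs s)" by (meson finite_subset)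
    then obtain s where s: "s \<in> S" "infinite (Bs s)" using finite_S by blast
    have BA: "Bs s \<subseteq> tail_min" by (auto simp: Bs_def)
    obtain n where "n \<in> Bs s" "N < n" using infinite_above[OF s(2) BA, of N 1 0] by auto
    then have n: "n \<in> tail_min" "hi < level n" "absv (a n - s) < q powi (level n - 1)" "N < n" by (auto simp: Bs_def)
    obtain n' where "n' \<in> Bs s" "n < n'" "level n' \<notin> {hi..level n}" using infinite_above[OF s(2) BA, of n hi "level n"] by auto
    then have n': "n' \<in> tail_min" "absv (a n' - s) < q powi (level n' - 1)" "n < n'" "level n < level n'" by (auto simp: Bs_def)
    have "q powi (level n' - 1) < q powi (level n - 1)" using n'(4) by simp
    then have "absv (a n - a n') < q powi (level n - 1)"
      using abs_diff_triangle[of "a n" "a n'" s] n(3) n'(2) unfolding abs_minus_commute[of s] by linarith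
    then have dist: "absv (a n - a n') \<le> q powi level n" using discrete[OF L_diff[OF a_L a_L], of n n' "level n - 1"] by simp
    \<comment> \<open>The depth of \<open>n'\<close> is at least that of \<open>n\<close>, so the
      ancestor of \<open>x n'\<close> at height \<open>depth n\<close> has level at least
      \<open>level n'\<close>.\<close>
    have level: "level n < m n' - int (depth n)" using n'(4) depth_le[OF n(1) n'(3)] by (simp add: level_def)
    have "\<exists>G B. trap G B \<and> x n' \<in> G \<and> (\<forall>s\<in>S. \<forall>\<mu>. lo \<le> \<mu> \<longrightarrow> \<mu> \<le> hi \<longrightarrow> D s \<mu> \<notin> G)"
    proof (rule trap_of_direction[OF bd(3) n(1)])
      show "hi < level k \<or> level k < lo" if "k \<in> tail_min" "n \<le> k" for k using N that n(4) by simp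
      show "n < n'" by (rule n')
      have "rho n = D (a n') (level n)" using dist by (simp add: D_eq_iff level_def)
      then show "direction lo n 0 (disk (a n') (q powi level n))"
        unfolding direction_def using n(2) \<open>lo \<le> hi\<close> by (auto simp: level_def)
      show "anc n' (depth n) \<in> disk (a n') (q powi level n)"
        unfolding pt_in_disk[OF q_VG] using level by simp
      show "x n' \<in> disk (a n') (q powi level n)" unfolding x_eq pt_in_disk[OF q_VG] using level by simp
      fix U assume "direction lo n (n' - n) U"
      moreover have "n + (n' - n) = n'" using n'(3) by simp
      ultimately consider (aff) c where "U = disk c (q powi (m n' - int (depth n)))"
          "anc n' (depth n) = D c (m n' - int (depth n))"
        | (inf) "m n' - int (depth n) < lo"
        unfolding direction_def by metis
      then show "U \<subseteq> disk (a n') (q powi level n)"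
      proof cases
        case aff
        have "absv (c - a n') \<le> q powi (m n' - int (depth n))"
          using aff(2) by (simp add: D_eq_iff abs_minus_commute[of c])
        moreover have lt: "q powi (m n' - int (depth n)) < q powi level n" using level by simp
        ultimately have "absv (c - a n') < q powi level n" by linarith
        then show ?thesis unfolding aff(1) using lt by (intro disk_mono) auto
      next
        case inf
        then show ?thesis using level n(2) \<open>lo \<le> hi\<close> by simp
      qed
    qed
    then show ?thesis by (rule key)
  qed
qed

theorem orbit_enters_trap:
  "\<exists>G B n. trap G B \<and> x n \<in> G \<and> (\<forall>s\<in>S. \<forall>\<mu>. l0 \<le> \<mu> \<longrightarrow> \<mu> \<le> u0 \<longrightarrow> D s \<mu> \<notin> G)"
proof (cases "inj_on rho tail_min")
  case True
  then show ?thesis by (rule trap_end)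
next
  case False
  then obtain n n' where n: "n \<in> tail_min" "n' \<in> tail_min" "n < n'" "rho n = rho n'"
    unfolding inj_on_def by (metis linorder_neqE_nat)
  then have "depth n \<le> depth n'" by (simp add: tail_min_def)
  then consider "depth n = depth n'" | "depth n < depth n'" by linarith
  then show ?thesis using trap_periodic[OF n] trap_contracting[OF n] by cases blast+
qed

end

section \<open>Assembling the stable vertex set\<close>

lemma finite_range_funpow:
  fixes f :: "'a \<Rightarrow> 'a"
  assumes "(f ^^ n) y = (f ^^ n') y" "n < n'"
  shows "finite (range (\<lambda>k. (f ^^ k) y))"
proof -
  have "(f ^^ k) y \<in> (\<lambda>k. (f ^^ k) y) ` {..<n'}" for k
  proof (induction k rule: less_induct)
    case (less k)
    show ?case
    proof (cases "k < n'")
      case False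
      define t where "t = k - n'"
      have "(f ^^ k) y = (f ^^ t) ((f ^^ n') y)" using False funpow_add[of t n' f] by (simp add: t_def)
      also have "\<dots> = (f ^^ (t + n)) y" by (simp add: assms(1)[symmetric] funpow_add)
      finally show ?thesis using less[of "t + n"] assms(2) False by (simp add: t_def)
    qed auto
  qed
  then have "range (\<lambda>k. (f ^^ k) y) \<subseteq> (\<lambda>k. (f ^^ k) y) ` {..<n'}" by auto
  then show ?thesis by (rule finite_subset) auto
qed

section \<open>Union of traps and the stable vertex set\<close>

context split_dynamics begin

lemma trap_empty: "trap {} {}"
proof -
  have "berk_P1 absv = disk_inf 0 1 \<union> disk 0 2"
    by (auto simp: berk_P1_def disk_inf_def disk_def)
  then have "openin PT (berk_P1 absv)" using openin_disk openin_disk_inf by auto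
  then show ?thesis by (simp add: trap_def)
qed

lemma trap_Un: assumes "trap G B" "trap G' B'" shows "trap (G \<union> G') (B \<union> B')"
proof -
  have "berk_P1 absv - ((G \<union> G') \<union> (B \<union> B')) = (berk_P1 absv - (G \<union> B)) \<inter> (berk_P1 absv - (G' \<union> B'))" by auto
  then have "openin PT (berk_P1 absv - ((G \<union> G') \<union> (B \<union> B')))" using assms by (auto simp: trap_def)
  then show ?thesis using assms unfolding trap_def image_Un by blast
qed

text \<open>The centres of the vertices are marked and \<open>l0\<close>, \<open>u0\<close> enclose
  their levels, so the traps of \<open>orbit_enters_trap\<close> miss every vertex. A finite orbit
  is served by the empty trap.\<close>

lemma common_trap:
  assumes fin: "finite \<Gamma>" and split_pts: "\<Gamma> \<subseteq> split_pts"
  obtains G B where "trap G B" "G \<inter> \<Gamma> = {}"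
    "\<And>\<gamma>. \<gamma> \<in> \<Gamma> \<Longrightarrow> finite (range (\<lambda>n. (fm ^^ n) \<gamma>)) \<or> (\<exists>n. (fm ^^ n) \<gamma> \<in> G)"
proof -
  obtain c \<mu> where c\<mu>: "\<And>\<gamma>. \<gamma> \<in> \<Gamma> \<Longrightarrow> c \<gamma> \<in> L \<and> \<gamma> = D (c \<gamma>) (\<mu> \<gamma>)"
  proof -
    have "\<forall>\<gamma>\<in>\<Gamma>. \<exists>p. fst p \<in> L \<and> \<gamma> = D (fst p) (snd p)" using split_pts by (fastforce simp: split_pts_def)
    from bchoice[OF this] obtain f where "\<forall>\<gamma>\<in>\<Gamma>. fst (f \<gamma>) \<in> L \<and> \<gamma> = D (fst (f \<gamma>)) (snd (f \<gamma>))" by blast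
    then show thesis using that[of "fst \<circ> f" "snd \<circ> f"] by simp
  qed
  define S where "S = insert 0 ({z. poly (P * Q * wronskian) z = 0} \<union> c ` \<Gamma>)"
  have "P \<noteq> 0" using nonconst[of 0] by simp
  then have "finite {z. poly (P * Q * wronskian) z = 0}" using Q_nz wronskian_nz by (intro poly_roots_finite) auto
  then interpret marked_dynamics absv P Q L q S
    using fin by unfold_locales (auto simp: S_def)
  define l0 u0 where "l0 = Min (\<mu> ` \<Gamma>)" and "u0 = Max (\<mu> ` \<Gamma>)"
  have "\<exists>G B. trap G B \<and> G \<inter> \<Gamma> = {} \<and> (finite (range (\<lambda>n. (fm ^^ n) \<gamma>)) \<or> (\<exists>n. (fm ^^ n) \<gamma> \<in> G))"
    if \<gamma>: "\<gamma> \<in> \<Gamma>" for \<gamma>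
  proof (cases "finite (range (\<lambda>n. (fm ^^ n) \<gamma>))")
    case True
    then show ?thesis using trap_empty by blast
  next
    case False
    have "(fm ^^ n) \<gamma> \<in> split_pts" for n using \<gamma> split_pts by (induction n) (auto intro: fm_split)
    then have "\<forall>n. \<exists>a m. a \<in> L \<and> (fm ^^ n) \<gamma> = D a m" unfolding split_pts_def by blast
    then obtain a m where am: "\<And>n. a n \<in> L" "\<And>n. (fm ^^ n) \<gamma> = D (a n) (m n)" by metis
    have "inj (\<lambda>n. (fm ^^ n) \<gamma>)" using finite_range_funpow[of _ fm \<gamma>] False by (intro linorder_injI) blast
    then interpret split_orbit absv P Q L q S "\<lambda>n. (fm ^^ n) \<gamma>" a m
      using am by unfold_locales auto
    obtain G B n where G: "trap G B" "(fm ^^ n) \<gamma> \<in> G"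
      "\<forall>s\<in>S. \<forall>\<nu>. l0 \<le> \<nu> \<longrightarrow> \<nu> \<le> u0 \<longrightarrow> D s \<nu> \<notin> G" using orbit_enters_trap[of l0 u0] by blast
    have "\<gamma>' \<notin> G" if "\<gamma>' \<in> \<Gamma>" for \<gamma>'
    proof -
      have "c \<gamma>' \<in> S" "l0 \<le> \<mu> \<gamma>'" "\<mu> \<gamma>' \<le> u0" using that fin by (auto simp: S_def l0_def u0_def)
      then have "D (c \<gamma>') (\<mu> \<gamma>') \<notin> G" using G(3) by blast
      then show ?thesis using c\<mu>[OF that] by simp
    qed
    then show ?thesis using G(1,2) by blast
  qed
  then obtain G B where GB: "\<And>\<gamma>. \<gamma> \<in> \<Gamma> \<Longrightarrow> trap (G \<gamma>) (B \<gamma>) \<and> G \<gamma> \<inter> \<Gamma> = {} \<and>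
      (finite (range (\<lambda>n. (fm ^^ n) \<gamma>)) \<or> (\<exists>n. (fm ^^ n) \<gamma> \<in> G \<gamma>))" by metis
  have "trap (\<Union>\<gamma>\<in>F. G \<gamma>) (\<Union>\<gamma>\<in>F. B \<gamma>)" if "F \<subseteq> \<Gamma>" for F
    using finite_subset[OF that fin] that
    by (induction F rule: finite_induct) (auto intro: trap_empty trap_Un simp: GB)
  from this[of \<Gamma>] have "trap (\<Union>\<gamma>\<in>\<Gamma>. G \<gamma>) (\<Union>\<gamma>\<in>\<Gamma>. B \<gamma>)" by simp
  moreover have "(\<Union>\<gamma>\<in>\<Gamma>. G \<gamma>) \<inter> \<Gamma> = {}" using GB by auto
  moreover have "finite (range (\<lambda>n. (fm ^^ n) \<gamma>)) \<or> (\<exists>n. (fm ^^ n) \<gamma> \<in> (\<Union>\<gamma>\<in>\<Gamma>. G \<gamma>))"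
    if "\<gamma> \<in> \<Gamma>" for \<gamma>
    using GB[OF that] that by blast
  ultimately show thesis by (rule that)
qed

theorem split_stabilisation:
  assumes fin: "finite \<Gamma>" and split_pts: "\<Gamma> \<subseteq> split_pts"
  obtains \<Gamma>' where "\<Gamma> \<subseteq> \<Gamma>'" "finite \<Gamma>'" "\<Gamma>' \<subseteq> split_pts" "analytically_stable absv P Q \<Gamma>'"
proof -
  obtain G B where GB: "trap G B" "G \<inter> \<Gamma> = {}"
    "\<And>\<gamma>. \<gamma> \<in> \<Gamma> \<Longrightarrow> finite (range (\<lambda>n. (fm ^^ n) \<gamma>)) \<or> (\<exists>n. (fm ^^ n) \<gamma> \<in> G)"
    using common_trap[OF fin split_pts] by metis
  \<comment> \<open>Boundary points inside \<open>G\<close> are dropped, since the new vertices must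
    stay out of \<open>G\<close>; the others still bound it. Each orbit is then cut off before its
    first entry into \<open>G\<close>.\<close>
  define Y where "Y = \<Gamma> \<union> (B - G)"
  define \<Gamma>' where "\<Gamma>' = (\<Union>y\<in>Y. {(fm ^^ j) y | j. \<forall>i\<le>j. (fm ^^ i) y \<notin> G})"
  have Y: "finite Y" "Y \<subseteq> split_pts" "Y \<inter> G = {}"
    "\<And>y. y \<in> Y \<Longrightarrow> finite (range (\<lambda>n. (fm ^^ n) y)) \<or> (\<exists>n. (fm ^^ n) y \<in> G)"
    using GB fin split_pts by (auto simp: Y_def trap_def)
  have YG': "Y \<subseteq> \<Gamma>'"
  proof
    fix y assume "y \<in> Y"
    moreover from this have "\<forall>i\<le>0. (fm ^^ i) y \<notin> G" using Y(3) by auto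
    ultimately show "y \<in> \<Gamma>'" unfolding \<Gamma>'_def by (intro UN_I[of y] CollectI exI[of _ 0]) auto
  qed
  have G'G: "G \<inter> \<Gamma>' = {}" by (auto simp: \<Gamma>'_def)
  have "finite \<Gamma>'" unfolding \<Gamma>'_def
  proof (rule finite_UN_I[OF Y(1)])
    fix y assume "y \<in> Y"
    then show "finite {(fm ^^ j) y | j. \<forall>i\<le>j. (fm ^^ i) y \<notin> G}"
    proof (rule Y(4)[THEN disjE])
      assume "finite (range (\<lambda>n. (fm ^^ n) y))"
      then show ?thesis by (rule rev_finite_subset) auto
    next
      assume "\<exists>n. (fm ^^ n) y \<in> G"
      then obtain n where n: "(fm ^^ n) y \<in> G" by auto
      have "j < n" if "\<forall>i\<le>j. (fm ^^ i) y \<notin> G" for j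
        using that n by (meson not_less)
      then have "{(fm ^^ j) y | j. \<forall>i\<le>j. (fm ^^ i) y \<notin> G} \<subseteq> (\<lambda>j. (fm ^^ j) y) ` {..<n}" by auto
      then show ?thesis by (rule finite_subset) auto
    qed
  qed
  moreover have "\<Gamma>' \<subseteq> split_pts"
  proof -
    have "(fm ^^ j) y \<in> split_pts" if "y \<in> Y" for y j using that Y(2) by (induction j) (auto intro: fm_split)
    then show ?thesis by (auto simp: \<Gamma>'_def)
  qed
  moreover have "analytically_stable absv P Q \<Gamma>'"
    unfolding analytically_stable_def
  proof
    fix \<zeta> assume "\<zeta> \<in> \<Gamma>'"
    then obtain y j where y: "y \<in> Y" "\<zeta> = (fm ^^ j) y" "\<forall>i\<le>j. (fm ^^ i) y \<notin> G" by (auto simp: \<Gamma>'_def)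
    have nxt: "fm \<zeta> = (fm ^^ Suc j) y" by (simp add: y)
    show "fm \<zeta> \<in> \<Gamma>' \<or> (\<exists>U. F_domain absv P Q \<Gamma>' U \<and> fm \<zeta> \<in> U)"
    proof (cases "fm \<zeta> \<in> G")
      case True
      have "G \<union> (B - G) = G \<union> B" by auto
      then have "openin PT G" "openin PT (berk_P1 absv - (G \<union> (B - G)))" using GB(1) by (auto simp: trap_def)
      moreover have "B - G \<subseteq> \<Gamma>'" using YG' by (auto simp: Y_def)
      ultimately obtain U where U: "U \<in> Gamma_domains absv \<Gamma>'" "fm \<zeta> \<in> U" "U \<subseteq> G"
        using domain_subset[of G "B - G" \<Gamma>' "fm \<zeta>"] G'G True by blast
      have "(fm ^^ n) ` U \<subseteq> G" for n
        using U(3) GB(1) by (induction n) (auto simp: trap_def)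
      then have "F_domain absv P Q \<Gamma>' U" using U(1) G'G unfolding F_domain_def by blast
      then show ?thesis using U(2) by blast
    next
      case False
      then have "\<forall>i\<le>Suc j. (fm ^^ i) y \<notin> G" using y(3) nxt by (auto simp: le_Suc_eq)
      then have "fm \<zeta> \<in> \<Gamma>'" unfolding \<Gamma>'_def nxt using y(1) by blast
      then show ?thesis by blast
    qed
  qed
  ultimately show thesis using that YG' by (auto simp: Y_def)
qed

end

section \<open>Algebraic elements and finite extensions\<close>

text \<open>The field operations of the type as a record, so that the theory of finite extensions
  over explicit carriers applies to subsets of the type.\<close>

definition type_ring :: "'k::field ring" where
  "type_ring = \<lparr>carrier = UNIV, monoid.mult = (*), one = 1, ring.zero = 0, add = (+)\<rparr>"

lemma type_ring_simps:
  "carrier type_ring = UNIV" "x \<otimes>\<^bsub>type_ring\<^esub> y = x * y" "x \<oplus>\<^bsub>type_ring\<^esub> y = x + y"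
  "\<one>\<^bsub>type_ring\<^esub> = (1 :: 'k::field)" "\<zero>\<^bsub>type_ring\<^esub> = (0 :: 'k)" for x y :: "'k::field"
  by (simp_all add: type_ring_def)

lemma field_type_ring: "Ring.field (type_ring :: 'k::field ring)"
proof -
  have "\<exists>y. x + y = 0" for x :: 'k
    using add.right_inverse by blast
  moreover have "x \<noteq> 0 \<Longrightarrow> \<exists>y. x * y = 1" for x :: 'k
    by (rule exI[of _ "inverse x"]) auto
  ultimately show "Ring.field (type_ring :: 'k ring)"
    unfolding type_ring_def
    by unfold_locales (auto simp: algebra_simps Units_def add.right_inverse)
qed

lemma type_ring_nat_pow: "x [^]\<^bsub>type_ring\<^esub> (n :: nat) = x ^ n" for x :: "'k::field"
  by (induction n) (simp_all add: type_ring_simps nat_pow_def mult.commute)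

lemma type_ring_a_inv: "\<ominus>\<^bsub>type_ring\<^esub> x = - x" for x :: "'k::field"
proof -
  interpret TR: Ring.field "type_ring :: 'k ring" by (rule field_type_ring)
  show ?thesis by (rule TR.minus_equality) (auto simp: type_ring_simps)
qed

lemma type_ring_inv: "x \<noteq> 0 \<Longrightarrow> inv\<^bsub>type_ring\<^esub> x = inverse x" for x :: "'k::field"
proof -
  interpret TR: Ring.field "type_ring :: 'k ring" by (rule field_type_ring)
  show "x \<noteq> 0 \<Longrightarrow> inv\<^bsub>type_ring\<^esub> x = inverse x"
    by (rule TR.inv_char) (auto simp: type_ring_simps)
qed

lemma subfield_iff: "subfield K type_ring \<longleftrightarrow> is_subfield K" for K :: "'k::field set"
proof
  interpret TR: Ring.field "type_ring :: 'k ring" by (rule field_type_ring)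
  assume K: "subfield K type_ring"
  note sr = subringE[OF subfieldE(1)[OF K]]
  have "inverse x \<in> K" if "x \<in> K" for x
  proof (cases "x = 0")
    case False
    then show ?thesis using TR.subfield_m_inv(1)[OF K, of x] that by (simp add: type_ring_simps type_ring_inv)
  qed (use sr in \<open>simp add: type_ring_simps\<close>)
  moreover have "x - y \<in> K" if "x \<in> K" "y \<in> K" for x y
    using sr(7)[OF that(1) sr(5)[OF that(2)]] by (simp add: type_ring_simps type_ring_a_inv)
  ultimately show "is_subfield K"
    using sr unfolding is_subfield_def by (simp add: type_ring_simps)
next
  interpret TR: Ring.field "type_ring :: 'k ring" by (rule field_type_ring)
  assume K: "is_subfield K"
  have neg: "- x \<in> K" if "x \<in> K" for x
  proof -
    have "0 - x \<in> K" using K that unfolding is_subfield_def by blast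
    then show ?thesis by simp
  qed
  show "subfield K type_ring"
  proof (rule TR.subfieldI')
    show "subring K type_ring"
      using K neg by (intro TR.subringI) (auto simp: type_ring_simps type_ring_a_inv is_subfield_def)
    show "inv\<^bsub>type_ring\<^esub> k \<in> K" if "k \<in> K - {\<zero>\<^bsub>type_ring\<^esub>}" for k
      using K that by (auto simp: type_ring_simps type_ring_inv is_subfield_def)
  qed
qed

text \<open>Polynomials as lists start with the leading coefficient, whereas \<open>Poly\<close>
  starts with the constant one.\<close>

lemma eval_eq_poly: "ring.eval type_ring p x = poly (Poly (rev p)) x" for x :: "'k::field"
proof -
  interpret TR: Ring.field "type_ring :: 'k ring" by (rule field_type_ring)
  show ?thesis by (induction p) (auto simp: type_ring_simps type_ring_nat_pow Poly_snoc poly_monom)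
qed

text \<open>This is \<open>algebraic over K\<close> with the locale abbreviation
  \<open>algebraic\<close> expanded, for use outside the ring locale.\<close>

definition alg_over :: "'k::field set \<Rightarrow> 'k \<Rightarrow> bool" where
  "alg_over K x \<longleftrightarrow> ((\<lambda>K x. \<not> ring.transcendental type_ring K x) over K) x"

lemma alg_overI:
  fixes p :: "'k::field poly"
  assumes "p \<noteq> 0" "\<And>i. coeff p i \<in> K" "poly p x = 0"
  shows "alg_over K x"
  unfolding alg_over_def
proof -
  interpret TR: Ring.field "type_ring :: 'k ring" by (rule field_type_ring)
  show "(TR.algebraic over K) x"
  proof (rule TR.algebraicI)
  have "set (rev (coeffs p)) \<subseteq> K" using assms(2) by (auto simp: coeffs_def)
  moreover have "hd (rev (coeffs p)) \<noteq> 0" using assms(1) by (simp add: hd_rev last_coeffs_eq_coeff_degree)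
  ultimately show "rev (coeffs p) \<in> carrier (K[X]\<^bsub>type_ring\<^esub>)"
    by (simp add: univ_poly_def polynomial_def type_ring_simps)
  show "rev (coeffs p) \<noteq> []" using assms(1) by simp
  show "TR.eval (rev (coeffs p)) x = \<zero>\<^bsub>type_ring\<^esub>"
    using assms(3) by (simp add: eval_eq_poly type_ring_simps)
  qed
qed

lemma list_poly:
  fixes p :: "'k::field list"
  assumes "p \<in> carrier (K[X]\<^bsub>type_ring\<^esub>)" "p \<noteq> []" "0 \<in> K"
  shows "Poly (rev p) \<noteq> 0" "\<And>i. coeff (Poly (rev p)) i \<in> K" "degree (Poly (rev p)) = length p - 1"
proof -
  have p: "set p \<subseteq> K" "hd p \<noteq> 0" using assms by (auto simp: univ_poly_def polynomial_def type_ring_simps)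
  moreover obtain a p' where "p = a # p'" using assms(2) by (cases p) auto
  ultimately have cf: "coeffs (Poly (rev p)) = rev p" by (simp add: strip_while_def)
  show "Poly (rev p) \<noteq> 0" using cf assms(2) by (metis coeffs_0_eq_Nil rev_is_Nil_conv)
  show "degree (Poly (rev p)) = length p - 1" unfolding degree_eq_length_coeffs cf by simp
  show "coeff (Poly (rev p)) i \<in> K" for i
    using p(1) assms(3) nth_mem[of i "rev p"] by (auto simp: nth_default_def)
qed

lemma algebraic_closure_in:
  fixes K :: "'k::field set"
  assumes "is_subfield K"
  shows "is_subfield {x. alg_over K x}" "K \<subseteq> {x. alg_over K x}"
proof -
  interpret TR: Ring.field "type_ring :: 'k ring" by (rule field_type_ring)
  have K: "subfield K type_ring" using assms by (simp add: subfield_iff)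
  show "is_subfield {x. alg_over K x}"
    using TR.subfield_of_algebraics[OF K] by (simp add: type_ring_simps subfield_iff alg_over_def)
  show "K \<subseteq> {x. alg_over K x}" using TR.algebraic_self[OF subfieldE(1)[OF K]] by (auto simp: alg_over_def)
qed

text \<open>The bound \<open>n\<close> is the dimension of \<open>M\<close> over \<open>K\<close>,
  since the powers of \<open>x\<close> below the degree of its minimal polynomial are independent.
  Discreteness of the values of \<open>M\<close> will rest on its uniformity in
  \<open>x\<close>.\<close>

lemma finite_extension_exists:
  fixes K :: "'k::field set"
  assumes K: "is_subfield K" and xs: "\<And>x. x \<in> set xs \<Longrightarrow> alg_over K x"
  obtains M n where "is_subfield M" "K \<subseteq> M" "set xs \<subseteq> M"
    "ring.finite_dimension type_ring K M"
    "\<And>x. x \<in> M \<Longrightarrow> \<exists>p. p \<noteq> 0 \<and> (\<forall>i. coeff p i \<in> K) \<and> degree p \<le> n \<and> poly p x = 0"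
proof -
  interpret TR: Ring.field "type_ring :: 'k ring" by (rule field_type_ring)
  have K': "subfield K type_ring" using K by (simp add: subfield_iff)
  have xs': "\<And>x. x \<in> set xs \<Longrightarrow> (TR.algebraic over K) x" using xs by (simp add: alg_over_def)
  define M where "M = TR.finite_extension K xs"
  have carr: "set xs \<subseteq> carrier type_ring" by (simp add: type_ring_simps)
  have M: "subfield M type_ring" unfolding M_def by (rule TR.finite_extension_is_subfield[OF K' carr xs'])
  have fd: "TR.finite_dimension K M" unfolding M_def by (rule TR.finite_extension_finite_dimension(1)[OF K' carr xs'])
  then obtain n where n: "TR.dimension n K M" by blast
  show thesis
  proof (rule that[of M n])
    show "is_subfield M" using M by (simp add: subfield_iff)
    show "K \<subseteq> M" unfolding M_def by (rule TR.finite_extension_incl[OF subfieldE(3)[OF K'] carr])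
    show "set xs \<subseteq> M" unfolding M_def by (rule TR.finite_extension_mem[OF subfieldE(1)[OF K'] carr])
    show "TR.finite_dimension K M" by (rule fd)
    fix x assume x: "x \<in> M"
    have xc: "x \<in> carrier type_ring" by (simp add: type_ring_simps)
    have alg: "(TR.algebraic over K) x" by (rule TR.finite_dimension_imp_algebraic[OF K' subfieldE(1)[OF M] fd x])
    define I where "I = TR.Irr K x"
    have I: "I \<in> carrier (K[X]\<^bsub>type_ring\<^esub>)" "TR.eval I x = 0" "hd I = 1"
      using TR.IrrE[OF K' xc alg] by (auto simp: I_def type_ring_simps)
    have "I \<noteq> []"
      using TR.pirreducibleE(1)[OF subfieldE(1)[OF K'] TR.IrrE(1,2)[OF K' xc alg]] by (simp add: I_def)
    have zK: "0 \<in> K" using K by (simp add: is_subfield_def)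
    note lp = list_poly[OF I(1) \<open>I \<noteq> []\<close> zK]
    have ind: "TR.independent K (TR.exp_base x (length I - 1))" unfolding I_def by (rule TR.exp_base_independent[OF K' xc alg])
    have pw: "x [^]\<^bsub>type_ring\<^esub> (i::nat) \<in> M" for i
      using subringE(3,6)[OF subfieldE(1)[OF M]] x by (induction i) auto
    have "set (TR.exp_base x (length I - 1)) \<subseteq> M" unfolding TR.exp_base_def using pw by auto
    then have "length (TR.exp_base x (length I - 1)) \<le> n"
      by (rule TR.independent_length_le_dimension[OF K' n ind])
    then have "degree (Poly (rev I)) \<le> n" using lp(3) by (simp add: TR.exp_base_def)
    then show "\<exists>p. p \<noteq> 0 \<and> (\<forall>i. coeff p i \<in> K) \<and> degree p \<le> n \<and> poly p x = 0"
      using lp(1,2) I(2) by (intro exI[of _ "Poly (rev I)"]) (auto simp: eval_eq_poly)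
  qed
qed

text \<open>The coefficients lie in a finite extension \<open>M\<close>, the root in a finite
  extension of \<open>M\<close>, and the tower is finite over \<open>K\<close>.\<close>

lemma algebraic_root_algebraic:
  fixes p :: "'k::field poly"
  assumes K: "is_subfield K" and p: "p \<noteq> 0" "\<And>i. alg_over K (coeff p i)" "poly p x = 0"
  shows "alg_over K x"
proof -
  interpret TR: Ring.field "type_ring :: 'k ring" by (rule field_type_ring)
  have K': "subfield K type_ring" using K by (simp add: subfield_iff)
  have "alg_over K y" if "y \<in> set (coeffs p)" for y using that p(2) by (auto simp: coeffs_def split: if_splits)
  then obtain M where M: "is_subfield M" "K \<subseteq> M" "set (coeffs p) \<subseteq> M" "TR.finite_dimension K M"
    using finite_extension_exists[OF K, of "coeffs p"] by metis
  have M': "subfield M type_ring" using M(1) by (simp add: subfield_iff)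
  have "coeff p i \<in> M" for i
  proof (cases "coeff p i = 0")
    case True
    then show ?thesis using M(1) by (simp add: is_subfield_def)
  next
    case False
    then have "coeff p i \<in> set (coeffs p)" by (metis coeff_in_coeffs le_degree p(1))
    then show ?thesis using M(3) by blast
  qed
  then have "alg_over M x" using p by (intro alg_overI[of p]) auto
  then obtain E where E: "is_subfield E" "set [x] \<subseteq> E" "TR.finite_dimension M E"
    using finite_extension_exists[OF M(1), of "[x]"] by (metis list.set_intros(1) set_ConsD empty_iff empty_set)
  have "TR.finite_dimension K E" by (rule TR.telescopic_base_dim(1)[OF K' M' M(4) E(3)])
  moreover have "subfield E type_ring" using E(1) by (simp add: subfield_iff)
  ultimately show ?thesis unfolding alg_over_def
    using TR.finite_dimension_imp_algebraic[OF K', of E x] E(2) subfieldE(1) by auto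
qed

section \<open>Density of algebraic elements and discreteness of finite extensions\<close>

context nonarch_closed begin

lemma root_lower_bound:
  assumes "p \<noteq> 0" "\<And>c. poly p c = 0 \<Longrightarrow> e \<le> absv (x - c)" "0 \<le> e"
  shows "absv (lead_coeff p) * e ^ degree p \<le> absv (poly p x)"
  using assms(1,2)
proof (induction p rule: linear_factor_induct)
  case (mult c p)
  have "degree (lin c * p) = Suc (degree p)" using mult(1) by (simp add: degree_mult_eq)
  moreover have "lead_coeff (lin c * p) = lead_coeff p" by (subst lead_coeff_mult) simp
  moreover have "e * (absv (lead_coeff p) * e ^ degree p) \<le> absv (x - c) * absv (poly p x)"
    using mult assms(3) by (intro mult_mono) auto
  ultimately show ?case by (simp add: abs_mult mult.left_commute)
qed auto

context
  fixes L :: "'k set"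
  assumes L: "is_subfield L"
begin

definition near_alg :: "'k set" where
  "near_alg = {x. \<forall>e>0. \<exists>y. alg_over L y \<and> absv (x - y) < e}"

lemma near_algD: "x \<in> near_alg \<Longrightarrow> 0 < e \<Longrightarrow> \<exists>y. alg_over L y \<and> absv (x - y) < e"
  by (auto simp: near_alg_def)

lemma near_alg_subfield: "is_subfield near_alg"
proof -
  note alg = algebraic_closure_in(1)[OF L, unfolded is_subfield_def mem_Collect_eq]
  have alg_near: "x \<in> near_alg" if "alg_over L x" for x
    using that by (auto simp: near_alg_def intro!: exI[of _ x])
  have add: "x + y \<in> near_alg \<and> x - y \<in> near_alg \<and> x * y \<in> near_alg" if x: "x \<in> near_alg" and y: "y \<in> near_alg" for x y
  proof -
    have "\<exists>z. alg_over L z \<and> absv (x + y - z) < e" "\<exists>z. alg_over L z \<and> absv (x - y - z) < e"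
      "\<exists>z. alg_over L z \<and> absv (x * y - z) < e" if e: "0 < e" for e
    proof -
      \<comment> \<open>The first two bounds control the two parts of
        \<open>x * y - x' * y' = (x - x') * y + x' * (y - y')\<close>; the second uses
        \<open>absv x' \<le> 1 + absv x + e\<close>.\<close>
      define d where "d = min (e / (1 + absv y)) (min (e / (1 + absv x + e)) e)"
      have d: "0 < d" using e by (simp add: d_def add_pos_nonneg)
      obtain x' where x': "alg_over L x'" "absv (x - x') < d" using near_algD[OF x d] by auto
      obtain y' where y': "alg_over L y'" "absv (y - y') < d" using near_algD[OF y d] by auto
      have de: "d \<le> e" by (simp add: d_def)
      have "absv ((x - x') + (y - y')) < e"
        using abs_add_le_max[of "x - x'" "y - y'"] x'(2) y'(2) de by linarith
      moreover have "x + y - (x' + y') = (x - x') + (y - y')" by simp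
      ultimately have "absv (x + y - (x' + y')) < e" by (simp only:)
      then show "\<exists>z. alg_over L z \<and> absv (x + y - z) < e" using alg x' y' by blast
      have "absv ((x - x') - (y - y')) < e"
        using abs_diff_le_max[of "x - x'" "y - y'"] x'(2) y'(2) de by linarith
      moreover have "x - y - (x' - y') = (x - x') - (y - y')" by simp
      ultimately have "absv (x - y - (x' - y')) < e" by (simp only:)
      then show "\<exists>z. alg_over L z \<and> absv (x - y - z) < e" using alg x' y' by blast
      have 1: "absv (x - x') * absv y < e"
      proof -
        have "absv (x - x') * absv y \<le> absv (x - x') * (1 + absv y)" by (intro mult_left_mono) auto
        also have "\<dots> < d * (1 + absv y)" using x' by (intro mult_strict_right_mono) (auto simp: add_pos_nonneg)
        also have "\<dots> \<le> e / (1 + absv y) * (1 + absv y)" by (intro mult_right_mono) (auto simp: d_def)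
        also have "\<dots> = e" using abs_nonneg[of y] by (simp add: add_nonneg_eq_0_iff)
        finally show ?thesis .
      qed
      have 2: "absv x' * absv (y - y') < e"
      proof -
        have "absv x' \<le> max (absv x) (absv (x - x'))" using abs_diff_le_max[of x "x - x'"] by simp
        then have "absv x' \<le> 1 + absv x + e" using x' de e abs_nonneg[of x] by linarith
        moreover have pos: "0 < 1 + absv x + e" using e abs_nonneg[of x] by linarith
        ultimately have "absv x' * absv (y - y') \<le> (1 + absv x + e) * absv (y - y')" by (intro mult_right_mono) auto
        also have "\<dots> < (1 + absv x + e) * d" using y' pos by (intro mult_strict_left_mono) auto
        also have "\<dots> \<le> (1 + absv x + e) * (e / (1 + absv x + e))" using pos by (intro mult_left_mono) (auto simp: d_def)
        also have "\<dots> = e" using pos by simp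
        finally show ?thesis .
      qed
      have "x * y - x' * y' = (x - x') * y + x' * (y - y')" by (simp add: algebra_simps)
      then have "absv (x * y - x' * y') < e"
        using abs_add_le_max[of "(x - x') * y" "x' * (y - y')"] 1 2 by (simp add: abs_mult)
      then show "\<exists>z. alg_over L z \<and> absv (x * y - z) < e" using alg x' y' by blast
    qed
    then show ?thesis by (auto simp: near_alg_def)
  qed
  have inv: "inverse x \<in> near_alg" if x: "x \<in> near_alg" for x
  proof (cases "x = 0")
    case True
    then show ?thesis using x by simp
  next
    case False
    have "\<exists>z. alg_over L z \<and> absv (inverse x - z) < e" if e: "0 < e" for e
    proof -
      \<comment> \<open>The first bound forces \<open>absv x' = absv x\<close>; the inverses then
        differ by \<open>absv (x - x') / (absv x * absv x)\<close>, which the second bound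
        controls.\<close>
      have "0 < min (absv x) (e * (absv x * absv x))" using False e by simp
      from near_algD[OF x this] obtain x' where x': "alg_over L x'" "absv (x - x') < absv x"
        "absv (x - x') < e * (absv x * absv x)" by auto
      have eq: "absv x' = absv x" using abs_diff_eq_left[of "x - x'" x] x'(2) by simp
      then have "x' \<noteq> 0" using False by auto
      then have "inverse x - inverse x' = (x' - x) / (x * x')" using False by (simp add: field_simps)
      then have "absv (inverse x - inverse x') = absv (x - x') / (absv x * absv x)"
        by (simp add: abs_divide abs_mult eq abs_minus_commute[of x'])
      also have "\<dots> < e" using x'(3) False by (simp add: pos_divide_less_eq)
      finally show ?thesis using alg x'(1) by blast
    qed
    then show ?thesis by (auto simp: near_alg_def)
  qed
  show ?thesis unfolding is_subfield_def using alg_near alg add inv by blast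
qed

lemma near_alg_complete:
  assumes "complete_wrt absv UNIV"
  shows "complete_wrt absv near_alg"
  unfolding complete_wrt_def
proof (intro allI impI)
  fix Y :: "nat \<Rightarrow> 'k"
  assume Y: "\<forall>n. Y n \<in> near_alg" and cauchy: "\<forall>e>0. \<exists>N. \<forall>m\<ge>N. \<forall>n\<ge>N. absv (Y m - Y n) < e"
  then obtain x where x: "(\<lambda>n. absv (Y n - x)) \<longlonglongrightarrow> 0" using assms unfolding complete_wrt_def by blast
  have "\<exists>y. alg_over L y \<and> absv (x - y) < e" if e: "0 < e" for e
  proof -
    obtain n where n: "absv (Y n - x) < e" using order_tendstoD(2)[OF x e] by (auto simp: eventually_sequentially)
    obtain y where y: "alg_over L y" "absv (Y n - y) < e" using Y near_algD[OF _ e] by blast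
    then have "absv (x - y) < e" using abs_diff_triangle[of x y "Y n"] n by (simp add: abs_minus_commute[of x])
    then show ?thesis using y by blast
  qed
  then show "\<exists>x\<in>near_alg. (\<lambda>n. absv (Y n - x)) \<longlonglongrightarrow> 0" using x by (auto simp: near_alg_def)
qed

text \<open>Continuity of roots: a root of a polynomial is approximated by roots of nearby
  polynomials with algebraic coefficients.\<close>
lemma near_alg_closed: "alg_closed_in near_alg"
  unfolding alg_closed_in_def
proof (intro allI impI)
  fix p :: "'k poly" assume p: "\<forall>i. coeff p i \<in> near_alg" "1 \<le> degree p"
  obtain x where x: "poly p x = 0" using alg_closed p(2) unfolding alg_closed_in_def by blast
  define d where "d = degree p"
  have lc: "lead_coeff p \<noteq> 0" using p(2) by auto
  have "\<exists>y. alg_over L y \<and> absv (x - y) < e" if e: "0 < e" for e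
  proof (rule ccontr)
    assume no: "\<nexists>y. alg_over L y \<and> absv (x - y) < e"
    define B where "B = max 1 (absv x) ^ d"
    have B: "1 \<le> B" by (simp add: B_def)
    \<comment> \<open>The first bound preserves the absolute value of the leading coefficient, hence
      the degree; the second makes \<open>absv (poly r x)\<close> too small for all roots of
      \<open>r\<close> to stay at distance \<open>e\<close> from \<open>x\<close>.\<close>
    define \<delta> where "\<delta> = min (absv (lead_coeff p)) (absv (lead_coeff p) * e ^ d / (2 * B))"
    have \<delta>: "0 < \<delta>" using lc e B by (simp add: \<delta>_def)
    have "\<exists>y. alg_over L y \<and> absv (coeff p i - y) < \<delta>" for i using near_algD p(1) \<delta> by blast
    then obtain g where g: "\<And>i. alg_over L (g i)" "\<And>i. absv (coeff p i - g i) < \<delta>" by metis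
    define r where "r = (\<Sum>i\<le>d. monom (g i) i)"
    have coeff_r: "coeff r i = (if i \<le> d then g i else 0)" for i
      by (simp add: r_def coeff_sum if_distrib cong: if_cong)
    have "absv (lead_coeff p - g d) < absv (lead_coeff p)" using g(2)[of d] by (simp add: \<delta>_def d_def)
    then have gd: "absv (g d) = absv (lead_coeff p)"
      using abs_diff_eq_left[of "lead_coeff p - g d" "lead_coeff p"] by simp
    then have gd0: "g d \<noteq> 0" using lc by auto
    have deg_r: "degree r = d"
      using gd0 by (intro antisym degree_le le_degree) (auto simp: coeff_r)
    have r0: "r \<noteq> 0" using gd0 coeff_r[of d] by auto
    have "alg_over L 0" using algebraic_closure_in(1)[OF L] by (simp add: is_subfield_def)
    then have "alg_over L (coeff r i)" for i using g(1) by (simp add: coeff_r)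
    then have "alg_over L c" if "poly r c = 0" for c using algebraic_root_algebraic[OF L r0 _ that] by blast
    then have far: "e \<le> absv (x - c)" if "poly r c = 0" for c using no that by force
    have "absv (lead_coeff r) * e ^ degree r \<le> absv (poly r x)"
      using far e by (intro root_lower_bound[OF r0]) auto
    then have low: "absv (lead_coeff p) * e ^ d \<le> absv (poly r x)" by (simp add: deg_r coeff_r gd)
    have "poly r x = poly (r - p) x" using x by simp
    also have "\<dots> = (\<Sum>i\<le>d. coeff (r - p) i * x ^ i)"
    proof -
      have "degree (r - p) \<le> d" using degree_diff_le_max[of r p] by (simp add: deg_r d_def)
      then have "(\<Sum>i\<le>degree (r - p). coeff (r - p) i * x ^ i) = (\<Sum>i\<le>d. coeff (r - p) i * x ^ i)"
        by (intro sum.mono_neutral_left) (auto simp: coeff_eq_0 simp del: coeff_diff)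
      then show ?thesis by (simp only: poly_altdef)
    qed
    also have "absv \<dots> \<le> \<delta> * B"
    proof (rule abs_sum_le)
      fix i assume i: "i \<in> {..d}"
      have "absv (coeff (r - p) i) \<le> \<delta>" using g(2)[of i] i by (simp add: coeff_r abs_minus_commute[of "g i"] less_imp_le)
      moreover have "absv x ^ i \<le> B"
      proof -
        have "absv x ^ i \<le> max 1 (absv x) ^ i" by (intro power_mono) auto
        also have "\<dots> \<le> B" unfolding B_def using i by (intro power_increasing) auto
        finally show ?thesis .
      qed
      ultimately show "absv (coeff (r - p) i * x ^ i) \<le> \<delta> * B"
        unfolding abs_mult abs_power using \<delta> by (intro mult_mono) auto
    qed (use \<delta> B in simp)
    also have "\<dots> \<le> absv (lead_coeff p) * e ^ d / (2 * B) * B" using B by (intro mult_right_mono) (auto simp: \<delta>_def)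
    also have "\<dots> < absv (lead_coeff p) * e ^ d" using B lc e by simp
    finally show False using low by simp
  qed
  then show "\<exists>x\<in>near_alg. poly p x = 0" using x by (auto simp: near_alg_def)
qed

lemma algebraic_dense:
  assumes "minimal_CAC_extension absv L" "0 < e"
  obtains y where "alg_over L y" "absv (x - y) < e"
proof -
  have "L \<subseteq> near_alg" using algebraic_closure_in(2)[OF L] by (force simp: near_alg_def)
  then have "near_alg = UNIV"
    using assms(1) near_alg_subfield near_alg_complete near_alg_closed unfolding minimal_CAC_extension_def by blast
  then show thesis using near_algD[of x e] assms(2) that by auto
qed

end

text \<open>Terms with sum zero attain their maximal absolute value at least twice; comparing two
  such terms expresses a power of \<open>absv x\<close> by coefficients.\<close>

lemma value_of_algebraic:
  assumes L: "is_subfield L" and p: "p \<noteq> 0" "\<And>i. coeff p i \<in> L" "poly p x = 0" and x: "x \<noteq> 0"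
  shows "\<exists>j\<ge>1. j \<le> degree p \<and> absv x ^ j \<in> value_group absv L"
proof -
  define t where "t i = coeff p i * x ^ i" for i
  define I where "I = {..degree p}"
  define B where "B = Max ((\<lambda>i. absv (t i)) ` I)"
  have I: "finite I" "I \<noteq> {}" by (auto simp: I_def)
  then have "B \<in> (\<lambda>i. absv (t i)) ` I" unfolding B_def by (intro Max_in) auto
  then obtain i0 where i0: "i0 \<in> I" "absv (t i0) = B" by auto
  have leB: "absv (t i) \<le> B" if "i \<in> I" for i using that I by (simp add: B_def)
  have "t (degree p) \<noteq> 0" using p x by (simp add: t_def)
  then have Bpos: "0 < B" using leB[of "degree p"] by (metis I_def abs_pos_iff atMost_iff less_le_trans order_refl)
  have sum0: "(\<Sum>i\<in>I. t i) = 0" using p(3) by (simp add: poly_altdef t_def I_def)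
  have "\<exists>i1\<in>I. i1 \<noteq> i0 \<and> absv (t i1) = B"
  proof (rule ccontr)
    assume *: "\<not> ?thesis"
    define J where "J = I - {i0}"
    have lt: "absv (t i) < B" if "i \<in> J" for i using * leB[of i] that by (force simp: J_def)
    have "absv (sum t J) < B"
    proof (cases "J = {}")
      case False
      have "finite J" using I by (simp add: J_def)
      then have "absv (sum t J) \<le> Max ((\<lambda>i. absv (t i)) ` J)"
        using False by (intro abs_sum_le) (auto simp: Max_ge_iff)
      also have "\<dots> < B" using lt False \<open>finite J\<close> by (subst Max_less_iff) auto
      finally show ?thesis .
    qed (use Bpos in simp)
    moreover have "sum t J = - t i0" using sum0 I i0 by (simp add: J_def sum.remove[of I i0] add_eq_0_iff)
    ultimately show False using i0 by simp
  qed
  then obtain i1 where i1: "i1 \<in> I" "i1 \<noteq> i0" "absv (t i1) = B" by auto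
  have main: "\<exists>j\<ge>1. j \<le> degree p \<and> absv x ^ j \<in> value_group absv L"
    if ij: "i < j" "j \<le> degree p" "absv (t i) = B" "absv (t j) = B" for i j
  proof -
    have "t i \<noteq> 0" "t j \<noteq> 0" using ij Bpos by auto
    then have nz: "coeff p i \<noteq> 0" "coeff p j \<noteq> 0" by (auto simp: t_def)
    have "absv x ^ j = absv x ^ i * absv x ^ (j - i)" using ij(1) by (simp flip: power_add)
    then have "absv (coeff p i) * absv x ^ i = absv (coeff p j) * (absv x ^ i * absv x ^ (j - i))"
      using ij(3,4) by (simp add: t_def abs_mult abs_power)
    then have "absv (coeff p i) = absv (coeff p j) * absv x ^ (j - i)" using x by simp
    then have "absv x ^ (j - i) = absv (coeff p i * inverse (coeff p j))"
      unfolding abs_mult abs_inverse using nz by (simp add: field_simps)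
    moreover have "coeff p i * inverse (coeff p j) \<in> L" using L p(2) by (simp add: is_subfield_def)
    moreover have "coeff p i * inverse (coeff p j) \<noteq> 0" using nz by simp
    ultimately have "absv x ^ (j - i) \<in> value_group absv L" unfolding value_group_def by blast
    then show ?thesis using ij by (intro exI[of _ "j - i"]) auto
  qed
  show ?thesis
    using main[of i0 i1] main[of i1 i0] i0 i1 by (cases "i0 < i1") (auto simp: I_def)
qed

lemma value_group_discrete:
  assumes "discretely_valued absv L" "is_subfield L"
  obtains \<pi> where "\<pi> \<in> L" "0 < absv \<pi>" "absv \<pi> < 1" "value_group absv L = range (\<lambda>n :: int. absv \<pi> powi n)"
proof -
  obtain \<pi> where \<pi>: "\<pi> \<in> L" "0 < absv \<pi>" "absv \<pi> < 1" "\<forall>x\<in>L. x \<noteq> 0 \<longrightarrow> (\<exists>n::int. absv x = absv \<pi> powi n)"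
    using assms(1) by (auto simp: discretely_valued_def)
  have pow: "\<exists>c\<in>L. c \<noteq> 0 \<and> absv c = absv \<pi> powi n" for n
  proof -
    have p: "\<pi> ^ k \<in> L" for k using assms(2) \<pi>(1) by (induction k) (auto simp: is_subfield_def)
    have "\<pi> \<noteq> 0" using \<pi>(2) by auto
    show ?thesis
    proof (cases "0 \<le> n")
      case True
      then show ?thesis using p \<open>\<pi> \<noteq> 0\<close> by (intro bexI[of _ "\<pi> ^ nat n"]) (auto simp: abs_power power_int_def)
    next
      case False
      then show ?thesis using p \<open>\<pi> \<noteq> 0\<close> assms(2)
        by (intro bexI[of _ "inverse (\<pi> ^ nat (- n))"])
          (auto simp: abs_power abs_inverse power_int_def power_inverse is_subfield_def)
    qed
  qed
  have "value_group absv L = range (\<lambda>n :: int. absv \<pi> powi n)"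
  proof (intro subset_antisym subsetI)
    fix r assume "r \<in> value_group absv L"
    then show "r \<in> range (\<lambda>n :: int. absv \<pi> powi n)" using \<pi>(4) unfolding value_group_def by blast
  next
    fix r assume "r \<in> range (\<lambda>n :: int. absv \<pi> powi n)"
    then obtain n where "r = absv \<pi> powi n" by blast
    then show "r \<in> value_group absv L" using pow[of n] unfolding value_group_def by force
  qed
  then show thesis using that \<pi> by blast
qed

text \<open>Each value of \<open>M\<close> has a power with exponent between 1 and \<open>n\<close>
  in the value group of \<open>L\<close>, so \<open>fact n\<close> is a uniform exponent and the
  values embed in a cyclic group. An element of least positive exponent generates them by division
  with remainder.\<close>

lemma discretely_valued_extension:
  assumes L: "is_subfield L" "discretely_valued absv L"
    and M: "is_subfield M" "L \<subseteq> M"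
    and bounded: "\<And>x. x \<in> M \<Longrightarrow> \<exists>p. p \<noteq> 0 \<and> (\<forall>i. coeff p i \<in> L) \<and> degree p \<le> n \<and> poly p x = 0"
  shows "discretely_valued absv M"
proof -
  obtain \<pi> where \<pi>: "\<pi> \<in> L" "0 < absv \<pi>" "absv \<pi> < 1" "value_group absv L = range (\<lambda>n :: int. absv \<pi> powi n)"
    using value_group_discrete[OF L(2,1)] by metis
  define q where "q = absv \<pi>"
  define N :: nat where "N = fact n"
  have N: "0 < N" by (simp add: N_def)
  have q: "0 < q" "q < 1" using \<pi> by (auto simp: q_def)
  have inj: "i = j" if "q powi i = q powi j" for i j
    using that power_int_strict_decreasing[of i j q] power_int_strict_decreasing[of j i q] q
    by (metis less_irrefl linorder_neqE)
  have "\<exists>k::int. absv x ^ N = q powi k" if x: "x \<in> M" "x \<noteq> 0" for x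
  proof -
    obtain p where p: "p \<noteq> 0" "\<forall>i. coeff p i \<in> L" "degree p \<le> n" "poly p x = 0" using bounded[OF x(1)] by auto
    then obtain j where j: "1 \<le> j" "j \<le> n" "absv x ^ j \<in> value_group absv L"
      using value_of_algebraic[OF L(1) p(1) _ p(4) x(2)] by force
    then obtain k where k: "absv x ^ j = q powi k" unfolding \<pi>(4) q_def by auto
    have "j dvd N" unfolding N_def using j by (intro dvd_fact) auto
    then obtain i where "N = j * i" by (elim dvdE)
    then have "absv x ^ N = q powi (k * int i)" by (simp add: power_mult k power_int_mult)
    then show ?thesis by blast
  qed
  then obtain v where v: "\<And>x. x \<in> M \<Longrightarrow> x \<noteq> 0 \<Longrightarrow> absv x ^ N = q powi (v x :: int)" by metis
  have \<pi>M: "\<pi> \<in> M" "\<pi> \<noteq> 0" using \<pi> M by auto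
  have "q powi (v \<pi>) = q powi (int N)" using v[OF \<pi>M] by (simp add: q_def)
  then have "0 < v \<pi>" using inj N by fastforce
  define g where "g = (LEAST g. 0 < g \<and> (\<exists>x\<in>M. x \<noteq> 0 \<and> v x = int g))"
  have "0 < g \<and> (\<exists>x\<in>M. x \<noteq> 0 \<and> v x = int g)" unfolding g_def
    by (rule LeastI[of _ "nat (v \<pi>)"]) (use \<open>0 < v \<pi>\<close> \<pi>M in auto)
  then obtain u where g: "0 < g" and u: "u \<in> M" "u \<noteq> 0" "v u = int g" by auto
  have g_min: "g \<le> h" if "0 < h" "x \<in> M" "x \<noteq> 0" "v x = int h" for h x
    unfolding g_def using that by (intro Least_le) auto
  have uN: "absv u ^ N = q ^ g" using v[OF u(1,2)] u(3) by simp
  have "absv u < 1"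
  proof (rule ccontr)
    assume "\<not> absv u < 1"
    then have "1 \<le> absv u ^ N" by simp
    moreover have "q ^ g < 1" using q g by (simp add: power_less_one_iff)
    ultimately show False using uN by simp
  qed
  moreover have "\<exists>t::int. absv x = absv u powi t" if x: "x \<in> M" "x \<noteq> 0" for x
  proof -
    define t where "t = v x div int g"
    define r where "r = v x mod int g"
    have r: "0 \<le> r" "r < int g" using g by (auto simp: r_def)
    have "\<exists>w\<in>M. w \<noteq> 0 \<and> absv w = absv u powi t"
    proof -
      have p: "u ^ k \<in> M" for k using M(1) u(1) by (induction k) (auto simp: is_subfield_def)
      show ?thesis
      proof (cases "0 \<le> t")
        case True
        then show ?thesis using p u by (intro bexI[of _ "u ^ nat t"]) (auto simp: abs_power power_int_def)
      next
        case False
        then show ?thesis using p u M(1)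
          by (intro bexI[of _ "inverse (u ^ nat (- t))"])
            (auto simp: abs_power abs_inverse power_int_def power_inverse is_subfield_def)
      qed
    qed
    then obtain w where w: "w \<in> M" "w \<noteq> 0" "absv w = absv u powi t" by auto
    define y where "y = x * inverse w"
    have y: "y \<in> M" "y \<noteq> 0" using x w M(1) by (auto simp: y_def is_subfield_def)
    have wN: "absv w ^ N = q powi (int g * t)"
    proof -
      have "absv w ^ N = (absv u ^ N) powi t"
        unfolding w(3) by (metis power_int_mult power_int_of_nat mult.commute)
      also have "\<dots> = (q powi int g) powi t" using uN by simp
      finally show ?thesis by (simp only: power_int_mult)
    qed
    have "v x = int g * t + r" by (simp add: t_def r_def)
    then have "absv x ^ N = q powi (int g * t) * q powi r" using v[OF x] q by (simp add: power_int_add)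
    moreover have "absv y ^ N = absv x ^ N / absv w ^ N" by (simp add: y_def abs_mult abs_inverse power_mult_distrib power_inverse divide_inverse)
    ultimately have "absv y ^ N = q powi r" using wN q by simp
    then have "v y = r" using v[OF y] inj by metis
    then have "r = 0" using g_min[of "nat r" y] y r by force
    then have "absv y ^ N = 1" using \<open>absv y ^ N = q powi r\<close> by simp
    then have "absv y = 1" using N abs_nonneg[of y] by (metis power_eq_1_iff real_norm_def abs_of_nonneg less_irrefl)
    then have "absv x = absv w" unfolding y_def abs_mult abs_inverse using w(2) by (simp add: field_simps)
    then show ?thesis using w(3) by (intro exI[of _ t]) simp
  qed
  ultimately show ?thesis unfolding discretely_valued_def using u by (intro bexI[of _ u]) auto
qed

text \<open>A type II point does not change when its centre and the element representing its radius
  move by less than the radius, so both can be taken algebraic over \<open>L\<close>.\<close>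

lemma split_extension_exists:
  assumes L: "is_subfield L" "discretely_valued absv L" "minimal_CAC_extension absv L"
    and \<Gamma>: "finite \<Gamma>" "\<And>\<zeta>. \<zeta> \<in> \<Gamma> \<Longrightarrow> type_II absv \<zeta>"
  obtains M where "is_subfield M" "L \<subseteq> M" "discretely_valued absv M" "\<And>\<zeta>. \<zeta> \<in> \<Gamma> \<Longrightarrow> l_split absv M \<zeta>"
proof -
  have "\<exists>p. alg_over L (fst p) \<and> alg_over L (snd p) \<and> snd p \<noteq> 0 \<and> \<zeta> = pt (fst p) (absv (snd p))" if \<zeta>: "\<zeta> \<in> \<Gamma>" for \<zeta>
  proof -
    obtain a c where c: "c \<noteq> 0" "\<zeta> = pt a (absv c)"
      using \<Gamma>(2)[OF \<zeta>] by (auto simp: type_II_def value_group_def)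
    then have "0 < absv c" by simp
    obtain c' where c': "alg_over L c'" "absv (c - c') < absv c" using algebraic_dense[OF L(1,3) \<open>0 < absv c\<close>] by blast
    obtain a' where a': "alg_over L a'" "absv (a - a') < absv c" using algebraic_dense[OF L(1,3) \<open>0 < absv c\<close>] by blast
    have eq: "absv c' = absv c" using abs_diff_eq_left[of "c - c'" c] c'(2) by simp
    then have "c' \<noteq> 0" using c(1) by auto
    have "absv c \<in> VG" using c(1) by (auto simp: value_group_def)
    then have "\<zeta> = pt a' (absv c')" using c(2) a'(2) by (simp add: eq zeta_eq_iff)
    then show ?thesis using a' c' \<open>c' \<noteq> 0\<close> by (intro exI[of _ "(a', c')"]) auto
  qed
  then obtain f where f: "\<And>\<zeta>. \<zeta> \<in> \<Gamma> \<Longrightarrow> alg_over L (fst (f \<zeta>)) \<and> alg_over L (snd (f \<zeta>)) \<and>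
      snd (f \<zeta>) \<noteq> 0 \<and> \<zeta> = pt (fst (f \<zeta>)) (absv (snd (f \<zeta>)))" by metis
  obtain xs where xs: "set xs = (fst \<circ> f) ` \<Gamma> \<union> (snd \<circ> f) ` \<Gamma>"
    using finite_list[of "(fst \<circ> f) ` \<Gamma> \<union> (snd \<circ> f) ` \<Gamma>"] \<Gamma>(1) by auto
  have "alg_over L x" if "x \<in> set xs" for x using that f by (auto simp: xs)
  then obtain M n where M: "is_subfield M" "L \<subseteq> M" "set xs \<subseteq> M"
    "\<And>x. x \<in> M \<Longrightarrow> \<exists>p. p \<noteq> 0 \<and> (\<forall>i. coeff p i \<in> L) \<and> degree p \<le> n \<and> poly p x = 0"
    using finite_extension_exists[OF L(1), of xs] by metis
  show thesis
  proof (rule that[OF M(1,2)])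
    show "discretely_valued absv M" by (rule discretely_valued_extension[OF L(1,2) M(1,2,4)])
    fix \<zeta> assume "\<zeta> \<in> \<Gamma>"
    then have "fst (f \<zeta>) \<in> M" "snd (f \<zeta>) \<in> M" using M(3) by (auto simp: xs)
    then show "l_split absv M \<zeta>" using f[OF \<open>\<zeta> \<in> \<Gamma>\<close>] unfolding l_split_def value_group_def by blast
  qed
qed

lemma split_analytic_stabilisation:
  assumes L: "is_subfield L" "discretely_valued absv L"
    and PQ: "\<And>i. coeff P i \<in> L" "\<And>i. coeff Q i \<in> L" "Q \<noteq> 0" "coprime P Q" "max (degree P) (degree Q) \<ge> 1"
    and \<Gamma>: "vertex_set absv \<Gamma>" "\<And>\<zeta>. \<zeta> \<in> \<Gamma> \<Longrightarrow> l_split absv L \<zeta>"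
  obtains \<Gamma>' where "\<Gamma> \<subseteq> \<Gamma>'" "vertex_set absv \<Gamma>'" "analytically_stable absv P Q \<Gamma>'"
    "\<And>\<zeta>. \<zeta> \<in> \<Gamma>' \<Longrightarrow> l_split absv L \<zeta>"
proof -
  obtain \<pi> where \<pi>: "\<pi> \<in> L" "0 < absv \<pi>" "absv \<pi> < 1" "value_group absv L = range (\<lambda>n :: int. absv \<pi> powi n)"
    using value_group_discrete[OF L(2,1)] by metis
  interpret split_dynamics absv P Q L "absv \<pi>"
    using L PQ \<pi> by unfold_locales auto
  have split_iff: "l_split absv L \<zeta> \<longleftrightarrow> \<zeta> \<in> split_pts" for \<zeta>
    unfolding l_split_def \<pi>(4) split_pts_def by auto
  have "finite \<Gamma>" "\<Gamma> \<subseteq> split_pts" using \<Gamma> split_iff by (auto simp: vertex_set_def)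
  then obtain \<Gamma>' where \<Gamma>': "\<Gamma> \<subseteq> \<Gamma>'" "finite \<Gamma>'" "\<Gamma>' \<subseteq> split_pts" "analytically_stable absv P Q \<Gamma>'"
    using split_stabilisation by metis
  have "type_II absv \<zeta>" if "\<zeta> \<in> split_pts" for \<zeta>
    using that q_VG unfolding split_pts_def type_II_def by blast
  then have "vertex_set absv \<Gamma>'" using \<Gamma> \<Gamma>' by (auto simp: vertex_set_def)
  then show thesis using that \<Gamma>' split_iff by blast
qed

end

theorem theoremD:
  fixes absv :: "'k::field \<Rightarrow> real" and L :: "'k set" and P Q :: "'k poly"
  assumes "nonarch_abs absv"
    and "is_subfield L"
    and "discretely_valued absv L"
    and "residue_char_zero absv"
    and "minimal_CAC_extension absv L"
    and "\<forall>i. coeff P i \<in> L" and "\<forall>i. coeff Q i \<in> L"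
    and "Q \<noteq> 0" and "coprime P Q"
    and "max (degree P) (degree Q) \<ge> 2"
    and "vertex_set absv \<Gamma>"
  shows "(\<exists>\<Gamma>'. \<Gamma> \<subseteq> \<Gamma>' \<and> vertex_set absv \<Gamma>' \<and> analytically_stable absv P Q \<Gamma>') \<and>
         ((\<forall>\<zeta>\<in>\<Gamma>. l_split absv L \<zeta>) \<longrightarrow>
            (\<exists>\<Gamma>'. \<Gamma> \<subseteq> \<Gamma>' \<and> vertex_set absv \<Gamma>' \<and> analytically_stable absv P Q \<Gamma>' \<and>
                  (\<forall>\<zeta>\<in>\<Gamma>'. l_split absv L \<zeta>)))"
proof -
  interpret nonarch_closed absv
    using assms(1,4,5) by unfold_locales (auto simp: minimal_CAC_extension_def)
  have deg: "max (degree P) (degree Q) \<ge> 1" using assms(10) by linarith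
  have "finite \<Gamma>" "\<And>\<zeta>. \<zeta> \<in> \<Gamma> \<Longrightarrow> type_II absv \<zeta>" using assms(11) by (auto simp: vertex_set_def)
  \<comment> \<open>All given vertices are split over \<open>M\<close>, so the first claim is the
    split case with \<open>M\<close> in place of \<open>L\<close>.\<close>
  then obtain M where M: "is_subfield M" "L \<subseteq> M" "discretely_valued absv M" "\<And>\<zeta>. \<zeta> \<in> \<Gamma> \<Longrightarrow> l_split absv M \<zeta>"
    using split_extension_exists[OF assms(2,3,5)] by metis
  have "coeff P i \<in> M" "coeff Q i \<in> M" for i using assms(6,7) M(2) by auto
  then have "\<exists>\<Gamma>'. \<Gamma> \<subseteq> \<Gamma>' \<and> vertex_set absv \<Gamma>' \<and> analytically_stable absv P Q \<Gamma>'"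
    using split_analytic_stabilisation[OF M(1,3) _ _ assms(8,9) deg assms(11) M(4)] by metis
  moreover have "\<exists>\<Gamma>'. \<Gamma> \<subseteq> \<Gamma>' \<and> vertex_set absv \<Gamma>' \<and> analytically_stable absv P Q \<Gamma>' \<and>
      (\<forall>\<zeta>\<in>\<Gamma>'. l_split absv L \<zeta>)" if split: "\<forall>\<zeta>\<in>\<Gamma>. l_split absv L \<zeta>"
  proof -
    have "coeff P i \<in> L" "coeff Q i \<in> L" "\<zeta> \<in> \<Gamma> \<Longrightarrow> l_split absv L \<zeta>" for i \<zeta>
      using assms(6,7) split by auto
    from split_analytic_stabilisation[OF assms(2,3) this(1,2) assms(8,9) deg assms(11) this(3)]
    show ?thesis by metis
  qed
  ultimately show ?thesis by blast
qed

end
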